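(* Let $B$ be a compact Hausdorff space, $\mathcal G\to B$ a bundle of compact Lie groups, $Y\to B$ a compact $\mathcal G$-fiber bundle and $Y'\subset Y$ a closed $\mathcal G$-invariant sub-bundle. Then for every integer $n$ there is a natural isomorphism $$K^n_{\mathcal G}(Y,Y')\cong K^{n-2}_{\mathcal G}(Y,Y').$$
   Context: A bundle of compact Lie groups $\mathcal G\to B$ with typical fiber a compact Lie group $G$ is a locally trivial fiber bundle with structure group $\operatorname{Aut}(G)$. A $\mathcal G$-fiber bundle is a fiber bundle $Y\to B$ with a continuous fiberwise action $\mathcal G\times_BY\to Y$. Let $\mathcal E_{\mathcal G}(Y)$ be the category of finite-dimensional complex $\mathcal G$-equivariant vector bundles over $Y$ (total space with continuous $\mathcal G$-action, equivariant projection, linear action on fibers), with $\mathcal G$-equivariant bundle maps as morphisms; it is a Banach category (sup norms). $C^{p,q}$ denotes the Clifford algebra with anticommuting generators $e_1,\dots,e_{p+q}$, $e_i^2=-1$ for $i\le p$, $e_i^2=1$ for $i>p$. A $C^{p,q}$-module in $\mathcal E_{\mathcal G}(Y)$ is an object $E$ with a homomorphism $r:C^{p,q}\to\operatorname{End}(E)$ into its $\mathcal G$-equivariant endomorphisms. A grading of $E$ is a $\mathcal G$-equivariant endomorphism $\eta$ with $\eta^2=1$, $\eta r(e_i)=-r(e_i)\eta$ for all $i$. $K^{p,q}_{\mathcal G}(Y,Y')$ is the $K^{p,q}$-group of the restriction functor $\mathcal E_{\mathcal G}(Y)\to\mathcal E_{\mathcal G}(Y')$: the quotient of the free abelian group on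 triples $(E,\eta_1,\eta_2)$, where $E$ is a $C^{p,q}$-module in $\mathcal E_{\mathcal G}(Y)$ and $\eta_1,\eta_2$ are gradings of $E$ with $\eta_1|_{Y'}=\eta_2|_{Y'}$, by the relations $(E,\eta_1,\eta_2)+(F,\xi_1,\xi_2)=(E\oplus F,\eta_1\oplus\xi_1,\eta_2\oplus\xi_2)$ and $(E,\eta_1,\eta_2)=0$ if $\eta_1$ and $\eta_2$ are homotopic through gradings of $E$ having constant restriction to $Y'$. This group depends only on $p-q$, and $K^{n}_{\mathcal G}(Y,Y'):=K^{p,q}_{\mathcal G}(Y,Y')$ for $n=p-q$. *)

theory Defs
  imports "HOL-Analysis.Analysis" "HOL-Algebra.Coset" "HOL-Algebra.Generated_Groups"
    "HOL-Algebra.Free_Abelian_Groups"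
begin

section \<open>Compact Lie groups\<close>

text \<open>Real functions of class \<open>C\<^sup>k\<close> on an open subset \<open>U\<close> of \<open>\<real>\<^sup>n\<close>, defined by iterated continuous
  partial derivatives. Points of \<open>\<real>\<^sup>n\<close> are sequences vanishing from index \<open>n\<close> on, as in
  \<^const>\<open>Euclidean_space\<close>.\<close>

primrec Ck_on :: "nat \<Rightarrow> (nat \<Rightarrow> real) set \<Rightarrow> nat \<Rightarrow> ((nat \<Rightarrow> real) \<Rightarrow> real) \<Rightarrow> bool" where
  "Ck_on n U 0 f \<longleftrightarrow> continuous_map (subtopology (Euclidean_space n) U) euclideanreal f"
| "Ck_on n U (Suc k) f \<longleftrightarrow>
     continuous_map (subtopology (Euclidean_space n) U) euclideanreal f \<and>
     (\<forall>i<n. \<exists>f'. (\<forall>x\<in>U. ((\<lambda>t. f (x(i := t))) has_real_derivative f' x) (at (x i))) \<and> Ck_on n U k f')"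

definition smooth_map_on ::
  "nat \<Rightarrow> nat \<Rightarrow> (nat \<Rightarrow> real) set \<Rightarrow> ((nat \<Rightarrow> real) \<Rightarrow> nat \<Rightarrow> real) \<Rightarrow> bool" where
  "smooth_map_on n m U F \<longleftrightarrow> F ` U \<subseteq> topspace (Euclidean_space m) \<and> (\<forall>k. \<forall>j<m. Ck_on n U k (\<lambda>x. F x j))"

definition smooth_atlas :: "'h topology \<Rightarrow> nat \<Rightarrow> ('h set \<times> ('h \<Rightarrow> nat \<Rightarrow> real)) set \<Rightarrow> bool" where
  "smooth_atlas T n A \<longleftrightarrow>
     (\<forall>(U, \<phi>)\<in>A. openin T U \<and> openin (Euclidean_space n) (\<phi> ` U) \<and>
        homeomorphic_map (subtopology T U) (subtopology (Euclidean_space n) (\<phi> ` U)) \<phi>) \<and>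
     topspace T = \<Union> (fst ` A) \<and>
     (\<forall>(U, \<phi>)\<in>A. \<forall>(V, \<psi>)\<in>A. smooth_map_on n n (\<phi> ` (U \<inter> V)) (\<lambda>x. \<psi> (inv_into U \<phi> x)))"

text \<open>\<open>\<real>\<^sup>2\<^sup>n = \<real>\<^sup>n \<times> \<real>\<^sup>n\<close>: first and last \<open>n\<close> coordinates.\<close>

definition coords_fst :: "nat \<Rightarrow> (nat \<Rightarrow> real) \<Rightarrow> nat \<Rightarrow> real" where
  "coords_fst n z = (\<lambda>i. if i < n then z i else 0)"

definition coords_snd :: "nat \<Rightarrow> (nat \<Rightarrow> real) \<Rightarrow> nat \<Rightarrow> real" where
  "coords_snd n z = (\<lambda>i. z (i + n))"

text \<open>A Lie group is homogeneous, so all its charts can be taken in one \<open>\<real>\<^sup>n\<close>; second countability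
  follows from compactness. The case \<open>n = 0\<close> gives the finite groups.\<close>

definition compact_lie_group :: "'h monoid \<Rightarrow> 'h topology \<Rightarrow> bool" where
  "compact_lie_group H T \<longleftrightarrow>
     group H \<and> carrier H = topspace T \<and> compact_space T \<and> Hausdorff_space T \<and>
     continuous_map (prod_topology T T) T (\<lambda>(x, y). x \<otimes>\<^bsub>H\<^esub> y) \<and>
     continuous_map T T (\<lambda>x. inv\<^bsub>H\<^esub> x) \<and>
     (\<exists>n A. smooth_atlas T n A \<and>
       (\<forall>(U, \<phi>)\<in>A. \<forall>(V, \<psi>)\<in>A. \<forall>(W, \<theta>)\<in>A.
          smooth_map_on (2 * n) n
            {z \<in> topspace (Euclidean_space (2 * n)).
               coords_fst n z \<in> \<phi> ` U \<and> coords_snd n z \<in> \<psi> ` V \<and>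
               inv_into U \<phi> (coords_fst n z) \<otimes>\<^bsub>H\<^esub> inv_into V \<psi> (coords_snd n z) \<in> W}
            (\<lambda>z. \<theta> (inv_into U \<phi> (coords_fst n z) \<otimes>\<^bsub>H\<^esub> inv_into V \<psi> (coords_snd n z)))) \<and>
       (\<forall>(U, \<phi>)\<in>A. \<forall>(V, \<psi>)\<in>A.
          smooth_map_on n n {x \<in> \<phi> ` U. inv\<^bsub>H\<^esub> (inv_into U \<phi> x) \<in> V}
            (\<lambda>x. \<psi> (inv\<^bsub>H\<^esub> (inv_into U \<phi> x)))))"

section \<open>Bundles of compact Lie groups and their actions\<close>

record ('g, 'b) group_bundle =
  gb_total :: "'g topology"
  gb_proj  :: "'g \<Rightarrow> 'b"
  gb_mult  :: "'g \<Rightarrow> 'g \<Rightarrow> 'g"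
  gb_one   :: "'b \<Rightarrow> 'g"

definition gb_fibre :: "('g, 'b) group_bundle \<Rightarrow> 'b \<Rightarrow> 'g monoid" where
  "gb_fibre GG b = \<lparr>carrier = {g \<in> topspace (gb_total GG). gb_proj GG g = b},
                    monoid.mult = gb_mult GG, one = gb_one GG b\<rparr>"

text \<open>The structure group \<open>Aut(G)\<close> is encoded by requiring the local trivializations to be fibrewise
  group isomorphisms; the transition functions then take values in \<open>Aut(G)\<close>, and they are continuous
  for the compact-open topology because \<open>G\<close> is compact. The typical fibre may be taken on the same
  type as the total space, since it is isomorphic to the actual fibres.\<close>

definition lie_group_bundle :: "'b topology \<Rightarrow> ('g, 'b) group_bundle \<Rightarrow> bool" where
  "lie_group_bundle B GG \<longleftrightarrow>
     continuous_map (gb_total GG) B (gb_proj GG) \<and>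
     (\<forall>b\<in>topspace B. group (gb_fibre GG b)) \<and>
     (\<exists>(H :: 'g monoid) T. compact_lie_group H T \<and>
        (\<forall>b\<in>topspace B. \<exists>U \<phi>. openin B U \<and> b \<in> U \<and>
           homeomorphic_map (subtopology (gb_total GG) {g. gb_proj GG g \<in> U})
             (prod_topology (subtopology B U) T) \<phi> \<and>
           (\<forall>c\<in>U. (\<forall>g\<in>carrier (gb_fibre GG c). fst (\<phi> g) = c) \<and>
                   (\<lambda>g. snd (\<phi> g)) \<in> iso (gb_fibre GG c) H)))"

definition fibre_bundle :: "'b topology \<Rightarrow> 'x topology \<Rightarrow> ('x \<Rightarrow> 'b) \<Rightarrow> bool" where
  "fibre_bundle B X \<pi> \<longleftrightarrow>
     continuous_map X B \<pi> \<and>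
     (\<exists>F :: 'x topology. \<forall>b\<in>topspace B. \<exists>U \<phi>. openin B U \<and> b \<in> U \<and>
        homeomorphic_map (subtopology X {x. \<pi> x \<in> U}) (prod_topology (subtopology B U) F) \<phi> \<and>
        (\<forall>x\<in>topspace X. \<pi> x \<in> U \<longrightarrow> fst (\<phi> x) = \<pi> x))"

definition fibrewise_action ::
  "('g, 'b) group_bundle \<Rightarrow> 'x topology \<Rightarrow> ('x \<Rightarrow> 'b) \<Rightarrow> ('g \<Rightarrow> 'x \<Rightarrow> 'x) \<Rightarrow> bool" where
  "fibrewise_action GG X \<pi> a \<longleftrightarrow>
     continuous_map
       (subtopology (prod_topology (gb_total GG) X) {(g, x). gb_proj GG g = \<pi> x}) X (\<lambda>(g, x). a g x) \<and>
     (\<forall>x\<in>topspace X. a (gb_one GG (\<pi> x)) x = x \<and>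
        (\<forall>g\<in>carrier (gb_fibre GG (\<pi> x)). \<pi> (a g x) = \<pi> x \<and>
           (\<forall>h\<in>carrier (gb_fibre GG (\<pi> x)). a (gb_mult GG h g) x = a h (a g x))))"

record ('y, 'g, 'b) gspace =
  gs_total :: "'y topology"
  gs_proj  :: "'y \<Rightarrow> 'b"
  gs_act   :: "'g \<Rightarrow> 'y \<Rightarrow> 'y"

definition g_fibre_bundle :: "'b topology \<Rightarrow> ('g, 'b) group_bundle \<Rightarrow> ('y, 'g, 'b) gspace \<Rightarrow> bool" where
  "g_fibre_bundle B GG Y \<longleftrightarrow>
     fibre_bundle B (gs_total Y) (gs_proj Y) \<and>
     fibrewise_action GG (gs_total Y) (gs_proj Y) (gs_act Y)"

definition g_invariant :: "('g, 'b) group_bundle \<Rightarrow> ('y, 'g, 'b) gspace \<Rightarrow> 'y set \<Rightarrow> bool" where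
  "g_invariant GG Y Y' \<longleftrightarrow> (\<forall>y\<in>Y'. \<forall>g\<in>carrier (gb_fibre GG (gs_proj Y y)). gs_act Y g y \<in> Y')"

definition compact_pair ::
  "'b topology \<Rightarrow> ('g, 'b) group_bundle \<Rightarrow> ('y, 'g, 'b) gspace \<Rightarrow> 'y set \<Rightarrow> bool" where
  "compact_pair B GG Y Y' \<longleftrightarrow>
     g_fibre_bundle B GG Y \<and> compact_space (gs_total Y) \<and>
     closedin (gs_total Y) Y' \<and> g_invariant GG Y Y' \<and>
     g_fibre_bundle B GG (Y\<lparr>gs_total := subtopology (gs_total Y) Y'\<rparr>)"

definition pair_map ::
  "('g, 'b) group_bundle \<Rightarrow> ('y, 'g, 'b) gspace \<Rightarrow> 'y set \<Rightarrow> ('z, 'g, 'b) gspace \<Rightarrow> 'z set \<Rightarrow>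
     ('y \<Rightarrow> 'z) \<Rightarrow> bool" where
  "pair_map GG Y Y' Z Z' f \<longleftrightarrow>
     continuous_map (gs_total Y) (gs_total Z) f \<and> f ` Y' \<subseteq> Z' \<and>
     (\<forall>y\<in>topspace (gs_total Y). gs_proj Z (f y) = gs_proj Y y \<and>
        (\<forall>g\<in>carrier (gb_fibre GG (gs_proj Y y)). f (gs_act Y g y) = gs_act Z g (f y)))"

section \<open>Equivariant vector bundles\<close>

definition complex_space :: "nat \<Rightarrow> (nat \<Rightarrow> complex) topology" where
  "complex_space n = subtopology (product_topology (\<lambda>_. euclidean) UNIV) {v. \<forall>i\<ge>n. v i = 0}"

text \<open>The fibrewise addition and complex scalar multiplication are part of the structure; zero and
  negatives are determined by scalar multiplication.\<close>

record ('e, 'y, 'g) vbundle =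
  vb_total :: "'e topology"
  vb_proj  :: "'e \<Rightarrow> 'y"
  vb_add   :: "'e \<Rightarrow> 'e \<Rightarrow> 'e"
  vb_scale :: "complex \<Rightarrow> 'e \<Rightarrow> 'e"
  vb_act   :: "'g \<Rightarrow> 'e \<Rightarrow> 'e"

definition vb_fibre :: "('e, 'y, 'g) vbundle \<Rightarrow> 'y \<Rightarrow> 'e set" where
  "vb_fibre E y = {e \<in> topspace (vb_total E). vb_proj E e = y}"

text \<open>The local trivializations restrict to linear bijections of the fibres with \<open>\<complex>\<^sup>n\<close>; in particular
  the fibres are complex vector spaces. The rank is only locally constant.\<close>

definition vector_bundle :: "'y topology \<Rightarrow> ('e, 'y, 'g) vbundle \<Rightarrow> bool" where
  "vector_bundle Y E \<longleftrightarrow>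
     continuous_map (vb_total E) Y (vb_proj E) \<and>
     (\<forall>y\<in>topspace Y. \<exists>U n \<phi>. openin Y U \<and> y \<in> U \<and>
        homeomorphic_map (subtopology (vb_total E) {e. vb_proj E e \<in> U})
          (prod_topology (subtopology Y U) (complex_space n)) \<phi> \<and>
        (\<forall>z\<in>U. \<forall>e\<in>vb_fibre E z. fst (\<phi> e) = z \<and>
           (\<forall>e'\<in>vb_fibre E z. vb_add E e e' \<in> vb_fibre E z \<and>
              snd (\<phi> (vb_add E e e')) = (\<lambda>i. snd (\<phi> e) i + snd (\<phi> e') i)) \<and>
           (\<forall>c. vb_scale E c e \<in> vb_fibre E z \<and>
              snd (\<phi> (vb_scale E c e)) = (\<lambda>i. c * snd (\<phi> e) i))))"

definition g_vector_bundle ::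
  "('g, 'b) group_bundle \<Rightarrow> ('y, 'g, 'b) gspace \<Rightarrow> ('e, 'y, 'g) vbundle \<Rightarrow> bool" where
  "g_vector_bundle GG Y E \<longleftrightarrow>
     vector_bundle (gs_total Y) E \<and>
     fibrewise_action GG (vb_total E) (\<lambda>e. gs_proj Y (vb_proj E e)) (vb_act E) \<and>
     (\<forall>y\<in>topspace (gs_total Y). \<forall>g\<in>carrier (gb_fibre GG (gs_proj Y y)). \<forall>e\<in>vb_fibre E y.
        vb_proj E (vb_act E g e) = gs_act Y g y \<and>
        (\<forall>e'\<in>vb_fibre E y. vb_act E g (vb_add E e e') = vb_add E (vb_act E g e) (vb_act E g e')) \<and>
        (\<forall>c. vb_act E g (vb_scale E c e) = vb_scale E c (vb_act E g e)))"

definition g_bundle_map ::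
  "('g, 'b) group_bundle \<Rightarrow> ('y, 'g, 'b) gspace \<Rightarrow> ('e, 'y, 'g) vbundle \<Rightarrow> ('f, 'y, 'g) vbundle \<Rightarrow>
     ('e \<Rightarrow> 'f) \<Rightarrow> bool" where
  "g_bundle_map GG Y E F h \<longleftrightarrow>
     continuous_map (vb_total E) (vb_total F) h \<and>
     (\<forall>y\<in>topspace (gs_total Y). \<forall>e\<in>vb_fibre E y. vb_proj F (h e) = y \<and>
        (\<forall>e'\<in>vb_fibre E y. h (vb_add E e e') = vb_add F (h e) (h e')) \<and>
        (\<forall>c. h (vb_scale E c e) = vb_scale F c (h e)) \<and>
        (\<forall>g\<in>carrier (gb_fibre GG (gs_proj Y y)). h (vb_act E g e) = vb_act F g (h e)))"

definition whitney_sum ::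
  "('e, 'y, 'g) vbundle \<Rightarrow> ('f, 'y, 'g) vbundle \<Rightarrow> ('e \<times> 'f, 'y, 'g) vbundle" where
  "whitney_sum E F =
     \<lparr>vb_total = subtopology (prod_topology (vb_total E) (vb_total F)) {(e, f). vb_proj E e = vb_proj F f},
      vb_proj = (\<lambda>(e, f). vb_proj E e),
      vb_add = (\<lambda>(e, f) (e', f'). (vb_add E e e', vb_add F f f')),
      vb_scale = (\<lambda>c (e, f). (vb_scale E c e, vb_scale F c f)),
      vb_act = (\<lambda>g (e, f). (vb_act E g e, vb_act F g f))\<rparr>"

definition pullback_bundle ::
  "('y, 'g, 'b) gspace \<Rightarrow> ('y \<Rightarrow> 'z) \<Rightarrow> ('e, 'z, 'g) vbundle \<Rightarrow> ('y \<times> 'e, 'y, 'g) vbundle" where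
  "pullback_bundle Y f E =
     \<lparr>vb_total = subtopology (prod_topology (gs_total Y) (vb_total E)) {(y, e). f y = vb_proj E e},
      vb_proj = fst,
      vb_add = (\<lambda>(y, e) (y', e'). (y, vb_add E e e')),
      vb_scale = (\<lambda>c (y, e). (y, vb_scale E c e)),
      vb_act = (\<lambda>g (y, e). (gs_act Y g y, vb_act E g e))\<rparr>"

section \<open>Clifford algebras\<close>

text \<open>The real algebra \<open>C\<^sup>p\<^sup>,\<^sup>q\<close> in its standard basis \<open>e\<^sub>S = e\<^sub>i\<^sub>1 \<cdots> e\<^sub>i\<^sub>k\<close>, where \<open>S = {i\<^sub>1 < \<cdots> < i\<^sub>k} \<subseteq> {0..<p+q}\<close>:
  an element is the function \<open>S \<mapsto>\<close> coefficient of \<open>e\<^sub>S\<close>. Generators are numbered from \<open>0\<close>, with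
  square \<open>-1\<close> for \<open>i < p\<close> and \<open>1\<close> for \<open>p \<le> i\<close>. Reordering and cancelling gives
  \<open>e\<^sub>S e\<^sub>T = \<plusminus> e\<^bsub>S \<triangle> T\<^esub>\<close>, with one sign for each pair \<open>j < i\<close> with \<open>i \<in> S\<close>, \<open>j \<in> T\<close>, and one for each
  common generator of square \<open>-1\<close>.\<close>

type_synonym clifford = "nat set \<Rightarrow> real"

definition cl_carrier :: "nat \<Rightarrow> nat \<Rightarrow> clifford set" where
  "cl_carrier p q = {a. \<forall>S. \<not> S \<subseteq> {..<p + q} \<longrightarrow> a S = 0}"

definition cl_sign :: "nat \<Rightarrow> nat set \<Rightarrow> nat set \<Rightarrow> real" where
  "cl_sign p S T = (- 1) ^ card {(i, j). i \<in> S \<and> j \<in> T \<and> j < i} * (- 1) ^ card {i \<in> S \<inter> T. i < p}"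

definition cl_mult :: "nat \<Rightarrow> nat \<Rightarrow> clifford \<Rightarrow> clifford \<Rightarrow> clifford" where
  "cl_mult p q a b =
     (\<lambda>R. \<Sum>S\<in>Pow {..<p + q}. cl_sign p S (sym_diff S R) * a S * b (sym_diff S R))"

definition cl_basis :: "nat set \<Rightarrow> clifford" where
  "cl_basis S = (\<lambda>R. if R = S then 1 else 0)"

abbreviation cl_one :: clifford where "cl_one \<equiv> cl_basis {}"

abbreviation cl_gen :: "nat \<Rightarrow> clifford" where "cl_gen i \<equiv> cl_basis {i}"

lemma cl_mult_basis:
  assumes "S \<subseteq> {..<p + q}" "T \<subseteq> {..<p + q}"
  shows "cl_mult p q (cl_basis S) (cl_basis T) = (\<lambda>R. cl_sign p S T * cl_basis (sym_diff S T) R)"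
proof
  fix R :: "nat set"
  have "cl_mult p q (cl_basis S) (cl_basis T) R =
        (\<Sum>S'\<in>Pow {..<p + q}. if S' = S then cl_sign p S (sym_diff S R) * cl_basis T (sym_diff S R) else 0)"
    unfolding cl_mult_def by (rule sum.cong) (auto simp: cl_basis_def)
  also have "\<dots> = cl_sign p S (sym_diff S R) * cl_basis T (sym_diff S R)"
    using assms by simp
  also have "\<dots> = cl_sign p S T * cl_basis (sym_diff S T) R"
  proof -
    have "sym_diff S R = T \<longleftrightarrow> R = sym_diff S T" by blast
    then show ?thesis by (auto simp: cl_basis_def)
  qed
  finally show "cl_mult p q (cl_basis S) (cl_basis T) R = cl_sign p S T * cl_basis (sym_diff S T) R" .
qed

lemma cl_gen_square:
  assumes "i < p + q"
  shows "cl_mult p q (cl_gen i) (cl_gen i) = (\<lambda>R. (if i < p then - 1 else 1) * cl_one R)"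
proof -
  have 1: "{(k, j). k \<in> {i} \<and> j \<in> {i} \<and> j < k} = {}" by auto
  have 2: "{k \<in> {i} \<inter> {i}. k < p} = (if i < p then {i} else {})" by auto
  have "cl_sign p {i} {i} = (if i < p then - 1 else 1)"
    unfolding cl_sign_def 1 2 by simp
  then show ?thesis using assms by (subst cl_mult_basis) auto
qed

lemma cl_gen_anticommute:
  assumes "i < p + q" "j < p + q" "i \<noteq> j"
  shows "cl_mult p q (cl_gen i) (cl_gen j) = (\<lambda>R. - cl_mult p q (cl_gen j) (cl_gen i) R)"
proof -
  have *: "cl_sign p {k} {l} = (if l < k then - 1 else 1)" if "k \<noteq> l" for k l
  proof -
    have 1: "{(a, b). a \<in> {k} \<and> b \<in> {l} \<and> b < a} = (if l < k then {(k, l)} else {})" by auto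
    have 2: "{a \<in> {k} \<inter> {l}. a < p} = {}" using that by auto
    show ?thesis unfolding cl_sign_def 1 2 by simp
  qed
  have "sym_diff {i} {j} = sym_diff {j} {i}" by blast
  then show ?thesis using assms by (subst (1 2) cl_mult_basis) (auto simp: *)
qed

definition clifford_module ::
  "('g, 'b) group_bundle \<Rightarrow> ('y, 'g, 'b) gspace \<Rightarrow> nat \<Rightarrow> nat \<Rightarrow> ('e, 'y, 'g) vbundle \<Rightarrow>
     (clifford \<Rightarrow> 'e \<Rightarrow> 'e) \<Rightarrow> bool" where
  "clifford_module GG Y p q E r \<longleftrightarrow>
     g_vector_bundle GG Y E \<and>
     (\<forall>a\<in>cl_carrier p q. g_bundle_map GG Y E E (r a)) \<and>
     (\<forall>e\<in>topspace (vb_total E). r cl_one e = e \<and>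
        (\<forall>a\<in>cl_carrier p q.
           (\<forall>c. r (\<lambda>S. c * a S) e = vb_scale E (complex_of_real c) (r a e)) \<and>
           (\<forall>b\<in>cl_carrier p q. r (\<lambda>S. a S + b S) e = vb_add E (r a e) (r b e) \<and>
              r (cl_mult p q a b) e = r a (r b e))))"

definition grading ::
  "('g, 'b) group_bundle \<Rightarrow> ('y, 'g, 'b) gspace \<Rightarrow> nat \<Rightarrow> nat \<Rightarrow> ('e, 'y, 'g) vbundle \<Rightarrow>
     (clifford \<Rightarrow> 'e \<Rightarrow> 'e) \<Rightarrow> ('e \<Rightarrow> 'e) \<Rightarrow> bool" where
  "grading GG Y p q E r \<eta> \<longleftrightarrow>
     g_bundle_map GG Y E E \<eta> \<and>
     (\<forall>e\<in>topspace (vb_total E). \<eta> (\<eta> e) = e \<and>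
        (\<forall>i<p + q. \<eta> (r (cl_gen i) e) = vb_scale E (- 1) (r (cl_gen i) (\<eta> e))))"

text \<open>A continuous family of norms on the fibres. The sup norm
  \<open>\<parallel>h\<parallel> = sup {\<nu> (h e) | \<nu> e \<le> 1}\<close> which it induces on the endomorphisms of a bundle over a compact base
  does not depend on \<open>\<nu>\<close> up to equivalence.\<close>

definition fibre_norm :: "('e, 'y, 'g) vbundle \<Rightarrow> ('e \<Rightarrow> real) \<Rightarrow> bool" where
  "fibre_norm E \<nu> \<longleftrightarrow>
     continuous_map (vb_total E) euclideanreal \<nu> \<and>
     (\<forall>e\<in>topspace (vb_total E). 0 \<le> \<nu> e \<and> (\<nu> e = 0 \<longleftrightarrow> e = vb_scale E 0 e) \<and>
        (\<forall>c. \<nu> (vb_scale E c e) = cmod c * \<nu> e) \<and>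
        (\<forall>e'\<in>vb_fibre E (vb_proj E e). \<nu> (vb_add E e e') \<le> \<nu> e + \<nu> e'))"

text \<open>The last clause is continuity of the path \<open>t \<mapsto> H t\<close> for the sup norm: it says that
  \<open>\<parallel>H s - H t\<parallel> \<le> \<epsilon>\<close> for \<open>s\<close> near \<open>t\<close>.\<close>

definition gradings_homotopic ::
  "('g, 'b) group_bundle \<Rightarrow> ('y, 'g, 'b) gspace \<Rightarrow> 'y set \<Rightarrow> nat \<Rightarrow> nat \<Rightarrow> ('e, 'y, 'g) vbundle \<Rightarrow>
     (clifford \<Rightarrow> 'e \<Rightarrow> 'e) \<Rightarrow> ('e \<Rightarrow> 'e) \<Rightarrow> ('e \<Rightarrow> 'e) \<Rightarrow> bool" where
  "gradings_homotopic GG Y Y' p q E r \<eta>1 \<eta>2 \<longleftrightarrow>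
     (\<exists>(H :: real \<Rightarrow> 'e \<Rightarrow> 'e) \<nu>. fibre_norm E \<nu> \<and>
        (\<forall>t\<in>{0..1}. grading GG Y p q E r (H t)) \<and>
        (\<forall>e\<in>topspace (vb_total E). H 0 e = \<eta>1 e \<and> H 1 e = \<eta>2 e) \<and>
        (\<forall>t\<in>{0..1}. \<forall>e\<in>topspace (vb_total E). vb_proj E e \<in> Y' \<longrightarrow> H t e = H 0 e) \<and>
        (\<forall>t\<in>{0..1}. \<forall>\<epsilon>>0. \<exists>\<delta>>0. \<forall>s\<in>{0..1}. \<bar>s - t\<bar> < \<delta> \<longrightarrow>
           (\<forall>e\<in>topspace (vb_total E). \<nu> (vb_add E (H s e) (vb_scale E (- 1) (H t e))) \<le> \<epsilon> * \<nu> e)))"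

section \<open>The groups \<open>K\<^sup>p\<^sup>,\<^sup>q\<close>\<close>

record ('e, 'y, 'g) ktriple =
  kt_bundle :: "('e, 'y, 'g) vbundle"
  kt_rep    :: "clifford \<Rightarrow> 'e \<Rightarrow> 'e"
  kt_eta1   :: "'e \<Rightarrow> 'e"
  kt_eta2   :: "'e \<Rightarrow> 'e"

definition is_ktriple ::
  "('g, 'b) group_bundle \<Rightarrow> ('y, 'g, 'b) gspace \<Rightarrow> 'y set \<Rightarrow> nat \<Rightarrow> nat \<Rightarrow> ('e, 'y, 'g) ktriple \<Rightarrow> bool" where
  "is_ktriple GG Y Y' p q T \<longleftrightarrow>
     clifford_module GG Y p q (kt_bundle T) (kt_rep T) \<and>
     grading GG Y p q (kt_bundle T) (kt_rep T) (kt_eta1 T) \<and>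
     grading GG Y p q (kt_bundle T) (kt_rep T) (kt_eta2 T) \<and>
     (\<forall>e\<in>topspace (vb_total (kt_bundle T)). vb_proj (kt_bundle T) e \<in> Y' \<longrightarrow> kt_eta1 T e = kt_eta2 T e)"

definition ktriple_iso ::
  "('g, 'b) group_bundle \<Rightarrow> ('y, 'g, 'b) gspace \<Rightarrow> nat \<Rightarrow> nat \<Rightarrow> ('e, 'y, 'g) ktriple \<Rightarrow>
     ('f, 'y, 'g) ktriple \<Rightarrow> bool" where
  "ktriple_iso GG Y p q S T \<longleftrightarrow>
     (\<exists>h. homeomorphic_map (vb_total (kt_bundle S)) (vb_total (kt_bundle T)) h \<and>
        g_bundle_map GG Y (kt_bundle S) (kt_bundle T) h \<and>
        (\<forall>e\<in>topspace (vb_total (kt_bundle S)).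
           (\<forall>a\<in>cl_carrier p q. h (kt_rep S a e) = kt_rep T a (h e)) \<and>
           h (kt_eta1 S e) = kt_eta1 T (h e) \<and> h (kt_eta2 S e) = kt_eta2 T (h e)))"

definition ktriple_sum ::
  "('e, 'y, 'g) ktriple \<Rightarrow> ('f, 'y, 'g) ktriple \<Rightarrow> ('e \<times> 'f, 'y, 'g) ktriple" where
  "ktriple_sum S T =
     \<lparr>kt_bundle = whitney_sum (kt_bundle S) (kt_bundle T),
      kt_rep = (\<lambda>a. map_prod (kt_rep S a) (kt_rep T a)),
      kt_eta1 = map_prod (kt_eta1 S) (kt_eta1 T),
      kt_eta2 = map_prod (kt_eta2 S) (kt_eta2 T)\<rparr>"

definition ktriple_pullback ::
  "('y, 'g, 'b) gspace \<Rightarrow> ('y \<Rightarrow> 'z) \<Rightarrow> ('e, 'z, 'g) ktriple \<Rightarrow> ('y \<times> 'e, 'y, 'g) ktriple" where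
  "ktriple_pullback Y f T =
     \<lparr>kt_bundle = pullback_bundle Y f (kt_bundle T),
      kt_rep = (\<lambda>a. map_prod id (kt_rep T a)),
      kt_eta1 = map_prod id (kt_eta1 T),
      kt_eta2 = map_prod id (kt_eta2 T)\<rparr>"

text \<open>The generators have their total space in the type \<open>'y \<times> (nat \<Rightarrow> complex)\<close>. A choice of a basis in
  every fibre shows that every vector bundle over \<open>Y\<close>, whatever the type of its total space, is
  isomorphic to one of these. Direct sums and pullbacks are formed on product types and replaced by
  an isomorphic copy in that type; the direct sum relation with a zero summand identifies
  isomorphic triples.\<close>

type_synonym ('y, 'g) kgen = "('y \<times> (nat \<Rightarrow> complex), 'y, 'g) ktriple"

definition K_generators ::
  "('g, 'b) group_bundle \<Rightarrow> nat \<Rightarrow> nat \<Rightarrow> ('y, 'g, 'b) gspace \<Rightarrow> 'y set \<Rightarrow> ('y, 'g) kgen set" where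
  "K_generators GG p q Y Y' = {T. is_ktriple GG Y Y' p q T}"

definition K_free ::
  "('g, 'b) group_bundle \<Rightarrow> nat \<Rightarrow> nat \<Rightarrow> ('y, 'g, 'b) gspace \<Rightarrow> 'y set \<Rightarrow> (('y, 'g) kgen \<Rightarrow>\<^sub>0 int) monoid" where
  "K_free GG p q Y Y' = free_Abelian_group (K_generators GG p q Y Y')"

definition K_relators ::
  "('g, 'b) group_bundle \<Rightarrow> nat \<Rightarrow> nat \<Rightarrow> ('y, 'g, 'b) gspace \<Rightarrow> 'y set \<Rightarrow> (('y, 'g) kgen \<Rightarrow>\<^sub>0 int) set" where
  "K_relators GG p q Y Y' =
     {frag_of S + frag_of T - frag_of U | S T U.
        S \<in> K_generators GG p q Y Y' \<and> T \<in> K_generators GG p q Y Y' \<and> U \<in> K_generators GG p q Y Y' \<and>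
        ktriple_iso GG Y p q U (ktriple_sum S T)} \<union>
     {frag_of T | T. T \<in> K_generators GG p q Y Y' \<and>
        gradings_homotopic GG Y Y' p q (kt_bundle T) (kt_rep T) (kt_eta1 T) (kt_eta2 T)}"

definition K_relations ::
  "('g, 'b) group_bundle \<Rightarrow> nat \<Rightarrow> nat \<Rightarrow> ('y, 'g, 'b) gspace \<Rightarrow> 'y set \<Rightarrow> (('y, 'g) kgen \<Rightarrow>\<^sub>0 int) set" where
  "K_relations GG p q Y Y' = generate (K_free GG p q Y Y') (K_relators GG p q Y Y')"

text \<open>\<open>K\<^sup>n\<close> is \<open>K\<^sup>p\<^sup>,\<^sup>q\<close> for any \<open>p\<close>, \<open>q\<close> with \<open>p - q = n\<close>.\<close>

definition K_group ::
  "('g, 'b) group_bundle \<Rightarrow> nat \<Rightarrow> nat \<Rightarrow> ('y, 'g, 'b) gspace \<Rightarrow> 'y set \<Rightarrow>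
     (('y, 'g) kgen \<Rightarrow>\<^sub>0 int) set monoid" where
  "K_group GG p q Y Y' = K_free GG p q Y Y' Mod K_relations GG p q Y Y'"

text \<open>The homomorphism \<open>f\<^sup>* : K\<^sup>p\<^sup>,\<^sup>q(Z, Z') \<rightarrow> K\<^sup>p\<^sup>,\<^sup>q(Y, Y')\<close> induced by a map of pairs
  \<open>f : (Y, Y') \<rightarrow> (Z, Z')\<close>; it sends the class of a triple to the class of its pullback.\<close>

definition K_pullback_gen ::
  "('g, 'b) group_bundle \<Rightarrow> nat \<Rightarrow> nat \<Rightarrow> ('y, 'g, 'b) gspace \<Rightarrow> 'y set \<Rightarrow> ('y \<Rightarrow> 'z) \<Rightarrow>
     ('z, 'g) kgen \<Rightarrow> ('y, 'g) kgen" where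
  "K_pullback_gen GG p q Y Y' f T =
     (SOME S. S \<in> K_generators GG p q Y Y' \<and> ktriple_iso GG Y p q S (ktriple_pullback Y f T))"

definition K_pullback ::
  "('g, 'b) group_bundle \<Rightarrow> nat \<Rightarrow> nat \<Rightarrow> ('y, 'g, 'b) gspace \<Rightarrow> 'y set \<Rightarrow> ('y \<Rightarrow> 'z) \<Rightarrow>
     (('z, 'g) kgen \<Rightarrow>\<^sub>0 int) set \<Rightarrow> (('y, 'g) kgen \<Rightarrow>\<^sub>0 int) set" where
  "K_pullback GG p q Y Y' f X =
     the_elem ((\<lambda>x. K_relations GG p q Y Y' #>\<^bsub>K_free GG p q Y Y'\<^esub>
                      frag_extend (\<lambda>T. frag_of (K_pullback_gen GG p q Y Y' f T)) x) ` X)"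

end

theory Submission
  imports Defs
begin

text \<open>Multiplying the generators of a Clifford module by square roots of their squares, which is possible
  over \<open>\<complex>\<close>, shows that a \<open>C\<^sup>p\<^sup>,\<^sup>q\<close>-module in complex bundles is the same as a bundle with \<open>N = p + q\<close>
  anticommuting involutions. Tensoring with \<open>\<complex>\<^sup>2\<close> and the Pauli matrices turns \<open>N\<close> involutions into
  \<open>N + 2\<close>. This is an equivalence: a bundle with two further involutions \<open>a\<close>, \<open>b\<close> is recovered from
  the \<open>1\<close>-eigenbundle of \<open>- \<i> a b\<close>. The equivalence is compatible with gradings and their homotopies,
  direct sums and pullbacks, so \<open>K\<^sup>p\<^sup>,\<^sup>q\<close> is naturally unchanged when \<open>p + q\<close> changes by an even number,
  and \<open>p - q = p' - q' + 2\<close> forces \<open>p + q\<close> and \<open>p' + q'\<close> to have the same parity.\<close>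

section \<open>Vector bundles and equivariant maps in local coordinates\<close>

section \<open>Continuous maps between abstract topologies\<close>

text \<open>Three points shape the development. A vector bundle is defined without vector space
  axioms for the fibres; these hold only through the trivializations. So identities between vectors
  of a fibre are reduced by \<open>vb_coord\<close> to identities of complex numbers, and continuity
  claims to claims in a chart.

  Generators of the K-groups live on one fixed type, while doubling, sums and pullbacks land on
  product types and have to be copied back. Doubling therefore acts on generators only up to
  isomorphism. It is treated as a relation, \<open>K_correspondence\<close>, from which functions
  are chosen at the end; isomorphic triples have equal classes, so the choice does not affect
  classes.

  For the relation to be reversible, doubling has to reflect isomorphisms and null homotopies. The
  product of the two new generators is \<open>\<i>\<close> on the first summand and
  \<open>- \<i>\<close> on the second. A linear map that commutes with both generators, or
  anticommutes with both, commutes with their product and hence preserves the first summand.\<close>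

lemma continuous_map_local:
  assumes "\<And>x. x \<in> topspace X \<Longrightarrow> \<exists>U. openin X U \<and> x \<in> U \<and> continuous_map (subtopology X U) Y f"
  shows "continuous_map X Y f"
proof -
  obtain U where U: "\<And>x. x \<in> topspace X \<Longrightarrow> openin X (U x) \<and> x \<in> U x \<and> continuous_map (subtopology X (U x)) Y f"
    using assms by metis
  show ?thesis
    by (rule pasting_lemma[where I = "topspace X" and T = U and f = "\<lambda>_. f"]) (use U in auto)
qed

lemma continuous_map_in: "continuous_map X Y f \<Longrightarrow> x \<in> topspace X \<Longrightarrow> f x \<in> topspace Y"
  by (auto simp: continuous_map_def)

lemma continuous_map_comp2:
  "continuous_map X Y f \<Longrightarrow> continuous_map Y Z g \<Longrightarrow> continuous_map X Z (\<lambda>x. g (f x))"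
  using continuous_map_compose[of X Y f Z g] by (simp add: o_def)

lemma continuous_map_into_sub:
  "continuous_map X Y f \<Longrightarrow> (\<And>x. x \<in> topspace X \<Longrightarrow> f x \<in> S) \<Longrightarrow> continuous_map X (subtopology Y S) f"
  by (auto simp: continuous_map_in_subtopology)

lemma continuous_map_prod_snd: "continuous_map X (prod_topology Y Z) f \<Longrightarrow> continuous_map X Z (\<lambda>x. snd (f x))"
  using continuous_map_comp2 continuous_map_snd by blast

lemma continuous_map_mult:
  fixes f g :: "'a \<Rightarrow> 'c :: real_normed_algebra"
  assumes "continuous_map X euclidean f" "continuous_map X euclidean g"
  shows "continuous_map X euclidean (\<lambda>x. f x * g x)"
  using assms by (simp add: continuous_map_atin tendsto_mult)

lemma continuous_map_sub_id: "continuous_map (subtopology X S) X (\<lambda>x. x)"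
  by (simp add: continuous_map_from_subtopology)

lemma topspace_complex_space: "topspace (complex_space n) = {v. \<forall>i\<ge>n. v i = 0}"
  by (auto simp: complex_space_def)

lemma continuous_map_complex_space:
  "continuous_map X (complex_space n) f \<longleftrightarrow>
     (\<forall>i. continuous_map X euclidean (\<lambda>x. f x i)) \<and> (\<forall>x\<in>topspace X. \<forall>i\<ge>n. f x i = 0)"
  by (auto simp: complex_space_def continuous_map_in_subtopology continuous_map_componentwise_UNIV)

section \<open>Charts of vector bundles\<close>

text \<open>A local trivialization cut into its fibre coordinate \<open>k\<close> and its inverse
  \<open>s\<close>. Instead of one homeomorphism onto a product there are two continuity conditions
  and two inverse laws, which each construction of bundles can verify separately.\<close>

definition vb_chart :: "'y topology \<Rightarrow> ('e, 'y, 'g) vbundle \<Rightarrow> 'y set \<Rightarrow> nat \<Rightarrow> ('e \<Rightarrow> nat \<Rightarrow> complex) \<Rightarrow>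
    ('y \<Rightarrow> (nat \<Rightarrow> complex) \<Rightarrow> 'e) \<Rightarrow> bool" where
  "vb_chart Y E U n k s \<longleftrightarrow> openin Y U \<and>
     continuous_map (subtopology (vb_total E) {e. vb_proj E e \<in> U}) (complex_space n) k \<and>
     continuous_map (prod_topology (subtopology Y U) (complex_space n)) (vb_total E) (\<lambda>(y, v). s y v) \<and>
     (\<forall>y\<in>U. (\<forall>v\<in>topspace (complex_space n). s y v \<in> vb_fibre E y \<and> k (s y v) = v) \<and>
        (\<forall>e\<in>vb_fibre E y. s y (k e) = e \<and>
           (\<forall>e'\<in>vb_fibre E y. vb_add E e e' \<in> vb_fibre E y \<and> k (vb_add E e e') = (\<lambda>i. k e i + k e' i)) \<and>
           (\<forall>c. vb_scale E c e \<in> vb_fibre E y \<and> k (vb_scale E c e) = (\<lambda>i. c * k e i))))"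

lemma vb_chartD:
  assumes "vb_chart Y E U n k s"
  shows "openin Y U"
    and "continuous_map (subtopology (vb_total E) {e. vb_proj E e \<in> U}) (complex_space n) k"
    and "continuous_map (prod_topology (subtopology Y U) (complex_space n)) (vb_total E) (\<lambda>(y, v). s y v)"
    and "\<And>y v. y \<in> U \<Longrightarrow> v \<in> topspace (complex_space n) \<Longrightarrow> s y v \<in> vb_fibre E y"
    and "\<And>y v. y \<in> U \<Longrightarrow> v \<in> topspace (complex_space n) \<Longrightarrow> k (s y v) = v"
    and "\<And>y e. y \<in> U \<Longrightarrow> e \<in> vb_fibre E y \<Longrightarrow> s y (k e) = e"
    and "\<And>y e. y \<in> U \<Longrightarrow> e \<in> vb_fibre E y \<Longrightarrow> k e \<in> topspace (complex_space n)"
    and "\<And>y e e'. y \<in> U \<Longrightarrow> e \<in> vb_fibre E y \<Longrightarrow> e' \<in> vb_fibre E y \<Longrightarrow> vb_add E e e' \<in> vb_fibre E y"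
    and "\<And>y e e'. y \<in> U \<Longrightarrow> e \<in> vb_fibre E y \<Longrightarrow> e' \<in> vb_fibre E y \<Longrightarrow>
           k (vb_add E e e') = (\<lambda>i. k e i + k e' i)"
    and "\<And>y e c. y \<in> U \<Longrightarrow> e \<in> vb_fibre E y \<Longrightarrow> vb_scale E c e \<in> vb_fibre E y"
    and "\<And>y e c. y \<in> U \<Longrightarrow> e \<in> vb_fibre E y \<Longrightarrow> k (vb_scale E c e) = (\<lambda>i. c * k e i)"
proof -
  show cont: "continuous_map (subtopology (vb_total E) {e. vb_proj E e \<in> U}) (complex_space n) k"
    using assms unfolding vb_chart_def by blast
  show "k e \<in> topspace (complex_space n)" if "y \<in> U" "e \<in> vb_fibre E y" for y e
    using continuous_map_in[OF cont] that by (auto simp: vb_fibre_def)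
qed (use assms in \<open>unfold vb_chart_def, blast+\<close>)

text \<open>The body of the existential in \<open>vector_bundle\<close>, named so that it can be
  exchanged for \<open>vb_chart\<close>.\<close>

definition vb_trivialization :: "'y topology \<Rightarrow> ('e, 'y, 'g) vbundle \<Rightarrow> 'y set \<Rightarrow> nat \<Rightarrow>
    ('e \<Rightarrow> 'y \<times> (nat \<Rightarrow> complex)) \<Rightarrow> bool" where
  "vb_trivialization Y E U n \<phi> \<longleftrightarrow> openin Y U \<and>
        homeomorphic_map (subtopology (vb_total E) {e. vb_proj E e \<in> U})
          (prod_topology (subtopology Y U) (complex_space n)) \<phi> \<and>
        (\<forall>z\<in>U. \<forall>e\<in>vb_fibre E z. fst (\<phi> e) = z \<and>
           (\<forall>e'\<in>vb_fibre E z. vb_add E e e' \<in> vb_fibre E z \<and>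
              snd (\<phi> (vb_add E e e')) = (\<lambda>i. snd (\<phi> e) i + snd (\<phi> e') i)) \<and>
           (\<forall>c. vb_scale E c e \<in> vb_fibre E z \<and>
              snd (\<phi> (vb_scale E c e)) = (\<lambda>i. c * snd (\<phi> e) i)))"

lemma vector_bundle_iff_trivialization:
  "vector_bundle Y E \<longleftrightarrow> continuous_map (vb_total E) Y (vb_proj E) \<and>
     (\<forall>y\<in>topspace Y. \<exists>U n \<phi>. y \<in> U \<and> vb_trivialization Y E U n \<phi>)"
  unfolding vector_bundle_def vb_trivialization_def by (simp only: conj_ac)

text \<open>A trivialization \<open>\<phi>\<close> gives \<open>k\<close> as its second component
  and \<open>s\<close> as its inverse; a chart gives back
  \<open>e \<mapsto> (vb_proj E e, k e)\<close>. Every bundle built below is recognized through its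
  charts.\<close>

lemma vector_bundle_iff_chart:
  "vector_bundle Y E \<longleftrightarrow> continuous_map (vb_total E) Y (vb_proj E) \<and>
     (\<forall>y\<in>topspace Y. \<exists>U n k s. y \<in> U \<and> vb_chart Y E U n k s)"
proof (intro iffI conjI ballI)
  assume E: "vector_bundle Y E"
  then show proj: "continuous_map (vb_total E) Y (vb_proj E)" by (simp add: vector_bundle_def)
  fix y assume y: "y \<in> topspace Y"
  then obtain U n \<phi> where U: "y \<in> U" and triv: "vb_trivialization Y E U n \<phi>"
    using E unfolding vector_bundle_iff_trivialization by blast
  then have U: "openin Y U" "y \<in> U"
    and \<phi>: "homeomorphic_map (subtopology (vb_total E) {e. vb_proj E e \<in> U})
          (prod_topology (subtopology Y U) (complex_space n)) \<phi>"
    and lin: "\<And>z e. z \<in> U \<Longrightarrow> e \<in> vb_fibre E z \<Longrightarrow> fst (\<phi> e) = z \<and>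
           (\<forall>e'\<in>vb_fibre E z. vb_add E e e' \<in> vb_fibre E z \<and>
              snd (\<phi> (vb_add E e e')) = (\<lambda>i. snd (\<phi> e) i + snd (\<phi> e') i)) \<and>
           (\<forall>c. vb_scale E c e \<in> vb_fibre E z \<and>
              snd (\<phi> (vb_scale E c e)) = (\<lambda>i. c * snd (\<phi> e) i))"
    unfolding vb_trivialization_def by blast+
  obtain \<psi> where h: "homeomorphic_maps (subtopology (vb_total E) {e. vb_proj E e \<in> U})
          (prod_topology (subtopology Y U) (complex_space n)) \<phi> \<psi>"
    using \<phi> homeomorphic_map_maps by blast
  have U': "U \<subseteq> topspace Y" using U openin_subset by blast
  have c\<phi>: "continuous_map (subtopology (vb_total E) {e. vb_proj E e \<in> U})
          (prod_topology (subtopology Y U) (complex_space n)) \<phi>"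
    and c\<psi>: "continuous_map (prod_topology (subtopology Y U) (complex_space n))
       (subtopology (vb_total E) {e. vb_proj E e \<in> U}) \<psi>"
    and inv1: "\<And>e. e \<in> topspace (vb_total E) \<Longrightarrow> vb_proj E e \<in> U \<Longrightarrow> \<psi> (\<phi> e) = e"
    and inv2: "\<And>z v. z \<in> U \<Longrightarrow> v \<in> topspace (complex_space n) \<Longrightarrow> \<phi> (\<psi> (z, v)) = (z, v)"
    using h U' unfolding homeomorphic_maps_def by auto
  \<comment> \<open>The first component of \<open>\<phi>\<close> is known only on fibres over
    \<open>U\<close>. So the point is first located over some base point of \<open>U\<close>, and
    applying \<open>\<phi>\<close> again identifies that base point as \<open>z\<close>.\<close>
  have in\<psi>: "\<psi> (z, v) \<in> vb_fibre E z" if "z \<in> U" "v \<in> topspace (complex_space n)" for z v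
  proof -
    have m: "\<psi> (z, v) \<in> topspace (vb_total E) \<and> vb_proj E (\<psi> (z, v)) \<in> U"
      using continuous_map_in[OF c\<psi>, of "(z, v)"] that U' by auto
    then have "fst (\<phi> (\<psi> (z, v))) = vb_proj E (\<psi> (z, v))"
      using lin by (auto simp: vb_fibre_def)
    then show ?thesis using inv2[OF that] m by (simp add: vb_fibre_def)
  qed
  have s: "\<psi> (z, snd (\<phi> e)) = e" if "z \<in> U" "e \<in> vb_fibre E z" for z e
  proof -
    have "(z, snd (\<phi> e)) = \<phi> e" using lin[OF that] by (metis prod.collapse)
    then show ?thesis using inv1 that by (simp add: vb_fibre_def)
  qed
  have "vb_chart Y E U n (\<lambda>e. snd (\<phi> e)) (\<lambda>z v. \<psi> (z, v))"
    unfolding vb_chart_def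
    using U lin in\<psi> s inv2 continuous_map_prod_snd[OF c\<phi>] c\<psi>[unfolded continuous_map_in_subtopology]
    by auto
  then show "\<exists>U n k s. y \<in> U \<and> vb_chart Y E U n k s" using U by blast
next
  assume R: "continuous_map (vb_total E) Y (vb_proj E) \<and>
     (\<forall>y\<in>topspace Y. \<exists>U n k s. y \<in> U \<and> vb_chart Y E U n k s)"
  have "\<exists>U n \<phi>. y \<in> U \<and> vb_trivialization Y E U n \<phi>" if y: "y \<in> topspace Y" for y
  proof -
    obtain U n k s where U: "y \<in> U" and ch: "vb_chart Y E U n k s" using R y by metis
    note c = vb_chartD[OF ch]
    have U': "U \<subseteq> topspace Y" using c(1) openin_subset by blast
    have p: "continuous_map (vb_total E) Y (vb_proj E)" using R by blast
    have "homeomorphic_maps (subtopology (vb_total E) {e. vb_proj E e \<in> U})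
          (prod_topology (subtopology Y U) (complex_space n)) (\<lambda>e. (vb_proj E e, k e)) (\<lambda>(z, v). s z v)"
      unfolding homeomorphic_maps_def
    proof (intro conjI)
      show "continuous_map (subtopology (vb_total E) {e. vb_proj E e \<in> U})
          (prod_topology (subtopology Y U) (complex_space n)) (\<lambda>e. (vb_proj E e, k e))"
        using c(2) p by (auto simp: continuous_map_pairwise o_def continuous_map_in_subtopology
            intro: continuous_map_from_subtopology)
      show "continuous_map (prod_topology (subtopology Y U) (complex_space n))
          (subtopology (vb_total E) {e. vb_proj E e \<in> U}) (\<lambda>(z, v). s z v)"
        using c(3) c(4) by (intro continuous_map_into_sub) (auto simp: vb_fibre_def)
    qed (use c U' in \<open>auto simp: vb_fibre_def\<close>)
    then have "homeomorphic_map (subtopology (vb_total E) {e. vb_proj E e \<in> U})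
          (prod_topology (subtopology Y U) (complex_space n)) (\<lambda>e. (vb_proj E e, k e))"
      using homeomorphic_map_maps by blast
    then show ?thesis using U c(1,8-11) unfolding vb_trivialization_def
      by (intro exI[of _ U] exI[of _ n] exI[of _ "\<lambda>e. (vb_proj E e, k e)"]) (auto simp: vb_fibre_def)
  qed
  then show "vector_bundle Y E" using R unfolding vector_bundle_iff_trivialization by blast
qed

text \<open>Coordinates in a chart picked by the choice operator. The choice depends on the base
  point only, so all vectors of one fibre share an injective linear coordinate map; nothing is
  claimed about continuity from fibre to fibre.\<close>

definition vb_coord :: "'y topology \<Rightarrow> ('e, 'y, 'g) vbundle \<Rightarrow> 'e \<Rightarrow> nat \<Rightarrow> complex" where
  "vb_coord Y E e = (SOME k. \<exists>U n s. vb_proj E e \<in> U \<and> vb_chart Y E U n k s) e"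

locale complex_vbundle =
  fixes Y :: "'y topology" and E :: "('e, 'y, 'g) vbundle"
  assumes vector_bundle: "vector_bundle Y E"
begin

lemma proj_cont: "continuous_map (vb_total E) Y (vb_proj E)"
  using vector_bundle by (simp add: vector_bundle_def)

lemma chart: assumes "y \<in> topspace Y" obtains U n k s where "y \<in> U" "vb_chart Y E U n k s"
  using vector_bundle assms unfolding vector_bundle_iff_chart by blast

lemma fibre_base: "e \<in> vb_fibre E y \<Longrightarrow> y \<in> topspace Y"
  using proj_cont by (auto simp: vb_fibre_def continuous_map_def)

lemma total_in_fibre: "e \<in> topspace (vb_total E) \<Longrightarrow> e \<in> vb_fibre E (vb_proj E e)"
  by (simp add: vb_fibre_def)

text \<open>Recovers the set \<open>U\<close>, the rank \<open>n\<close> and the inverse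
  \<open>s\<close> that belong to the coordinate map chosen at \<open>y\<close>.\<close>

lemma coord_chart:
  assumes "y \<in> topspace Y"
  obtains U n k s where "y \<in> U" "vb_chart Y E U n k s" "\<And>e. e \<in> vb_fibre E y \<Longrightarrow> vb_coord Y E e = k e"
proof -
  define k where "k = (SOME k. \<exists>U n s. y \<in> U \<and> vb_chart Y E U n k s)"
  have "\<exists>k U n s. y \<in> U \<and> vb_chart Y E U n k s"
    using chart[OF assms] by metis
  then have "\<exists>U n s. y \<in> U \<and> vb_chart Y E U n k s"
    unfolding k_def by (rule someI_ex)
  moreover have "vb_coord Y E e = k e" if "e \<in> vb_fibre E y" for e
    using that by (simp add: vb_coord_def k_def vb_fibre_def)
  ultimately show thesis using that by blast
qed

lemma add_in: "e \<in> vb_fibre E y \<Longrightarrow> e' \<in> vb_fibre E y \<Longrightarrow> vb_add E e e' \<in> vb_fibre E y"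
  using chart[of y] fibre_base[of e y] vb_chartD(8) by metis

lemma scale_in: "e \<in> vb_fibre E y \<Longrightarrow> vb_scale E c e \<in> vb_fibre E y"
  using chart[of y] fibre_base[of e y] vb_chartD(10) by metis

lemma coord_add_fibre: "e \<in> vb_fibre E y \<Longrightarrow> e' \<in> vb_fibre E y \<Longrightarrow>
   vb_coord Y E (vb_add E e e') i = vb_coord Y E e i + vb_coord Y E e' i"
  using coord_chart[of y] fibre_base[of e y] vb_chartD(8,9) add_in by metis

lemma coord_scale_fibre: "e \<in> vb_fibre E y \<Longrightarrow> vb_coord Y E (vb_scale E c e) i = c * vb_coord Y E e i"
  using coord_chart[of y] fibre_base[of e y] vb_chartD(10,11) scale_in by metis

lemma fibre_eqI:
  assumes e: "e \<in> vb_fibre E y" "e' \<in> vb_fibre E y" and eq: "\<And>i. vb_coord Y E e i = vb_coord Y E e' i"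
  shows "e = e'"
proof -
  obtain U n k s where "y \<in> U" "vb_chart Y E U n k s" "\<And>e. e \<in> vb_fibre E y \<Longrightarrow> vb_coord Y E e = k e"
    using coord_chart[OF fibre_base[OF e(1)]] by blast
  then show ?thesis using vb_chartD(6) e eq by (metis ext)
qed

lemma add_total [simp]:
  assumes "e \<in> topspace (vb_total E)" "e' \<in> topspace (vb_total E)" "vb_proj E e' = vb_proj E e"
  shows "vb_add E e e' \<in> topspace (vb_total E)" "vb_proj E (vb_add E e e') = vb_proj E e"
  using add_in[of e "vb_proj E e" e'] assms by (auto simp: vb_fibre_def)

lemma scale_total [simp]:
  assumes "e \<in> topspace (vb_total E)"
  shows "vb_scale E c e \<in> topspace (vb_total E)" "vb_proj E (vb_scale E c e) = vb_proj E e"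
  using scale_in[of e "vb_proj E e"] assms by (auto simp: vb_fibre_def)

lemma coord_add [simp]:
  assumes "e \<in> topspace (vb_total E)" "e' \<in> topspace (vb_total E)" "vb_proj E e' = vb_proj E e"
  shows "vb_coord Y E (vb_add E e e') i = vb_coord Y E e i + vb_coord Y E e' i"
  using coord_add_fibre[of e "vb_proj E e" e'] assms by (auto simp: vb_fibre_def)

lemma coord_scale [simp]:
  assumes "e \<in> topspace (vb_total E)"
  shows "vb_coord Y E (vb_scale E c e) i = c * vb_coord Y E e i"
  using coord_scale_fibre[of e "vb_proj E e"] assms by (auto simp: vb_fibre_def)

text \<open>The standard way to prove vector identities from here on: together with the
  simplification rules \<open>coord_add\<close> and \<open>coord_scale\<close> it leaves an identity
  of complex numbers.\<close>

lemma eqI: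
  assumes "e \<in> topspace (vb_total E)" "e' \<in> topspace (vb_total E)" "vb_proj E e' = vb_proj E e"
    and "\<And>i. vb_coord Y E e i = vb_coord Y E e' i"
  shows "e = e'"
  by (rule fibre_eqI[of e "vb_proj E e"]) (use assms in \<open>auto simp: vb_fibre_def\<close>)

lemma proj_base [simp]: "e \<in> topspace (vb_total E) \<Longrightarrow> vb_proj E e \<in> topspace Y"
  using continuous_map_in[OF proj_cont] .

text \<open>Near \<open>x\<close> the sum is \<open>s\<close> applied to the base point and the sum
  of the \<open>k\<close>-coordinates, a composite of continuous maps. One chart serves both
  summands because they lie in the same fibre.\<close>

lemma add_cont:
  assumes "continuous_map X (vb_total E) f" "continuous_map X (vb_total E) f'"
    and pr: "\<And>x. x \<in> topspace X \<Longrightarrow> vb_proj E (f x) = vb_proj E (f' x)"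
  shows "continuous_map X (vb_total E) (\<lambda>x. vb_add E (f x) (f' x))"
proof (rule continuous_map_local)
  fix x assume x: "x \<in> topspace X"
  have fx: "\<And>x. x \<in> topspace X \<Longrightarrow> f x \<in> topspace (vb_total E)" "\<And>x. x \<in> topspace X \<Longrightarrow> f' x \<in> topspace (vb_total E)"
    using assms(1,2) by (auto simp: continuous_map_def)
  obtain U n k s where U: "vb_proj E (f x) \<in> U" and ch: "vb_chart Y E U n k s"
    using chart fibre_base total_in_fibre fx x by metis
  note c = vb_chartD[OF ch]
  let ?V = "{x \<in> topspace X. vb_proj E (f x) \<in> U}"
  have cp: "continuous_map X Y (\<lambda>x. vb_proj E (f x))" using continuous_map_comp2[OF assms(1) proj_cont] .
  have V: "openin X ?V" using cp c(1) by (simp add: continuous_map_def)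
  have k: "continuous_map (subtopology X ?V) (complex_space n) (\<lambda>x. k (h x))"
    if "continuous_map X (vb_total E) h" "\<And>x. x \<in> topspace X \<Longrightarrow> vb_proj E (h x) = vb_proj E (f x)" for h
    by (rule continuous_map_comp2[OF _ c(2)])
      (intro continuous_map_into_sub continuous_map_from_subtopology that(1), use that(2) in auto)
  have kk: "continuous_map (subtopology X ?V) (complex_space n) (\<lambda>x i. k (f x) i + k (f' x) i)"
    using k[OF assms(1)] k[OF assms(2)] pr unfolding continuous_map_complex_space
    by (auto intro!: continuous_map_add)
  have ct: "continuous_map (subtopology X ?V) (vb_total E)
     (\<lambda>x. (\<lambda>(y, v). s y v) (vb_proj E (f x), (\<lambda>i. k (f x) i + k (f' x) i)))"
    by (rule continuous_map_comp2[OF _ c(3)])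
      (use kk cp in \<open>auto simp: continuous_map_pairwise o_def intro!: continuous_map_into_sub
         intro: continuous_map_from_subtopology\<close>)
  have eq: "s (vb_proj E (f x)) (\<lambda>i. k (f x) i + k (f' x) i) = vb_add E (f x) (f' x)"
    if "x \<in> ?V" for x
    using that c(6)[of "vb_proj E (f x)" "vb_add E (f x) (f' x)"] c(8,9)[of "vb_proj E (f x)" "f x" "f' x"] fx pr
    by (auto simp: vb_fibre_def)
  have "continuous_map (subtopology X ?V) (vb_total E) (\<lambda>x. vb_add E (f x) (f' x))"
    by (rule continuous_map_eq[OF ct]) (simp add: eq)
  then show "\<exists>U. openin X U \<and> x \<in> U \<and> continuous_map (subtopology X U) (vb_total E) (\<lambda>x. vb_add E (f x) (f' x))"
    using V U x by (intro exI[of _ ?V]) auto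
qed

lemma scale_cont:
  assumes f: "continuous_map X (vb_total E) f"
  shows "continuous_map X (vb_total E) (\<lambda>x. vb_scale E c (f x))"
proof (rule continuous_map_local)
  fix x assume x: "x \<in> topspace X"
  have fx: "\<And>x. x \<in> topspace X \<Longrightarrow> f x \<in> topspace (vb_total E)"
    using f by (auto simp: continuous_map_def)
  obtain U n k s where U: "vb_proj E (f x) \<in> U" and ch: "vb_chart Y E U n k s"
    using chart fibre_base total_in_fibre fx x by metis
  note c = vb_chartD[OF ch]
  let ?V = "{x \<in> topspace X. vb_proj E (f x) \<in> U}"
  have cp: "continuous_map X Y (\<lambda>x. vb_proj E (f x))" using continuous_map_comp2[OF f proj_cont] .
  have V: "openin X ?V" using cp c(1) by (simp add: continuous_map_def)
  have k: "continuous_map (subtopology X ?V) (complex_space n) (\<lambda>x. k (f x))"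
    by (rule continuous_map_comp2[OF _ c(2)])
      (intro continuous_map_into_sub continuous_map_from_subtopology f, auto)
  have kk: "continuous_map (subtopology X ?V) (complex_space n) (\<lambda>x i. c * k (f x) i)"
    using k unfolding continuous_map_complex_space
    by (auto intro!: continuous_map_mult)
  have ct: "continuous_map (subtopology X ?V) (vb_total E)
     (\<lambda>x. (\<lambda>(y, v). s y v) (vb_proj E (f x), (\<lambda>i. c * k (f x) i)))"
    by (rule continuous_map_comp2[OF _ c(3)])
      (use kk cp in \<open>auto simp: continuous_map_pairwise o_def intro!: continuous_map_into_sub
         intro: continuous_map_from_subtopology\<close>)
  have eq: "s (vb_proj E (f x)) (\<lambda>i. c * k (f x) i) = vb_scale E c (f x)"
    if "x \<in> ?V" for x
    using that c(6)[of "vb_proj E (f x)" "vb_scale E c (f x)"] c(10,11)[of "vb_proj E (f x)" "f x" c] fx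
    by (auto simp: vb_fibre_def)
  have "continuous_map (subtopology X ?V) (vb_total E) (\<lambda>x. vb_scale E c (f x))"
    by (rule continuous_map_eq[OF ct]) (simp add: eq)
  then show "\<exists>U. openin X U \<and> x \<in> U \<and> continuous_map (subtopology X U) (vb_total E) (\<lambda>x. vb_scale E c (f x))"
    using V U x by (intro exI[of _ ?V]) auto
qed

end

section \<open>Equivariant bundles and bundle maps\<close>

locale g_bundle =
  fixes GG :: "('g, 'b) group_bundle" and Y :: "('y, 'g, 'b) gspace" and E :: "('e, 'y, 'g) vbundle"
  assumes g_vector_bundle: "g_vector_bundle GG Y E"

sublocale g_bundle \<subseteq> complex_vbundle "gs_total Y" E
  using g_vector_bundle by unfold_locales (simp add: g_vector_bundle_def)

context g_bundle
begin

lemma fibrewise: "fibrewise_action GG (vb_total E) (\<lambda>e. gs_proj Y (vb_proj E e)) (vb_act E)"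
  using g_vector_bundle by (simp add: g_vector_bundle_def)

lemma act_cont:
  assumes "continuous_map X (gb_total GG) \<gamma>" "continuous_map X (vb_total E) f"
    and "\<And>x. x \<in> topspace X \<Longrightarrow> gb_proj GG (\<gamma> x) = gs_proj Y (vb_proj E (f x))"
  shows "continuous_map X (vb_total E) (\<lambda>x. vb_act E (\<gamma> x) (f x))"
proof -
  have "continuous_map X (subtopology (prod_topology (gb_total GG) (vb_total E))
          {(g, e). gb_proj GG g = gs_proj Y (vb_proj E e)}) (\<lambda>x. (\<gamma> x, f x))"
    by (rule continuous_map_into_sub) (use assms in \<open>auto simp: continuous_map_pairwise o_def\<close>)
  from continuous_map_comp2[OF this conjunct1[OF fibrewise[unfolded fibrewise_action_def]]]
  show ?thesis by simp
qed

lemma act_in: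
  assumes "e \<in> vb_fibre E y" "g \<in> carrier (gb_fibre GG (gs_proj Y y))"
  shows "vb_act E g e \<in> vb_fibre E (gs_act Y g y)"
proof -
  have "(g, e) \<in> topspace (subtopology (prod_topology (gb_total GG) (vb_total E))
          {(g, e). gb_proj GG g = gs_proj Y (vb_proj E e)})"
    using assms by (auto simp: vb_fibre_def gb_fibre_def)
  from continuous_map_in[OF conjunct1[OF fibrewise[unfolded fibrewise_action_def]] this]
  show ?thesis using assms g_vector_bundle fibre_base[OF assms(1)]
    by (simp add: vb_fibre_def g_vector_bundle_def)
qed

lemma act_total [simp]:
  assumes "e \<in> topspace (vb_total E)" "g \<in> carrier (gb_fibre GG (gs_proj Y (vb_proj E e)))"
  shows "vb_act E g e \<in> topspace (vb_total E)" "vb_proj E (vb_act E g e) = gs_act Y g (vb_proj E e)"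
  using act_in[of e "vb_proj E e" g] assms by (auto simp: vb_fibre_def)

lemma act_one [simp]: "e \<in> topspace (vb_total E) \<Longrightarrow> vb_act E (gb_one GG (gs_proj Y (vb_proj E e))) e = e"
  using fibrewise unfolding fibrewise_action_def by blast

lemma act_proj [simp]:
  assumes "e \<in> topspace (vb_total E)" "g \<in> carrier (gb_fibre GG (gs_proj Y (vb_proj E e)))"
  shows "gs_proj Y (gs_act Y g (vb_proj E e)) = gs_proj Y (vb_proj E e)"
  using fibrewise act_total[OF assms] assms unfolding fibrewise_action_def by metis

lemma act_mult [simp]:
  assumes "e \<in> topspace (vb_total E)" "g \<in> carrier (gb_fibre GG (gs_proj Y (vb_proj E e)))"
    "h \<in> carrier (gb_fibre GG (gs_proj Y (vb_proj E e)))"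
  shows "vb_act E (gb_mult GG h g) e = vb_act E h (vb_act E g e)"
  using fibrewise assms unfolding fibrewise_action_def by blast

lemma fibre': "e' \<in> topspace (vb_total E) \<Longrightarrow> vb_proj E e' = y \<Longrightarrow> e' \<in> vb_fibre E y"
  by (simp add: vb_fibre_def)

lemma act_add [simp]:
  assumes "e \<in> topspace (vb_total E)" "e' \<in> topspace (vb_total E)" "vb_proj E e' = vb_proj E e"
    and "g \<in> carrier (gb_fibre GG (gs_proj Y (vb_proj E e)))"
  shows "vb_act E g (vb_add E e e') = vb_add E (vb_act E g e) (vb_act E g e')"
  using g_vector_bundle total_in_fibre[OF assms(1)] proj_base[OF assms(1)] fibre'[OF assms(2,3)] assms(4)
  unfolding g_vector_bundle_def by blast

lemma act_scale [simp]:
  assumes "e \<in> topspace (vb_total E)" "g \<in> carrier (gb_fibre GG (gs_proj Y (vb_proj E e)))"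
  shows "vb_act E g (vb_scale E c e) = vb_scale E c (vb_act E g e)"
  using g_vector_bundle total_in_fibre[OF assms(1)] proj_base[OF assms(1)] assms(2)
  unfolding g_vector_bundle_def by blast

lemma bm_total:
  assumes "g_bundle_map GG Y E F h" "e \<in> topspace (vb_total E)"
  shows "h e \<in> topspace (vb_total F)" "vb_proj F (h e) = vb_proj E e"
  using assms unfolding g_bundle_map_def by (auto simp: vb_fibre_def intro: continuous_map_in)

lemma bm_in: "g_bundle_map GG Y E F h \<Longrightarrow> e \<in> vb_fibre E y \<Longrightarrow> h e \<in> vb_fibre F y"
  by (auto simp: vb_fibre_def bm_total)

lemma bm_add:
  assumes "g_bundle_map GG Y E F h" "e \<in> topspace (vb_total E)" "e' \<in> topspace (vb_total E)"
    "vb_proj E e' = vb_proj E e"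
  shows "h (vb_add E e e') = vb_add F (h e) (h e')"
  using total_in_fibre[OF assms(2)] proj_base[OF assms(2)] fibre'[OF assms(3,4)] assms
  unfolding g_bundle_map_def by blast

lemma bm_scale:
  assumes "g_bundle_map GG Y E F h" "e \<in> topspace (vb_total E)"
  shows "h (vb_scale E c e) = vb_scale F c (h e)"
  using total_in_fibre[OF assms(2)] proj_base[OF assms(2)] assms
  unfolding g_bundle_map_def by blast

lemma bm_act:
  assumes "g_bundle_map GG Y E F h" "e \<in> topspace (vb_total E)"
    "g \<in> carrier (gb_fibre GG (gs_proj Y (vb_proj E e)))"
  shows "h (vb_act E g e) = vb_act F g (h e)"
  using total_in_fibre[OF assms(2)] proj_base[OF assms(2)] assms
  unfolding g_bundle_map_def by blast

end

lemma g_vector_bundleI: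
  assumes "vector_bundle (gs_total Y) E"
    and "continuous_map
       (subtopology (prod_topology (gb_total GG) (vb_total E)) {(g, e). gb_proj GG g = gs_proj Y (vb_proj E e)})
       (vb_total E) (\<lambda>(g, e). vb_act E g e)"
    and "\<And>e. e \<in> topspace (vb_total E) \<Longrightarrow> vb_act E (gb_one GG (gs_proj Y (vb_proj E e))) e = e"
    and "\<And>e g. e \<in> topspace (vb_total E) \<Longrightarrow> g \<in> carrier (gb_fibre GG (gs_proj Y (vb_proj E e))) \<Longrightarrow>
       vb_proj E (vb_act E g e) = gs_act Y g (vb_proj E e)"
    and "\<And>e g. e \<in> topspace (vb_total E) \<Longrightarrow> g \<in> carrier (gb_fibre GG (gs_proj Y (vb_proj E e))) \<Longrightarrow>
       gs_proj Y (gs_act Y g (vb_proj E e)) = gs_proj Y (vb_proj E e)"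
    and "\<And>e g h. e \<in> topspace (vb_total E) \<Longrightarrow> g \<in> carrier (gb_fibre GG (gs_proj Y (vb_proj E e))) \<Longrightarrow>
       h \<in> carrier (gb_fibre GG (gs_proj Y (vb_proj E e))) \<Longrightarrow>
       vb_act E (gb_mult GG h g) e = vb_act E h (vb_act E g e)"
    and "\<And>e e' g. e \<in> topspace (vb_total E) \<Longrightarrow> e' \<in> topspace (vb_total E) \<Longrightarrow> vb_proj E e' = vb_proj E e \<Longrightarrow>
       g \<in> carrier (gb_fibre GG (gs_proj Y (vb_proj E e))) \<Longrightarrow>
       vb_act E g (vb_add E e e') = vb_add E (vb_act E g e) (vb_act E g e')"
    and "\<And>e c g. e \<in> topspace (vb_total E) \<Longrightarrow> g \<in> carrier (gb_fibre GG (gs_proj Y (vb_proj E e))) \<Longrightarrow>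
       vb_act E g (vb_scale E c e) = vb_scale E c (vb_act E g e)"
  shows "g_vector_bundle GG Y E"
  using assms unfolding g_vector_bundle_def fibrewise_action_def by (auto simp: vb_fibre_def)

lemma g_bundle_mapI:
  assumes "continuous_map (vb_total E) (vb_total F) h"
    and "\<And>e. e \<in> topspace (vb_total E) \<Longrightarrow> vb_proj F (h e) = vb_proj E e"
    and "\<And>e e'. e \<in> topspace (vb_total E) \<Longrightarrow> e' \<in> topspace (vb_total E) \<Longrightarrow> vb_proj E e' = vb_proj E e \<Longrightarrow>
           h (vb_add E e e') = vb_add F (h e) (h e')"
    and "\<And>e c. e \<in> topspace (vb_total E) \<Longrightarrow> h (vb_scale E c e) = vb_scale F c (h e)"
    and "\<And>e g. e \<in> topspace (vb_total E) \<Longrightarrow> g \<in> carrier (gb_fibre GG (gs_proj Y (vb_proj E e))) \<Longrightarrow>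
           h (vb_act E g e) = vb_act F g (h e)"
  shows "g_bundle_map GG Y E F h"
  using assms unfolding g_bundle_map_def vb_fibre_def by (auto simp del: split_paired_All)

lemma g_bundle_map_cont: "g_bundle_map GG Y E F h \<Longrightarrow> continuous_map (vb_total E) (vb_total F) h"
  by (simp add: g_bundle_map_def)

lemma g_bundle_map_id: "g_bundle_map GG Y E E (\<lambda>e. e)"
  by (rule g_bundle_mapI) auto

lemma g_bundle_map_comp:
  assumes E: "g_vector_bundle GG Y E" and h: "g_bundle_map GG Y E F h" and k: "g_bundle_map GG Y F H k"
  shows "g_bundle_map GG Y E H (\<lambda>e. k (h e))"
proof -
  interpret E: g_bundle GG Y E using E by unfold_locales
  have k': "vb_proj H (k f) = y \<and> (\<forall>f'\<in>vb_fibre F y. k (vb_add F f f') = vb_add H (k f) (k f')) \<and>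
    (\<forall>c. k (vb_scale F c f) = vb_scale H c (k f)) \<and>
    (\<forall>g\<in>carrier (gb_fibre GG (gs_proj Y y)). k (vb_act F g f) = vb_act H g (k f))"
    if "y \<in> topspace (gs_total Y)" "f \<in> vb_fibre F y" for y f
    using k that unfolding g_bundle_map_def by blast
  note [simp] = E.bm_total[OF h] E.bm_add[OF h] E.bm_scale[OF h] E.bm_act[OF h]
  have hF: "h e \<in> vb_fibre F (vb_proj E e)" if "e \<in> topspace (vb_total E)" for e
    using h that by (simp add: vb_fibre_def)
  have hF': "h e' \<in> vb_fibre F (vb_proj E e)" if "e' \<in> topspace (vb_total E)" "vb_proj E e' = vb_proj E e" for e e'
    using h that by (simp add: vb_fibre_def)
  show ?thesis
    by (rule g_bundle_mapI)
      (use h k'[OF E.proj_base hF] hF' in \<open>auto intro: continuous_map_comp2[OF g_bundle_map_cont[OF h] g_bundle_map_cont[OF k]]\<close>)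
qed

lemma g_bundle_map_eq:
  assumes E: "g_vector_bundle GG Y E" and h: "g_bundle_map GG Y E F h"
    and eq: "\<And>e. e \<in> topspace (vb_total E) \<Longrightarrow> h e = k e"
  shows "g_bundle_map GG Y E F k"
proof -
  interpret E: g_bundle GG Y E using E by unfold_locales
  show ?thesis
    by (rule g_bundle_mapI)
      (auto simp flip: eq intro: continuous_map_eq[OF g_bundle_map_cont[OF h] eq]
        simp: E.bm_total[OF h] E.bm_add[OF h] E.bm_scale[OF h] E.bm_act[OF h])
qed

lemma g_bundle_map_add:
  assumes E: "g_vector_bundle GG Y E" and F: "g_vector_bundle GG Y F"
    and h: "g_bundle_map GG Y E F h" and k: "g_bundle_map GG Y E F k"
  shows "g_bundle_map GG Y E F (\<lambda>e. vb_add F (h e) (k e))"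
proof -
  interpret E: g_bundle GG Y E using E by unfold_locales
  interpret F: g_bundle GG Y F using F by unfold_locales
  note [simp] = E.bm_total[OF h] E.bm_total[OF k] E.bm_add[OF h] E.bm_add[OF k]
     E.bm_scale[OF h] E.bm_scale[OF k] E.bm_act[OF h] E.bm_act[OF k]
  show ?thesis
  proof (rule g_bundle_mapI)
    show "continuous_map (vb_total E) (vb_total F) (\<lambda>e. vb_add F (h e) (k e))"
      by (rule F.add_cont[OF g_bundle_map_cont[OF h] g_bundle_map_cont[OF k]]) simp
    show "vb_add F (h (vb_add E e e')) (k (vb_add E e e')) = vb_add F (vb_add F (h e) (k e)) (vb_add F (h e') (k e'))"
      if "e \<in> topspace (vb_total E)" "e' \<in> topspace (vb_total E)" "vb_proj E e' = vb_proj E e" for e e'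
      by (rule F.eqI) (use that in simp_all)
    show "vb_add F (h (vb_scale E c e)) (k (vb_scale E c e)) = vb_scale F c (vb_add F (h e) (k e))"
      if "e \<in> topspace (vb_total E)" for e c
      by (rule F.eqI) (use that in \<open>simp_all add: algebra_simps\<close>)
  qed simp_all
qed

lemma g_bundle_map_scale:
  assumes E: "g_vector_bundle GG Y E" and F: "g_vector_bundle GG Y F"
    and h: "g_bundle_map GG Y E F h"
  shows "g_bundle_map GG Y E F (\<lambda>e. vb_scale F c (h e))"
proof -
  interpret E: g_bundle GG Y E using E by unfold_locales
  interpret F: g_bundle GG Y F using F by unfold_locales
  note [simp] = E.bm_total[OF h] E.bm_add[OF h] E.bm_scale[OF h] E.bm_act[OF h]
  show ?thesis
  proof (rule g_bundle_mapI)
    show "continuous_map (vb_total E) (vb_total F) (\<lambda>e. vb_scale F c (h e))"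
      by (rule F.scale_cont[OF g_bundle_map_cont[OF h]])
    show "vb_scale F c (h (vb_add E e e')) = vb_add F (vb_scale F c (h e)) (vb_scale F c (h e'))"
      if "e \<in> topspace (vb_total E)" "e' \<in> topspace (vb_total E)" "vb_proj E e' = vb_proj E e" for e e'
      by (rule F.eqI) (use that in \<open>simp_all add: algebra_simps\<close>)
    show "vb_scale F c (h (vb_scale E d e)) = vb_scale F d (vb_scale F c (h e))"
      if "e \<in> topspace (vb_total E)" for e d
      by (rule F.eqI) (use that in \<open>simp_all add: algebra_simps\<close>)
  qed simp_all
qed

text \<open>Linearity and equivariance of \<open>k\<close> are those of \<open>h\<close> read
  backwards: the two sides of each equation have the same image under the injective map
  \<open>h\<close>.\<close>

lemma g_bundle_map_inverse:
  assumes E: "g_vector_bundle GG Y E" and F: "g_vector_bundle GG Y F"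
    and h: "g_bundle_map GG Y E F h" and k: "homeomorphic_maps (vb_total E) (vb_total F) h k"
  shows "g_bundle_map GG Y F E k"
proof -
  interpret E: g_bundle GG Y E using E by unfold_locales
  interpret F: g_bundle GG Y F using F by unfold_locales
  note [simp] = E.bm_total[OF h] E.bm_add[OF h] E.bm_scale[OF h] E.bm_act[OF h]
  have ck: "continuous_map (vb_total F) (vb_total E) k"
    and kh: "\<And>e. e \<in> topspace (vb_total E) \<Longrightarrow> k (h e) = e"
    and hk[simp]: "\<And>f. f \<in> topspace (vb_total F) \<Longrightarrow> h (k f) = f"
    using k by (auto simp: homeomorphic_maps_def)
  have kt[simp]: "k f \<in> topspace (vb_total E)" if "f \<in> topspace (vb_total F)" for f
    using continuous_map_in[OF ck that] .
  have kp[simp]: "vb_proj E (k f) = vb_proj F f" if "f \<in> topspace (vb_total F)" for f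
    using E.bm_total(2)[OF h kt[OF that]] that by simp
  have *: "k f = e" if "h e = f" "e \<in> topspace (vb_total E)" for e f
    using that kh by auto
  show ?thesis
    by (rule g_bundle_mapI) (auto intro!: * ck)
qed

lemma continuous_map_prod_sub_fst: "continuous_map (prod_topology (subtopology Y U) Z) Y fst"
  using continuous_map_fst[of "subtopology Y U" Z] by (simp add: continuous_map_in_subtopology)

section \<open>New bundles from old: sums, copies, pullbacks, images of projections\<close>

section \<open>Direct sums\<close>

lemma whitney_sum_simps [simp]:
  "p \<in> topspace (vb_total (whitney_sum E F)) \<longleftrightarrow>
     fst p \<in> topspace (vb_total E) \<and> snd p \<in> topspace (vb_total F) \<and> vb_proj E (fst p) = vb_proj F (snd p)"
  "vb_proj (whitney_sum E F) p = vb_proj E (fst p)"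
  "vb_add (whitney_sum E F) p p' = (vb_add E (fst p) (fst p'), vb_add F (snd p) (snd p'))"
  "vb_scale (whitney_sum E F) c p = (vb_scale E c (fst p), vb_scale F c (snd p))"
  "vb_act (whitney_sum E F) g p = (vb_act E g (fst p), vb_act F g (snd p))"
  by (auto simp: whitney_sum_def split: prod.splits)

lemma in_fibre_whitney_sum:
  "p \<in> vb_fibre (whitney_sum E F) y \<longleftrightarrow> fst p \<in> vb_fibre E y \<and> snd p \<in> vb_fibre F y"
  by (auto simp: vb_fibre_def)

lemma whitney_sum_cont:
  "continuous_map X (vb_total (whitney_sum E F)) h \<longleftrightarrow>
     continuous_map X (vb_total E) (\<lambda>x. fst (h x)) \<and> continuous_map X (vb_total F) (\<lambda>x. snd (h x)) \<and>
     (\<forall>x\<in>topspace X. vb_proj E (fst (h x)) = vb_proj F (snd (h x)))"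
  by (auto simp: whitney_sum_def continuous_map_in_subtopology continuous_map_pairwise o_def split_beta Pi_iff)

lemma whitney_sum_cont_fst: "continuous_map (vb_total (whitney_sum E F)) (vb_total E) fst"
  and whitney_sum_cont_snd: "continuous_map (vb_total (whitney_sum E F)) (vb_total F) snd"
  using whitney_sum_cont[of "vb_total (whitney_sum E F)" E F "\<lambda>x. x"] by auto

text \<open>Coordinates are concatenated: the slots below \<open>n\<close> belong to
  \<open>E\<close>, the next \<open>m\<close> slots to \<open>F\<close>. Points of
  \<open>complex_space\<close> are sequences padded with zeros, so the part for \<open>E\<close> has
  to be cut off at \<open>n\<close>, whereas the part for \<open>F\<close> is a mere shift by
  \<open>n\<close>.\<close>

lemma vb_chart_whitney_sum:
  assumes "vb_chart Y E U n k s" and "vb_chart Y F V m l t"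
  shows "vb_chart Y (whitney_sum E F) (U \<inter> V) (n + m) (\<lambda>p i. if i < n then k (fst p) i else l (snd p) (i - n))
           (\<lambda>y v. (s y (\<lambda>i. if i < n then v i else 0), t y (\<lambda>i. v (i + n))))"
proof -
  note c = vb_chartD[OF assms(1)] and d = vb_chartD[OF assms(2)]
  let ?W = "whitney_sum E F"
  let ?X = "subtopology (vb_total ?W) {p. vb_proj ?W p \<in> U \<inter> V}"
  let ?Z = "prod_topology (subtopology Y (U \<inter> V)) (complex_space (n + m))"
  have 1: "continuous_map ?X (complex_space n) (\<lambda>p. k (fst p))"
    by (rule continuous_map_comp2[OF _ c(2)])
      (rule continuous_map_into_sub, rule continuous_map_from_subtopology, rule whitney_sum_cont_fst, auto)
  have 2: "continuous_map ?X (complex_space m) (\<lambda>p. l (snd p))"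
    by (rule continuous_map_comp2[OF _ d(2)])
      (rule continuous_map_into_sub, rule continuous_map_from_subtopology, rule whitney_sum_cont_snd, auto)
  have k: "continuous_map ?X (complex_space (n + m)) (\<lambda>p i. if i < n then k (fst p) i else l (snd p) (i - n))"
    unfolding continuous_map_complex_space
  proof (intro conjI allI ballI impI)
    fix i
    show "continuous_map ?X euclidean (\<lambda>p. if i < n then k (fst p) i else l (snd p) (i - n))"
      using 1 2 unfolding continuous_map_complex_space by (cases "i < n") auto
  next
    fix p i assume "p \<in> topspace ?X" "n + m \<le> i"
    then show "(if i < n then k (fst p) i else l (snd p) (i - n)) = 0"
      using 2 unfolding continuous_map_complex_space by auto
  qed
  have fs: "continuous_map ?Z Y fst" "continuous_map ?Z (complex_space (n + m)) snd"
    by (simp_all add: continuous_map_prod_sub_fst continuous_map_snd)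
  have v: "continuous_map ?Z euclidean (\<lambda>z. snd z i)" "z \<in> topspace ?Z \<Longrightarrow> i \<ge> n + m \<Longrightarrow> snd z i = 0" for i z
    using fs(2) unfolding continuous_map_complex_space by auto
  have "continuous_map ?Z (complex_space n) (\<lambda>z i. if i < n then snd z i else 0)"
    unfolding continuous_map_complex_space
  proof (intro conjI allI ballI impI)
    fix i show "continuous_map ?Z euclidean (\<lambda>z. if i < n then snd z i else 0)"
      using v by (cases "i < n") auto
  qed auto
  then have 3: "continuous_map ?Z (prod_topology (subtopology Y U) (complex_space n))
       (\<lambda>z. (fst z, (\<lambda>i. if i < n then snd z i else 0)))"
    using fs(1) by (auto simp: continuous_map_pairwise o_def intro!: continuous_map_into_sub)
  have "continuous_map ?Z (complex_space m) (\<lambda>z i. snd z (i + n))"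
    unfolding continuous_map_complex_space using v by auto
  then have 4: "continuous_map ?Z (prod_topology (subtopology Y V) (complex_space m))
       (\<lambda>z. (fst z, (\<lambda>i. snd z (i + n))))"
    using fs(1) by (auto simp: continuous_map_pairwise o_def intro!: continuous_map_into_sub)
  have v1: "(\<lambda>i. if i < n then v i else 0) \<in> topspace (complex_space n)" for v
    by (auto simp: topspace_complex_space)
  have v2: "v \<in> topspace (complex_space (n + m)) \<Longrightarrow> (\<lambda>i. v (i + n)) \<in> topspace (complex_space m)" for v
    by (auto simp: topspace_complex_space)
  have s: "continuous_map ?Z (vb_total ?W)
     (\<lambda>(y, v). (s y (\<lambda>i. if i < n then v i else 0), t y (\<lambda>i. v (i + n))))"
    unfolding whitney_sum_cont using continuous_map_comp2[OF 3 c(3)] continuous_map_comp2[OF 4 d(3)]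
      c(4)[OF _ v1] d(4)[OF _ v2]
    by (auto simp: split_beta vb_fibre_def)
  have ext1: "(\<lambda>i. if i < n then (if i < n then a i else b i) else 0) = a" if "a \<in> topspace (complex_space n)"
    for a b :: "nat \<Rightarrow> complex"
    using that by (auto simp: topspace_complex_space)
  show ?thesis
    unfolding vb_chart_def
  proof (intro conjI ballI allI)
    show "openin Y (U \<inter> V)" using c(1) d(1) by blast
    fix y assume y: "y \<in> U \<inter> V"
    { fix v assume v: "v \<in> topspace (complex_space (n + m))"
      show "(s y (\<lambda>i. if i < n then v i else 0), t y (\<lambda>i. v (i + n))) \<in> vb_fibre ?W y"
        using c(4)[OF _ v1] d(4)[OF _ v2[OF v]] y by (auto simp: in_fibre_whitney_sum)
      show "(\<lambda>i. if i < n then k (fst (s y (\<lambda>i. if i < n then v i else 0), t y (\<lambda>i. v (i + n)))) i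
          else l (snd (s y (\<lambda>i. if i < n then v i else 0), t y (\<lambda>i. v (i + n)))) (i - n)) = v"
        using c(5)[OF _ v1] d(5)[OF _ v2[OF v]] y by auto }
    fix p assume "p \<in> vb_fibre ?W y"
    then have p: "fst p \<in> vb_fibre E y" "snd p \<in> vb_fibre F y" by (simp_all add: in_fibre_whitney_sum)
    have kp: "k (fst p) \<in> topspace (complex_space n)" using c(7) p y by auto
    show "(s y (\<lambda>i. if i < n then if i < n then k (fst p) i else l (snd p) (i - n) else 0),
          t y (\<lambda>i. if i + n < n then k (fst p) (i + n) else l (snd p) (i + n - n))) = p"
      using c(6) d(6) y p by (auto simp: ext1[OF kp])
    { fix q assume "q \<in> vb_fibre ?W y"
      then have q: "fst q \<in> vb_fibre E y" "snd q \<in> vb_fibre F y" by (simp_all add: in_fibre_whitney_sum)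
      show "vb_add ?W p q \<in> vb_fibre ?W y" using c(8) d(8) p q y by (auto simp: in_fibre_whitney_sum)
      show "(\<lambda>i. if i < n then k (fst (vb_add ?W p q)) i else l (snd (vb_add ?W p q)) (i - n)) =
        (\<lambda>i. (if i < n then k (fst p) i else l (snd p) (i - n)) + (if i < n then k (fst q) i else l (snd q) (i - n)))"
        using c(9)[OF _ p(1) q(1)] d(9)[OF _ p(2) q(2)] y by auto }
    fix a
    show "vb_scale ?W a p \<in> vb_fibre ?W y" using c(10) d(10) p y by (auto simp: in_fibre_whitney_sum)
    show "(\<lambda>i. if i < n then k (fst (vb_scale ?W a p)) i else l (snd (vb_scale ?W a p)) (i - n)) =
        (\<lambda>i. a * (if i < n then k (fst p) i else l (snd p) (i - n)))"
      using c(11)[OF _ p(1)] d(11)[OF _ p(2)] y by auto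
  qed (use k s in auto)
qed

lemma g_vector_bundle_whitney_sum [simp]:
  assumes E: "g_vector_bundle GG Y E" and F: "g_vector_bundle GG Y F"
  shows "g_vector_bundle GG Y (whitney_sum E F)"
proof -
  interpret E: g_bundle GG Y E using E by unfold_locales
  interpret F: g_bundle GG Y F using F by unfold_locales
  let ?W = "whitney_sum E F"
  show ?thesis
  proof (rule g_vector_bundleI)
    show "vector_bundle (gs_total Y) ?W"
      unfolding vector_bundle_iff_chart
    proof (intro conjI ballI)
      show "continuous_map (vb_total ?W) (gs_total Y) (vb_proj ?W)"
        by (rule continuous_map_eq[OF continuous_map_comp2[OF whitney_sum_cont_fst E.proj_cont]]) simp
      fix y assume y: "y \<in> topspace (gs_total Y)"
      obtain U n k s where U: "y \<in> U" and cE: "vb_chart (gs_total Y) E U n k s" by (rule E.chart[OF y])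
      obtain V m l t where V: "y \<in> V" and cF: "vb_chart (gs_total Y) F V m l t" by (rule F.chart[OF y])
      show "\<exists>U n k s. y \<in> U \<and> vb_chart (gs_total Y) ?W U n k s"
        using IntI[OF U V] vb_chart_whitney_sum[OF cE cF] by (intro exI conjI)
    qed
    let ?X = "subtopology (prod_topology (gb_total GG) (vb_total ?W)) {(g, p). gb_proj GG g = gs_proj Y (vb_proj ?W p)}"
    have g: "continuous_map ?X (gb_total GG) fst" and p: "continuous_map ?X (vb_total ?W) snd"
      by (simp_all add: continuous_map_from_subtopology continuous_map_fst continuous_map_snd)
    have "continuous_map ?X (vb_total E) (\<lambda>x. vb_act E (fst x) (fst (snd x)))"
      by (rule E.act_cont[OF g conjunct1[OF p[unfolded whitney_sum_cont]]]) (auto simp: split_beta)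
    moreover have "continuous_map ?X (vb_total F) (\<lambda>x. vb_act F (fst x) (snd (snd x)))"
      by (rule F.act_cont[OF g conjunct1[OF conjunct2[OF p[unfolded whitney_sum_cont]]]]) (auto simp: split_beta)
    ultimately show "continuous_map ?X (vb_total ?W) (\<lambda>(g, p). vb_act ?W g p)"
      unfolding whitney_sum_cont by (auto simp: split_beta gb_fibre_def)
  next
    fix p assume "p \<in> topspace (vb_total ?W)"
    then show "vb_act ?W (gb_one GG (gs_proj Y (vb_proj ?W p))) p = p"
      using E.act_one[of "fst p"] F.act_one[of "snd p"] by (simp add: prod_eq_iff)
  qed auto
qed

lemma g_bundle_map_pair:
  assumes h: "g_bundle_map GG Y D E h" and k: "g_bundle_map GG Y D F k" and D: "g_vector_bundle GG Y D"
  shows "g_bundle_map GG Y D (whitney_sum E F) (\<lambda>e. (h e, k e))"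
proof -
  interpret D: g_bundle GG Y D using D by unfold_locales
  note [simp] = D.bm_total[OF h] D.bm_add[OF h] D.bm_scale[OF h] D.bm_act[OF h]
    D.bm_total[OF k] D.bm_add[OF k] D.bm_scale[OF k] D.bm_act[OF k]
  show ?thesis
    by (rule g_bundle_mapI)
      (auto simp: whitney_sum_cont g_bundle_map_cont[OF h] g_bundle_map_cont[OF k])
qed

lemma g_bundle_map_fst: "g_bundle_map GG Y (whitney_sum E F) E fst"
  and g_bundle_map_snd: "g_bundle_map GG Y (whitney_sum E F) F snd"
  by (rule g_bundle_mapI; simp add: whitney_sum_cont_fst whitney_sum_cont_snd)+

lemma g_bundle_map_map_prod:
  assumes "g_vector_bundle GG Y E" "g_vector_bundle GG Y F"
    and h: "g_bundle_map GG Y E E' h" and k: "g_bundle_map GG Y F F' k"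
  shows "g_bundle_map GG Y (whitney_sum E F) (whitney_sum E' F') (map_prod h k)"
  using g_bundle_map_pair[OF g_bundle_map_comp[OF _ g_bundle_map_fst h] g_bundle_map_comp[OF _ g_bundle_map_snd k]] assms
  by (simp add: map_prod_def case_prod_unfold)

section \<open>Isomorphic copies\<close>

text \<open>Transport of structure along an injection \<open>j\<close>, used to move a bundle into
  the type on which the generators of the K-groups live. The topology is pulled back along the
  inverse of \<open>j\<close>, so \<open>j\<close> is a homeomorphism onto the copy whatever
  topology the target type may carry.\<close>

definition vb_copy :: "('e \<Rightarrow> 'f) \<Rightarrow> ('e, 'y, 'g) vbundle \<Rightarrow> ('f, 'y, 'g) vbundle" where
  "vb_copy j E = (let i = inv_into (topspace (vb_total E)) j in
     \<lparr>vb_total = pullback_topology (j ` topspace (vb_total E)) i (vb_total E),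
      vb_proj = (\<lambda>x. vb_proj E (i x)),
      vb_add = (\<lambda>x y. j (vb_add E (i x) (i y))),
      vb_scale = (\<lambda>c x. j (vb_scale E c (i x))),
      vb_act = (\<lambda>g x. j (vb_act E g (i x)))\<rparr>)"

lemma vb_copy_homeomorphic:
  assumes j: "inj_on j (topspace (vb_total E))"
  shows "homeomorphic_maps (vb_total E) (vb_total (vb_copy j E)) j (inv_into (topspace (vb_total E)) j)"
proof -
  let ?i = "inv_into (topspace (vb_total E)) j"
  have "continuous_map (vb_total E) (vb_total (vb_copy j E)) j"
    unfolding vb_copy_def Let_def vbundle.simps
    by (rule continuous_map_pullback') (auto intro!: continuous_map_eq[OF continuous_map_id] simp: j)
  moreover have "continuous_map (vb_total (vb_copy j E)) (vb_total E) ?i"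
    unfolding vb_copy_def Let_def vbundle.simps
    using continuous_map_pullback[OF continuous_map_id, where A = "j ` topspace (vb_total E)" and f = ?i]
    by (simp add: o_def id_def)
  ultimately show ?thesis
    unfolding homeomorphic_maps_def
    by (auto simp: j vb_copy_def Let_def topspace_pullback_topology)
qed

lemma g_vector_bundle_copy:
  assumes E: "g_vector_bundle GG Y E" and j: "inj_on j (topspace (vb_total E))"
  shows "g_vector_bundle GG Y (vb_copy j E)" and "g_bundle_map GG Y E (vb_copy j E) j"
proof -
  interpret E: g_bundle GG Y E using E by unfold_locales
  let ?C = "vb_copy j E" and ?i = "inv_into (topspace (vb_total E)) j"
  have cj: "continuous_map (vb_total E) (vb_total ?C) j"
    and ci: "continuous_map (vb_total ?C) (vb_total E) ?i"
    and ij: "\<And>e. e \<in> topspace (vb_total E) \<Longrightarrow> ?i (j e) = e"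
    and ji: "\<And>x. x \<in> topspace (vb_total ?C) \<Longrightarrow> j (?i x) = x"
    using vb_copy_homeomorphic[OF j] by (auto simp: homeomorphic_maps_def)
  have C [simp]: "vb_proj ?C x = vb_proj E (?i x)" "vb_add ?C x y = j (vb_add E (?i x) (?i y))"
    "vb_scale ?C c x = j (vb_scale E c (?i x))" "vb_act ?C g x = j (vb_act E g (?i x))" for x y c g
    by (simp_all add: vb_copy_def Let_def)
  have jt [simp]: "e \<in> topspace (vb_total E) \<Longrightarrow> j e \<in> topspace (vb_total ?C)" for e
    using continuous_map_in[OF cj] .
  have it [simp]: "x \<in> topspace (vb_total ?C) \<Longrightarrow> ?i x \<in> topspace (vb_total E)" for x
    using continuous_map_in[OF ci] .
  have fib: "x \<in> vb_fibre ?C y \<longleftrightarrow> x \<in> topspace (vb_total ?C) \<and> ?i x \<in> vb_fibre E y" for x y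
    by (auto simp: vb_fibre_def)
  show "g_vector_bundle GG Y ?C"
  proof (rule g_vector_bundleI)
    show "vector_bundle (gs_total Y) ?C"
      unfolding vector_bundle_iff_chart
    proof (intro conjI ballI)
      show "continuous_map (vb_total ?C) (gs_total Y) (vb_proj ?C)"
        by (rule continuous_map_eq[OF continuous_map_comp2[OF ci E.proj_cont]]) simp
      fix y assume y: "y \<in> topspace (gs_total Y)"
      obtain U n k s where U: "y \<in> U" and ch: "vb_chart (gs_total Y) E U n k s" by (rule E.chart[OF y])
      note c = vb_chartD[OF ch]
      have "vb_chart (gs_total Y) ?C U n (\<lambda>x. k (?i x)) (\<lambda>y v. j (s y v))"
        unfolding vb_chart_def
      proof (intro conjI ballI allI)
        show "continuous_map (subtopology (vb_total ?C) {e. vb_proj ?C e \<in> U}) (complex_space n) (\<lambda>x. k (?i x))"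
          by (rule continuous_map_comp2[OF _ c(2)])
            (rule continuous_map_into_sub, rule continuous_map_from_subtopology, rule ci, auto)
        show "continuous_map (prod_topology (subtopology (gs_total Y) U) (complex_space n)) (vb_total ?C) (\<lambda>(y, v). j (s y v))"
          using continuous_map_comp2[OF c(3) cj] by (simp add: case_prod_unfold)
        fix y assume y: "y \<in> U"
        have [simp]: "?i (j e) = e" "j e \<in> topspace (vb_total ?C)" if "e \<in> vb_fibre E y" for e
          using that ij by (auto simp: vb_fibre_def)
        { fix v assume "v \<in> topspace (complex_space n)"
          then show "j (s y v) \<in> vb_fibre ?C y" "k (?i (j (s y v))) = v"
            using c(4,5)[OF y] by (simp_all add: fib) }
        fix e assume "e \<in> vb_fibre ?C y"
        then have e: "e \<in> topspace (vb_total ?C)" "?i e \<in> vb_fibre E y" by (simp_all add: fib)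
        show "j (s y (k (?i e))) = e" using e c(6)[OF y] ji by simp
        { fix e' assume "e' \<in> vb_fibre ?C y"
          then have e': "e' \<in> topspace (vb_total ?C)" "?i e' \<in> vb_fibre E y" by (simp_all add: fib)
          show "vb_add ?C e e' \<in> vb_fibre ?C y" using e e' c(8)[OF y] by (simp add: fib)
          show "k (?i (vb_add ?C e e')) = (\<lambda>i. k (?i e) i + k (?i e') i)" using e e' c(8,9)[OF y] by simp }
        fix a
        show "vb_scale ?C a e \<in> vb_fibre ?C y" using e c(10)[OF y] by (simp add: fib)
        show "k (?i (vb_scale ?C a e)) = (\<lambda>i. a * k (?i e) i)" using e c(10,11)[OF y] by simp
      qed (rule c(1))
      with U show "\<exists>U n k s. y \<in> U \<and> vb_chart (gs_total Y) ?C U n k s" by (intro exI conjI)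
    qed
    let ?X = "subtopology (prod_topology (gb_total GG) (vb_total ?C)) {(g, p). gb_proj GG g = gs_proj Y (vb_proj ?C p)}"
    have g: "continuous_map ?X (gb_total GG) fst" and p: "continuous_map ?X (vb_total ?C) snd"
      by (simp_all add: continuous_map_from_subtopology continuous_map_fst continuous_map_snd)
    have "continuous_map ?X (vb_total E) (\<lambda>x. vb_act E (fst x) (?i (snd x)))"
      by (rule E.act_cont[OF g continuous_map_comp2[OF p ci]]) (auto simp: split_beta)
    from continuous_map_comp2[OF this cj]
    show "continuous_map ?X (vb_total ?C) (\<lambda>(g, p). vb_act ?C g p)" by (simp add: case_prod_unfold)
  qed (use ij ji in auto)
  show "g_bundle_map GG Y E ?C j"
    by (rule g_bundle_mapI) (auto simp: cj ij)
qed

section \<open>Pullbacks\<close>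

lemma pullback_bundle_simps [simp]:
  "p \<in> topspace (vb_total (pullback_bundle Y f E)) \<longleftrightarrow>
     fst p \<in> topspace (gs_total Y) \<and> snd p \<in> topspace (vb_total E) \<and> f (fst p) = vb_proj E (snd p)"
  "vb_proj (pullback_bundle Y f E) p = fst p"
  "vb_add (pullback_bundle Y f E) p p' = (fst p, vb_add E (snd p) (snd p'))"
  "vb_scale (pullback_bundle Y f E) c p = (fst p, vb_scale E c (snd p))"
  "vb_act (pullback_bundle Y f E) g p = (gs_act Y g (fst p), vb_act E g (snd p))"
  by (auto simp: pullback_bundle_def split: prod.splits)

lemma in_fibre_pullback_bundle:
  "p \<in> vb_fibre (pullback_bundle Y f E) y \<longleftrightarrow> y \<in> topspace (gs_total Y) \<and> fst p = y \<and> snd p \<in> vb_fibre E (f y)"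
  by (auto simp: vb_fibre_def)

lemma pullback_bundle_cont:
  "continuous_map X (vb_total (pullback_bundle Y f E)) h \<longleftrightarrow>
     continuous_map X (gs_total Y) (\<lambda>x. fst (h x)) \<and> continuous_map X (vb_total E) (\<lambda>x. snd (h x)) \<and>
     (\<forall>x\<in>topspace X. f (fst (h x)) = vb_proj E (snd (h x)))"
  by (auto simp: pullback_bundle_def continuous_map_in_subtopology continuous_map_pairwise o_def split_beta Pi_iff)

lemma pullback_bundle_cont_fst: "continuous_map (vb_total (pullback_bundle Y f E)) (gs_total Y) fst"
  and pullback_bundle_cont_snd: "continuous_map (vb_total (pullback_bundle Y f E)) (vb_total E) snd"
  using pullback_bundle_cont[of "vb_total (pullback_bundle Y f E)" Y f E "\<lambda>x. x"] by auto

text \<open>What pulling back a bundle along \<open>f\<close> uses: an action on the source, which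
  becomes the first component of the action on the pullback, and the equivariance of
  \<open>f\<close>, which keeps the two components over matching points.\<close>

definition equivariant_map ::
  "('g, 'b) group_bundle \<Rightarrow> ('y, 'g, 'b) gspace \<Rightarrow> ('z, 'g, 'b) gspace \<Rightarrow> ('y \<Rightarrow> 'z) \<Rightarrow> bool" where
  "equivariant_map GG Y Z f \<longleftrightarrow> fibrewise_action GG (gs_total Y) (gs_proj Y) (gs_act Y) \<and>
     continuous_map (gs_total Y) (gs_total Z) f \<and>
     (\<forall>y\<in>topspace (gs_total Y). gs_proj Z (f y) = gs_proj Y y \<and>
        (\<forall>g\<in>carrier (gb_fibre GG (gs_proj Y y)). f (gs_act Y g y) = gs_act Z g (f y)))"

lemma equivariant_mapD:
  assumes "equivariant_map GG Y Z f"
  shows "continuous_map (gs_total Y) (gs_total Z) f"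
    and "y \<in> topspace (gs_total Y) \<Longrightarrow> gs_proj Z (f y) = gs_proj Y y"
    and "y \<in> topspace (gs_total Y) \<Longrightarrow> g \<in> carrier (gb_fibre GG (gs_proj Y y)) \<Longrightarrow> f (gs_act Y g y) = gs_act Z g (f y)"
    and "continuous_map
       (subtopology (prod_topology (gb_total GG) (gs_total Y)) {(g, x). gb_proj GG g = gs_proj Y x})
       (gs_total Y) (\<lambda>(g, x). gs_act Y g x)"
    and "y \<in> topspace (gs_total Y) \<Longrightarrow> gs_act Y (gb_one GG (gs_proj Y y)) y = y"
    and "y \<in> topspace (gs_total Y) \<Longrightarrow> g \<in> carrier (gb_fibre GG (gs_proj Y y)) \<Longrightarrow> gs_proj Y (gs_act Y g y) = gs_proj Y y"
    and "y \<in> topspace (gs_total Y) \<Longrightarrow> g \<in> carrier (gb_fibre GG (gs_proj Y y)) \<Longrightarrow>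
      h \<in> carrier (gb_fibre GG (gs_proj Y y)) \<Longrightarrow> gs_act Y (gb_mult GG h g) y = gs_act Y h (gs_act Y g y)"
  using assms unfolding equivariant_map_def fibrewise_action_def by blast+

lemma vb_chart_pullback:
  assumes ch: "vb_chart Z E U n k s" and f: "continuous_map (gs_total Y) Z f"
  shows "vb_chart (gs_total Y) (pullback_bundle Y f E) {y \<in> topspace (gs_total Y). f y \<in> U} n (\<lambda>p. k (snd p))
           (\<lambda>y v. (y, s (f y) v))"
proof -
  note c = vb_chartD[OF ch]
  let ?P = "pullback_bundle Y f E" and ?V = "{y \<in> topspace (gs_total Y). f y \<in> U}"
  let ?Z = "prod_topology (subtopology (gs_total Y) ?V) (complex_space n)"
  have fs: "continuous_map ?Z (gs_total Y) fst" "continuous_map ?Z (complex_space n) snd"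
    by (simp_all add: continuous_map_prod_sub_fst continuous_map_snd)
  have 3: "continuous_map ?Z (prod_topology (subtopology Z U) (complex_space n)) (\<lambda>z. (f (fst z), snd z))"
    using fs(2) continuous_map_comp2[OF fs(1) f] by (auto simp: continuous_map_pairwise o_def intro!: continuous_map_into_sub)
  show ?thesis
    unfolding vb_chart_def
  proof (intro conjI ballI allI)
    show "openin (gs_total Y) ?V" using f c(1) by (simp add: continuous_map_def)
    show "continuous_map (subtopology (vb_total ?P) {e. vb_proj ?P e \<in> ?V}) (complex_space n) (\<lambda>p. k (snd p))"
      by (rule continuous_map_comp2[OF _ c(2)])
        (rule continuous_map_into_sub, rule continuous_map_from_subtopology, rule pullback_bundle_cont_snd, auto)
    show "continuous_map ?Z (vb_total ?P) (\<lambda>(y, v). (y, s (f y) v))"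
      unfolding pullback_bundle_cont using continuous_map_comp2[OF 3 c(3)] fs(1) c(4)
      by (auto simp: split_beta vb_fibre_def)
  qed (use c in \<open>auto simp: in_fibre_pullback_bundle\<close>)
qed

lemma g_vector_bundle_pullback:
  assumes E: "g_vector_bundle GG Z E" and f: "equivariant_map GG Y Z f"
  shows "g_vector_bundle GG Y (pullback_bundle Y f E)"
proof -
  interpret E: g_bundle GG Z E using E by unfold_locales
  note f' = equivariant_mapD[OF f]
  let ?P = "pullback_bundle Y f E"
  show ?thesis
  proof (rule g_vector_bundleI)
    show "vector_bundle (gs_total Y) ?P"
      unfolding vector_bundle_iff_chart
    proof (intro conjI ballI)
      show "continuous_map (vb_total ?P) (gs_total Y) (vb_proj ?P)"
        using pullback_bundle_cont_fst by (rule continuous_map_eq) simp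
      fix y assume y: "y \<in> topspace (gs_total Y)"
      then have "f y \<in> topspace (gs_total Z)" using continuous_map_in[OF f'(1)] by blast
      then obtain U n k s where U: "f y \<in> U" and ch: "vb_chart (gs_total Z) E U n k s" by (rule E.chart)
      have "y \<in> {y \<in> topspace (gs_total Y). f y \<in> U}" using U y by simp
      then show "\<exists>U n k s. y \<in> U \<and> vb_chart (gs_total Y) ?P U n k s"
        using vb_chart_pullback[OF ch f'(1)] by (intro exI conjI)
    qed
    let ?X = "subtopology (prod_topology (gb_total GG) (vb_total ?P)) {(g, p). gb_proj GG g = gs_proj Y (vb_proj ?P p)}"
    have g: "continuous_map ?X (gb_total GG) fst" and p: "continuous_map ?X (vb_total ?P) snd"
      by (simp_all add: continuous_map_from_subtopology continuous_map_fst continuous_map_snd)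
    have act: "continuous_map ?X (vb_total E) (\<lambda>x. vb_act E (fst x) (snd (snd x)))"
      by (rule E.act_cont[OF g conjunct1[OF conjunct2[OF p[unfolded pullback_bundle_cont]]]])
        (auto simp: split_beta simp flip: f'(2))
    have "continuous_map ?X (subtopology (prod_topology (gb_total GG) (gs_total Y)) {(g, x). gb_proj GG g = gs_proj Y x})
       (\<lambda>x. (fst x, fst (snd x)))"
      using g conjunct1[OF p[unfolded pullback_bundle_cont]]
      by (auto simp: continuous_map_pairwise o_def intro!: continuous_map_into_sub)
    from act continuous_map_comp2[OF this f'(4)]
    have c: "continuous_map ?X (vb_total E) (\<lambda>x. vb_act E (fst x) (snd (snd x)))"
      "continuous_map ?X (gs_total Y) (\<lambda>x. gs_act Y (fst x) (fst (snd x)))" by simp_all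
    have "f (gs_act Y (fst x) (fst (snd x))) = vb_proj E (vb_act E (fst x) (snd (snd x)))" if "x \<in> topspace ?X" for x
      using that E.act_total(2)[of "snd (snd x)" "fst x"] f'(2)[of "fst (snd x)"] f'(3)[of "fst (snd x)" "fst x"]
      by (auto simp: split_beta gb_fibre_def)
    then show "continuous_map ?X (vb_total ?P) (\<lambda>(g, p). vb_act ?P g p)"
      unfolding pullback_bundle_cont using c by (simp add: case_prod_unfold)
  next
    fix p assume "p \<in> topspace (vb_total ?P)"
    then show "vb_act ?P (gb_one GG (gs_proj Y (vb_proj ?P p))) p = p"
      using E.act_one[of "snd p"] f'(5)[of "fst p"] f'(2)[of "fst p"] by (simp add: prod_eq_iff del: E.act_one)
  next
    fix p g h assume p: "p \<in> topspace (vb_total ?P)" "g \<in> carrier (gb_fibre GG (gs_proj Y (vb_proj ?P p)))"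
      "h \<in> carrier (gb_fibre GG (gs_proj Y (vb_proj ?P p)))"
    then show "vb_act ?P (gb_mult GG h g) p = vb_act ?P h (vb_act ?P g p)"
      using E.act_mult[of "snd p" g h] f'(2)[of "fst p"] f'(7)[of "fst p" g h] by simp
  next
    fix p q g assume "p \<in> topspace (vb_total ?P)" "q \<in> topspace (vb_total ?P)"
      "vb_proj ?P q = vb_proj ?P p" "g \<in> carrier (gb_fibre GG (gs_proj Y (vb_proj ?P p)))"
    then show "vb_act ?P g (vb_add ?P p q) = vb_add ?P (vb_act ?P g p) (vb_act ?P g q)"
      using E.act_add[of "snd p" "snd q" g] f'(2)[of "fst p"] by simp
  next
    fix p c g assume "p \<in> topspace (vb_total ?P)" "g \<in> carrier (gb_fibre GG (gs_proj Y (vb_proj ?P p)))"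
    then show "vb_act ?P g (vb_scale ?P c p) = vb_scale ?P c (vb_act ?P g p)"
      using E.act_scale[of "snd p" g c] f'(2)[of "fst p"] by simp
  qed (use f'(6) in auto)
qed

lemma g_bundle_map_pullback:
  assumes E: "g_vector_bundle GG Z E" and f: "equivariant_map GG Y Z f" and h: "g_bundle_map GG Z E F h"
  shows "g_bundle_map GG Y (pullback_bundle Y f E) (pullback_bundle Y f F) (map_prod id h)"
proof -
  interpret E: g_bundle GG Z E using E by unfold_locales
  note f' = equivariant_mapD[OF f]
  show ?thesis
  proof (rule g_bundle_mapI)
    show "continuous_map (vb_total (pullback_bundle Y f E)) (vb_total (pullback_bundle Y f F)) (map_prod id h)"
      unfolding pullback_bundle_cont using pullback_bundle_cont_fst
        continuous_map_comp2[OF pullback_bundle_cont_snd g_bundle_map_cont[OF h]] E.bm_total[OF h]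
      by auto
  next
    fix p g assume "p \<in> topspace (vb_total (pullback_bundle Y f E))"
      "g \<in> carrier (gb_fibre GG (gs_proj Y (vb_proj (pullback_bundle Y f E) p)))"
    then show "map_prod id h (vb_act (pullback_bundle Y f E) g p) = vb_act (pullback_bundle Y f F) g (map_prod id h p)"
      using E.bm_act[OF h, of "snd p" g] f'(2)[of "fst p"] by simp
  qed (use E.bm_add[OF h] E.bm_scale[OF h] in auto)
qed

text \<open>The base point is stored once on one side and in each summand on the other; the inverse
  map reads it off the first summand.\<close>

lemma pullback_whitney_sum:
  assumes E: "g_vector_bundle GG Z E" and F: "g_vector_bundle GG Z F" and f: "equivariant_map GG Y Z f"
  shows "g_bundle_map GG Y (pullback_bundle Y f (whitney_sum E F))
           (whitney_sum (pullback_bundle Y f E) (pullback_bundle Y f F)) (\<lambda>(y, p). ((y, fst p), (y, snd p)))" (is ?A)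
    and "homeomorphic_maps (vb_total (pullback_bundle Y f (whitney_sum E F)))
           (vb_total (whitney_sum (pullback_bundle Y f E) (pullback_bundle Y f F)))
           (\<lambda>(y, p). ((y, fst p), (y, snd p))) (\<lambda>(a, b). (fst a, (snd a, snd b)))" (is ?B)
proof -
  let ?W = "whitney_sum E F"
  have W: "g_vector_bundle GG Z ?W" using E F by simp
  note P = g_vector_bundle_pullback[OF W f]
  have eq: "(\<lambda>(y, p). ((y, fst p), (y, snd p))) = (\<lambda>x. (map_prod id fst x, map_prod id snd x))"
    by auto
  show a: ?A unfolding eq
    by (rule g_bundle_map_pair[OF g_bundle_map_pullback[OF W f g_bundle_map_fst] g_bundle_map_pullback[OF W f g_bundle_map_snd] P])
  have "continuous_map (vb_total (whitney_sum (pullback_bundle Y f E) (pullback_bundle Y f F)))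
      (vb_total (pullback_bundle Y f ?W)) (\<lambda>q. (fst (fst q), (snd (fst q), snd (snd q))))"
    unfolding pullback_bundle_cont whitney_sum_cont
    using continuous_map_comp2[OF whitney_sum_cont_fst pullback_bundle_cont_fst]
      continuous_map_comp2[OF whitney_sum_cont_fst pullback_bundle_cont_snd]
      continuous_map_comp2[OF whitney_sum_cont_snd pullback_bundle_cont_snd]
    by auto
  then show ?B
    unfolding homeomorphic_maps_def using g_bundle_map_cont[OF a] by (auto simp: case_prod_unfold)
qed

section \<open>The image of an idempotent bundle map\<close>

lemma sum_delta_mult:
  fixes l :: "nat \<Rightarrow> complex"
  assumes "a < (k::nat)" shows "(\<Sum>b<k. (if a = b then 1 else 0) * l b) = l a"
  using assms by (simp add: if_distrib[of "\<lambda>x. x * _"] cong: if_cong)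

text \<open>The sum \<open>s\<close> of the absolute values of the entries is submultiplicative, so
  idempotency gives \<open>s \<le> s * s\<close>, which forces \<open>s = 0\<close> when
  \<open>0 \<le> s < 1\<close>. Hence a continuous family of idempotents that vanishes at a point
  vanishes near it.\<close>

lemma idempotent_matrix_small:
  fixes p :: "nat \<Rightarrow> nat \<Rightarrow> complex"
  assumes idem: "\<And>i j. i < n \<Longrightarrow> j < n \<Longrightarrow> (\<Sum>k<n. p i k * p k j) = p i j"
    and small: "(\<Sum>i<n. \<Sum>j<n. cmod (p i j)) < 1" and ij: "i < n" "j < n"
  shows "p i j = 0"
proof -
  define s where "s = (\<Sum>i<n. \<Sum>j<n. cmod (p i j))"
  have row: "(\<Sum>j<n. cmod (p k j)) \<le> s" if "k < n" for k
    unfolding s_def by (rule member_le_sum[of k _ "\<lambda>i. \<Sum>j<n. cmod (p i j)"]) (use that in \<open>auto intro: sum_nonneg\<close>)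
  have s0: "s \<ge> 0" unfolding s_def by (intro sum_nonneg) auto
  have "s \<le> (\<Sum>i<n. \<Sum>j<n. \<Sum>k<n. cmod (p i k) * cmod (p k j))"
    unfolding s_def
  proof (intro sum_mono)
    fix i j assume "i \<in> {..<n}" "j \<in> {..<n}"
    then have "cmod (p i j) = cmod (\<Sum>k<n. p i k * p k j)" using idem by simp
    also have "\<dots> \<le> (\<Sum>k<n. cmod (p i k * p k j))" by (rule norm_sum)
    finally show "cmod (p i j) \<le> (\<Sum>k<n. cmod (p i k) * cmod (p k j))" by (simp add: norm_mult)
  qed
  also have "\<dots> = (\<Sum>i<n. \<Sum>k<n. cmod (p i k) * (\<Sum>j<n. cmod (p k j)))"
    by (subst sum.swap) (simp add: sum_distrib_left)
  also have "\<dots> \<le> (\<Sum>i<n. \<Sum>k<n. cmod (p i k) * s)"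
    by (intro sum_mono mult_left_mono row) auto
  also have "\<dots> = s * s" by (simp add: s_def sum_distrib_right)
  finally have "s * (1 - s) \<le> 0" by (simp add: algebra_simps)
  then have "s = 0" using s0 small unfolding s_def[symmetric] by (simp add: mult_le_0_iff)
  moreover have "cmod (p i j) \<le> (\<Sum>j<n. cmod (p i j))"
    by (rule member_le_sum[of j _ "\<lambda>j. cmod (p i j)"]) (use ij in auto)
  ultimately show ?thesis using row[OF ij(1)] by (metis norm_le_zero_iff order_trans)
qed

text \<open>A continuous local splitting \<open>p = L R\<close> with \<open>R L\<close> the unit
  matrix of size \<open>k\<close>: the columns of \<open>L\<close> form a frame of the image of
  \<open>p\<close>, and \<open>R\<close> computes coordinates in this frame. It amounts to a local
  trivialization of the image.\<close>

definition matrix_factorization ::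
  "'y topology \<Rightarrow> nat \<Rightarrow> (nat \<Rightarrow> nat \<Rightarrow> 'y \<Rightarrow> complex) \<Rightarrow> 'y set \<Rightarrow> nat \<Rightarrow>
     (nat \<Rightarrow> nat \<Rightarrow> 'y \<Rightarrow> complex) \<Rightarrow> (nat \<Rightarrow> nat \<Rightarrow> 'y \<Rightarrow> complex) \<Rightarrow> bool" where
  "matrix_factorization X n p V k L R \<longleftrightarrow> openin X V \<and>
     (\<forall>i<n. \<forall>a<k. continuous_map (subtopology X V) euclidean (L i a) \<and>
        continuous_map (subtopology X V) euclidean (R a i)) \<and>
     (\<forall>y\<in>V. (\<forall>a<k. \<forall>b<k. (\<Sum>i<n. R a i y * L i b y) = (if a = b then 1 else 0)) \<and>
        (\<forall>i<n. \<forall>j<n. (\<Sum>a<k. L i a y * R a j y) = p i j y))"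

lemma matrix_factorizationD:
  assumes "matrix_factorization X n p V k L R"
  shows "openin X V"
    and "\<And>i a. i < n \<Longrightarrow> a < k \<Longrightarrow> continuous_map (subtopology X V) euclidean (L i a) \<and>
        continuous_map (subtopology X V) euclidean (R a i)"
    and "\<And>y a b. y \<in> V \<Longrightarrow> a < k \<Longrightarrow> b < k \<Longrightarrow> (\<Sum>i<n. R a i y * L i b y) = (if a = b then 1 else 0)"
    and "\<And>y i j. y \<in> V \<Longrightarrow> i < n \<Longrightarrow> j < n \<Longrightarrow> (\<Sum>a<k. L i a y * R a j y) = p i j y"
  using assms unfolding matrix_factorization_def by blast+

text \<open>Near a point where the entry \<open>p\<^sub>r\<^sub>c\<close> does not vanish, \<open>p\<close> is the sum of the rank-one idempotent
  \<open>(p e\<^sub>c / p\<^sub>r\<^sub>c) (e\<^sub>r\<^sup>T p)\<close> and an idempotent whose \<open>r\<close>-th row vanishes, so that the number of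
  non-zero rows drops. At a point where \<open>p = 0\<close>, \<open>p\<close> is small and hence zero nearby.\<close>

lemma idempotent_matrix_split:
  fixes p :: "nat \<Rightarrow> nat \<Rightarrow> 'y \<Rightarrow> complex"
  assumes cont: "\<And>i j. i < n \<Longrightarrow> j < n \<Longrightarrow> continuous_map X euclidean (p i j)"
    and idem: "\<And>y i j. y \<in> topspace X \<Longrightarrow> i < n \<Longrightarrow> j < n \<Longrightarrow> (\<Sum>k<n. p i k y * p k j y) = p i j y"
    and y0: "y0 \<in> topspace X"
  shows "\<exists>V k L R. y0 \<in> V \<and> matrix_factorization X n p V k L R"
  using assms
\<comment> \<open>The measure counts the rows of \<open>p\<close> that do not vanish identically on
  \<open>X\<close>. The step also shrinks the space to the open set where the pivot entry is
  non-zero, hence \<open>X\<close> varies along with \<open>p\<close>.\<close>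
proof (induction "card {i. i < n \<and> \<not> (\<forall>y\<in>topspace X. \<forall>j<n. p i j y = 0)}" arbitrary: p X rule: less_induct)
  case less
  note cont = less.prems(1) and idem = less.prems(2) and y0 = less.prems(3)
  show ?case
  proof (cases "\<exists>r<n. \<exists>c<n. p r c y0 \<noteq> 0")
    case False
    define V where "V = {y \<in> topspace X. (\<Sum>i<n. \<Sum>j<n. cmod (p i j y)) \<in> {..<1}}"
    have "continuous_map X euclideanreal (\<lambda>y. \<Sum>i<n. \<Sum>j<n. cmod (p i j y))"
      by (intro continuous_map_sum continuous_map_norm cont) auto
    then have "openin X V" unfolding V_def by (rule openin_continuous_map_preimage) simp
    moreover have "y0 \<in> V" using False y0 by (simp add: V_def)
    moreover have "p i j y = 0" if "y \<in> V" "i < n" "j < n" for y i j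
      using idempotent_matrix_small[of n "\<lambda>i j. p i j y" i j] idem that by (auto simp: V_def)
    ultimately show ?thesis 
      by (intro exI[of _ V] exI[of _ "0::nat"] exI[of _ "\<lambda>_ _ _. 0"])
        (simp add: matrix_factorization_def)
  next
    case True
    then obtain r c where r: "r < n" and c: "c < n" and rc: "p r c y0 \<noteq> 0" by blast
    define D where "D = {y \<in> topspace X. p r c y \<in> - {0}}"
    have D: "openin X D" unfolding D_def by (rule openin_continuous_map_preimage[OF cont[OF r c]]) auto
    have DX: "D \<subseteq> topspace X" by (auto simp: D_def)
    have nz: "p r c y \<noteq> 0" if "y \<in> D" for y using that by (simp add: D_def)
    define X' where "X' = subtopology X D"
    have X': "topspace X' = D" using DX by (auto simp: X'_def)
    \<comment> \<open>\<open>l\<close> is column \<open>c\<close> of \<open>p\<close> divided by the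
      pivot. Its entry at \<open>r\<close> is \<open>1\<close>, so row \<open>r\<close> of
      \<open>p'\<close> vanishes; and \<open>p l = l\<close>, because an idempotent fixes its own
      columns, which makes \<open>p'\<close> idempotent again.\<close>
    define l where "l i y = p i c y / p r c y" for i y
    define p' where "p' i j y = p i j y - l i y * p r j y" for i j y
    have l_cont: "continuous_map X' euclidean (l i)" if "i < n" for i
    proof -
      have "continuous_map X' euclidean (p i c)" "continuous_map X' euclidean (p r c)"
        unfolding X'_def using cont that r c by (auto intro: continuous_map_from_subtopology)
      then show ?thesis
        unfolding l_def continuous_map_atin using nz by (auto intro!: tendsto_divide simp: X')
    qed
    have pl: "(\<Sum>k<n. p i k y * l k y) = l i y" if "i < n" "y \<in> D" for i y
    proof -
      have "(\<Sum>k<n. p i k y * l k y) = (\<Sum>k<n. p i k y * p k c y) / p r c y"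
        by (simp add: l_def sum_divide_distrib)
      then show ?thesis using idem[of y i c] that c DX by (auto simp: l_def)
    qed
    have lr: "l r y = 1" if "y \<in> D" for y using nz[OF that] by (simp add: l_def)
    have idem': "(\<Sum>k<n. p' i k y * p' k j y) = p' i j y" if y: "y \<in> D" and i: "i < n" and j: "j < n" for i j y
    proof -
      have "(\<Sum>k<n. p' i k y * p' k j y) = (\<Sum>k<n. p i k y * p k j y) - (\<Sum>k<n. p i k y * l k y) * p r j y
          - l i y * (\<Sum>k<n. p r k y * p k j y) + l i y * (\<Sum>k<n. p r k y * l k y) * p r j y"
        unfolding p'_def sum_distrib_left sum_distrib_right
        by (simp add: algebra_simps sum.distrib sum_subtractf)
      then show ?thesis using y i j r DX by (simp add: idem subset_iff pl lr p'_def)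
    qed
    have "\<exists>V k L R. y0 \<in> V \<and> matrix_factorization X' n p' V k L R"
    proof (rule less.hyps)
      have "{i. i < n \<and> \<not> (\<forall>y\<in>topspace X'. \<forall>j<n. p' i j y = 0)} \<subset> {i. i < n \<and> \<not> (\<forall>y\<in>topspace X. \<forall>j<n. p i j y = 0)}"
      proof (rule psubsetI)
        show "{i. i < n \<and> \<not> (\<forall>y\<in>topspace X'. \<forall>j<n. p' i j y = 0)} \<subseteq> {i. i < n \<and> \<not> (\<forall>y\<in>topspace X. \<forall>j<n. p i j y = 0)}"
        proof (rule Collect_mono, rule impI)
          fix i assume i: "i < n \<and> \<not> (\<forall>y\<in>topspace X'. \<forall>j<n. p' i j y = 0)"
          \<comment> \<open>A row of \<open>p\<close> that is zero on \<open>X\<close> has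
            \<open>l i = 0\<close> as well, so it stays zero in \<open>p'\<close>; no new non-zero
            rows appear.\<close>
          have "\<forall>y\<in>topspace X'. \<forall>j<n. p' i j y = 0" if "\<forall>y\<in>topspace X. \<forall>j<n. p i j y = 0"
            using that DX c by (simp add: X' p'_def l_def subset_iff)
          with i show "i < n \<and> \<not> (\<forall>y\<in>topspace X. \<forall>j<n. p i j y = 0)" by blast
        qed
        have "r \<notin> {i. i < n \<and> \<not> (\<forall>y\<in>topspace X'. \<forall>j<n. p' i j y = 0)}"
          by (auto simp: X' p'_def lr)
        moreover have "r \<in> {i. i < n \<and> \<not> (\<forall>y\<in>topspace X. \<forall>j<n. p i j y = 0)}"
          using r c rc y0 by auto
        ultimately show "{i. i < n \<and> \<not> (\<forall>y\<in>topspace X'. \<forall>j<n. p' i j y = 0)} \<noteq> {i. i < n \<and> \<not> (\<forall>y\<in>topspace X. \<forall>j<n. p i j y = 0)}"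
          by blast
      qed
      then show "card {i. i < n \<and> \<not> (\<forall>y\<in>topspace X'. \<forall>j<n. p' i j y = 0)} < card {i. i < n \<and> \<not> (\<forall>y\<in>topspace X. \<forall>j<n. p i j y = 0)}"
        by (intro psubset_card_mono) auto
      show "continuous_map X' euclidean (p' i j)" if ij: "i < n" "j < n" for i j
      proof -
        have "continuous_map X' euclidean (p i j)" "continuous_map X' euclidean (p r j)"
          unfolding X'_def using cont ij r by (simp_all add: continuous_map_from_subtopology)
        then show ?thesis
          unfolding p'_def by (intro continuous_map_diff continuous_map_mult l_cont[OF ij(1)])
      qed
      show "(\<Sum>k<n. p' i k y * p' k j y) = p' i j y" if "y \<in> topspace X'" "i < n" "j < n" for y i j
        using idem' that unfolding X' by blast
      show "y0 \<in> topspace X'" using y0 rc by (simp add: X' D_def)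
    qed
    then obtain V k L R where yV: "y0 \<in> V" and F: "matrix_factorization X' n p' V k L R" by blast
    note V = matrix_factorizationD(1)[OF F] yV and LR = matrix_factorizationD(2)[OF F]
      and RL = matrix_factorizationD(3)[OF F] and LRp = matrix_factorizationD(4)[OF F]
    have VD: "V \<subseteq> D" using V openin_subset X' by blast
    have sub: "subtopology X' V = subtopology X V" unfolding X'_def subtopology_subtopology using VD by (simp add: Int_absorb1)
    have oV: "openin X V" using V D openin_trans_full unfolding X'_def by blast
    \<comment> \<open>The splitting of \<open>p'\<close> is enlarged at the new index
      \<open>k\<close> by the column \<open>l\<close> and by the pivot row of
      \<open>p\<close>.\<close>
    define L' where "L' i a = (if a < k then L i a else l i)" for i a
    define R' where "R' a i = (if a < k then R a i else p r i)" for a i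
    have Rp: "(\<Sum>i<n. R a i y * p' i j y) = R a j y" if "a < k" "j < n" "y \<in> V" for a j y
    proof -
      have "(\<Sum>i<n. R a i y * p' i j y) = (\<Sum>i<n. R a i y * (\<Sum>b<k. L i b y * R b j y))"
        using LRp that by simp
      also have "\<dots> = (\<Sum>b<k. (\<Sum>i<n. R a i y * L i b y) * R b j y)"
        by (simp add: sum_distrib_left sum_distrib_right mult.assoc) (rule sum.swap)
      also have "\<dots> = (\<Sum>b<k. (if a = b then 1 else 0) * R b j y)" using RL that by simp
      finally show ?thesis using sum_delta_mult[OF that(1)] by simp
    qed
    have pL: "(\<Sum>j<n. p' i j y * L j a y) = L i a y" if "a < k" "i < n" "y \<in> V" for a i y
    proof -
      have "(\<Sum>j<n. p' i j y * L j a y) = (\<Sum>j<n. (\<Sum>b<k. L i b y * R b j y) * L j a y)"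
        using LRp that by simp
      also have "\<dots> = (\<Sum>b<k. L i b y * (\<Sum>j<n. R b j y * L j a y))"
        by (simp add: sum_distrib_left sum_distrib_right mult.assoc) (rule sum.swap)
      also have "\<dots> = (\<Sum>b<k. (if a = b then 1 else 0) * L i b y)" using RL that by (auto intro!: sum.cong)
      finally show ?thesis using sum_delta_mult[OF that(1)] by simp
    qed
    have p'l: "(\<Sum>j<n. p' i j y * l j y) = 0" if "i < n" "y \<in> V" for i y
    proof -
      have "(\<Sum>j<n. p' i j y * l j y) = (\<Sum>j<n. p i j y * l j y) - l i y * (\<Sum>j<n. p r j y * l j y)"
        by (simp add: p'_def algebra_simps sum_subtractf sum_distrib_left)
      then show ?thesis using pl lr r that VD by (simp add: subset_iff)
    qed
    have pp': "(\<Sum>i<n. p r i y * p' i j y) = 0" if "j < n" "y \<in> V" for j y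
    proof -
      have "(\<Sum>i<n. p r i y * p' i j y) = (\<Sum>i<n. p r i y * p i j y) - (\<Sum>i<n. p r i y * l i y) * p r j y"
        by (simp add: p'_def algebra_simps sum_subtractf sum_distrib_left)
      then show ?thesis using pl lr r that VD DX by (simp add: subset_iff idem)
    qed
    \<comment> \<open>The cross terms vanish because \<open>R = R p'\<close> and
      \<open>L = p' L\<close>, while \<open>p' l = 0\<close> and the pivot row of \<open>p\<close>
      times \<open>p'\<close> is zero.\<close>
    have Rl: "(\<Sum>i<n. R a i y * l i y) = 0" if "a < k" "y \<in> V" for a y
    proof -
      have "(\<Sum>j<n. R a j y * l j y) = (\<Sum>j<n. (\<Sum>i<n. R a i y * p' i j y) * l j y)" using Rp that by simp
      also have "\<dots> = (\<Sum>i<n. R a i y * (\<Sum>j<n. p' i j y * l j y))"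
        by (simp add: sum_distrib_left sum_distrib_right mult.assoc) (rule sum.swap)
      finally show ?thesis using p'l that by simp
    qed
    have pL0: "(\<Sum>i<n. p r i y * L i b y) = 0" if "b < k" "y \<in> V" for b y
    proof -
      have "(\<Sum>i<n. p r i y * L i b y) = (\<Sum>i<n. p r i y * (\<Sum>j<n. p' i j y * L j b y))" using pL that by simp
      also have "\<dots> = (\<Sum>j<n. (\<Sum>i<n. p r i y * p' i j y) * L j b y)"
        by (simp add: sum_distrib_left sum_distrib_right mult.assoc) (rule sum.swap)
      finally show ?thesis using pp' that by simp
    qed
    have "continuous_map (subtopology X V) euclidean (L' i a) \<and> continuous_map (subtopology X V) euclidean (R' a i)"
      if "i < n" for i a
      using LR[OF that, of a] continuous_map_from_subtopology[OF l_cont[OF that], of V] cont[OF r that] unfolding sub L'_def R'_def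
      by (auto intro: continuous_map_from_subtopology)
    moreover have "(\<Sum>i<n. R' a i y * L' i b y) = (if a = b then 1 else 0)" if "y \<in> V" "a < Suc k" "b < Suc k" for y a b
      using that RL[OF that(1)] Rl[OF _ that(1)] pL0[OF _ that(1)] pl[OF r] lr VD
      by (auto simp: L'_def R'_def subset_iff less_Suc_eq)
    moreover have "(\<Sum>a<Suc k. L' i a y * R' a j y) = p i j y" if "y \<in> V" "i < n" "j < n" for y i j
      using LRp[OF that] by (simp add: L'_def R'_def p'_def)
    ultimately have "matrix_factorization X n p V (Suc k) L' R'"
      unfolding matrix_factorization_def using oV by blast
    then show ?thesis using yV by blast
  qed
qed

text \<open>Induction on the number of coordinates kept: each step adds one multiple of a unit
  vector. With \<open>\<psi>\<close> a coordinate of a linear map, the values on unit vectors are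
  matrix entries.\<close>

lemma linear_complex_space_expand:
  assumes add: "\<And>u v. u \<in> topspace (complex_space n) \<Longrightarrow> v \<in> topspace (complex_space n) \<Longrightarrow>
      \<psi> (\<lambda>i. u i + v i) = \<psi> u + (\<psi> v :: complex)"
    and scale: "\<And>c v. v \<in> topspace (complex_space n) \<Longrightarrow> \<psi> (\<lambda>i. c * v i) = c * \<psi> v"
    and v: "v \<in> topspace (complex_space n)"
  shows "\<psi> v = (\<Sum>j<n. v j * \<psi> (\<lambda>i. if i = j then 1 else 0))"
proof -
  have "\<psi> (\<lambda>i. if i < m then v i else 0) = (\<Sum>j<m. v j * \<psi> (\<lambda>i. if i = j then 1 else 0))" if "m \<le> n" for m
    using that
  proof (induction m)
    case 0
    have "\<psi> (\<lambda>i. 0 * (0::complex)) = 0 * \<psi> (\<lambda>i. 0)" by (rule scale) (simp add: topspace_complex_space)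
    then show ?case by simp
  next
    case (Suc m)
    have eq: "(\<lambda>i. if i < Suc m then v i else 0) =
        (\<lambda>i. (if i < m then v i else 0) + v m * (if i = m then 1 else 0))"
      by (auto simp: less_Suc_eq)
    have d: "(\<lambda>i. if i = m then 1 else 0 :: complex) \<in> topspace (complex_space n)"
      using Suc.prems by (auto simp: topspace_complex_space)
    have vm: "(\<lambda>i. if i < m then v i else 0) \<in> topspace (complex_space n)"
      using Suc.prems by (auto simp: topspace_complex_space)
    have dm: "(\<lambda>i. v m * (if i = m then 1 else 0)) \<in> topspace (complex_space n)"
      using Suc.prems by (auto simp: topspace_complex_space)
    show ?case unfolding eq add[OF vm dm] scale[OF d] using Suc by simp
  qed
  moreover have "(\<lambda>i. if i < n then v i else 0) = v" using v by (auto simp: topspace_complex_space)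
  ultimately show ?thesis by force
qed

text \<open>The image of an idempotent \<open>P\<close> is its set of fixed points. Written as
  \<open>P e = e\<close>, membership is an equation, and all operations are inherited unchanged from
  \<open>E\<close>.\<close>

definition vb_sub :: "('e \<Rightarrow> 'e) \<Rightarrow> ('e, 'y, 'g) vbundle \<Rightarrow> ('e, 'y, 'g) vbundle" where
  "vb_sub P E = E\<lparr>vb_total := subtopology (vb_total E) {e. P e = e}\<rparr>"

lemma vb_sub_simps [simp]:
  "e \<in> topspace (vb_total (vb_sub P E)) \<longleftrightarrow> e \<in> topspace (vb_total E) \<and> P e = e"
  "vb_proj (vb_sub P E) = vb_proj E" "vb_add (vb_sub P E) = vb_add E"
  "vb_scale (vb_sub P E) = vb_scale E" "vb_act (vb_sub P E) = vb_act E"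
  by (auto simp: vb_sub_def)

lemma in_fibre_vb_sub: "e \<in> vb_fibre (vb_sub P E) y \<longleftrightarrow> e \<in> vb_fibre E y \<and> P e = e"
  by (auto simp: vb_fibre_def)

lemma vb_sub_cont:
  "continuous_map X (vb_total (vb_sub P E)) h \<longleftrightarrow>
     continuous_map X (vb_total E) h \<and> (\<forall>x\<in>topspace X. P (h x) = h x)"
  by (auto simp: vb_sub_def continuous_map_in_subtopology)

text \<open>In a chart of \<open>E\<close>, \<open>P\<close> becomes an idempotent matrix
  \<open>p\<close> with continuous entries. Splitting it as \<open>L R\<close> near
  \<open>y0\<close> yields the coordinate map \<open>R k\<close> and the parametrization by
  \<open>s\<close> after \<open>L\<close>.\<close>

lemma vb_chart_vb_sub:
  assumes E: "g_vector_bundle GG Y E" and P: "g_bundle_map GG Y E E P"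
    and idem: "\<And>e. e \<in> topspace (vb_total E) \<Longrightarrow> P (P e) = P e"
    and y0: "y0 \<in> topspace (gs_total Y)"
  shows "\<exists>V m l t. y0 \<in> V \<and> vb_chart (gs_total Y) (vb_sub P E) V m l t"
proof -
  interpret E: g_bundle GG Y E using E by unfold_locales
  note [simp] = E.bm_total[OF P] E.bm_add[OF P] E.bm_scale[OF P] E.bm_in[OF P]
  obtain U n k s where U: "y0 \<in> U" and ch: "vb_chart (gs_total Y) E U n k s" by (rule E.chart[OF y0])
  note c = vb_chartD[OF ch]
  have UY: "U \<subseteq> topspace (gs_total Y)" using c(1) openin_subset by blast
  define \<delta> where "\<delta> j = (\<lambda>i. if i = j then 1 else 0 :: complex)" for j :: nat
  have \<delta>: "\<delta> j \<in> topspace (complex_space n)" if "j < n" for j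
    using that by (auto simp: \<delta>_def topspace_complex_space)
  define p where "p i j y = k (P (s y (\<delta> j))) i" for i j y
  let ?X = "subtopology (gs_total Y) U"
  \<comment> \<open>On chart coordinates \<open>P\<close> is multiplication by \<open>p\<close>,
    whose columns are the images of the unit vectors.\<close>
  have kP: "k (P e) i = (\<Sum>j<n. p i j y * k e j)" if y: "y \<in> U" and e: "e \<in> vb_fibre E y" for y e i
  proof -
    have sv: "s y (\<lambda>i. u i + v i) = vb_add E (s y u) (s y v)"
      if "u \<in> topspace (complex_space n)" "v \<in> topspace (complex_space n)" for u v
      using c(6)[OF y c(8)[OF y c(4)[OF y that(1)] c(4)[OF y that(2)]]]
        c(9)[OF y c(4)[OF y that(1)] c(4)[OF y that(2)]] c(5)[OF y] that by simp
    have sc: "s y (\<lambda>i. a * v i) = vb_scale E a (s y v)" if "v \<in> topspace (complex_space n)" for a v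
      using c(6)[OF y c(10)[OF y c(4)[OF y that]]] c(11)[OF y c(4)[OF y that]] c(5)[OF y] that by simp
    have f: "s y v \<in> topspace (vb_total E)" "vb_proj E (s y v) = y" "P (s y v) \<in> vb_fibre E y"
      if "v \<in> topspace (complex_space n)" for v
      using c(4)[OF y that] by (auto simp: vb_fibre_def)
    have "k (P (s y (k e))) i = (\<Sum>j<n. k e j * k (P (s y (\<lambda>i. if i = j then 1 else 0))) i)"
      by (rule linear_complex_space_expand) (use y c(9,11)[OF y] f in \<open>simp_all add: sv sc c(7)[OF y e]\<close>)
    then show ?thesis using c(6)[OF y e] by (simp add: p_def \<delta>_def mult.commute)
  qed
  have "\<exists>V m L R. y0 \<in> V \<and> matrix_factorization ?X n p V m L R"
  proof (rule idempotent_matrix_split)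
    fix i j assume ij: "i < n" "j < n"
    have "continuous_map ?X (prod_topology ?X (complex_space n)) (\<lambda>y. (y, \<delta> j))"
      using \<delta>[OF ij(2)] by (simp add: continuous_map_pairwise o_def)
    from continuous_map_comp2[OF continuous_map_comp2[OF this c(3)] g_bundle_map_cont[OF P]]
    have 1: "continuous_map ?X (vb_total E) (\<lambda>y. P (s y (\<delta> j)))" by simp
    have "continuous_map ?X (complex_space n) (\<lambda>y. k (P (s y (\<delta> j))))"
      by (rule continuous_map_comp2[OF continuous_map_into_sub[OF 1] c(2)])
        (use c(4)[OF _ \<delta>[OF ij(2)]] in \<open>auto simp: vb_fibre_def\<close>)
    then show "continuous_map ?X euclidean (p i j)"
      unfolding continuous_map_complex_space p_def by blast
    fix y assume "y \<in> topspace ?X"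
    then have y: "y \<in> U" by simp
    have f: "s y (\<delta> j) \<in> vb_fibre E y" using c(4)[OF y \<delta>[OF ij(2)]] .
    have "k (P (P (s y (\<delta> j)))) i = (\<Sum>l<n. p i l y * p l j y)"
      using kP[OF y E.bm_in[OF P f], of i] by (simp add: p_def)
    then show "(\<Sum>l<n. p i l y * p l j y) = p i j y"
      using idem f by (simp add: vb_fibre_def p_def)
  qed (use U UY in auto)
  then obtain V m L R where yV: "y0 \<in> V" and F: "matrix_factorization ?X n p V m L R" by blast
  note V = matrix_factorizationD(1)[OF F] yV and LR = matrix_factorizationD(2)[OF F]
    and RL = matrix_factorizationD(3)[OF F] and LRp = matrix_factorizationD(4)[OF F]
  have VU: "V \<subseteq> U" using V openin_subset by fastforce
  have oV: "openin (gs_total Y) V" using V c(1) openin_trans_full by blast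
  have sub: "subtopology ?X V = subtopology (gs_total Y) V"
    using VU by (simp add: subtopology_subtopology Int_absorb1)
  define l where "l e = (\<lambda>a. if a < m then \<Sum>i<n. R a i (vb_proj E e) * k e i else 0)" for e
  define w where "w y v = (\<lambda>i. if i < n then \<Sum>a<m. L i a y * v a else 0)" for y and v :: "nat \<Rightarrow> complex"
  have w: "w y v \<in> topspace (complex_space n)" for y v by (auto simp: w_def topspace_complex_space)
  \<comment> \<open>\<open>p L = L R L = L\<close>, so the vectors parametrized by \<open>L\<close>
    are fixed by \<open>P\<close>.\<close>
  have Ps: "P (s y (w y v)) = s y (w y v)" if y: "y \<in> V" for y v
  proof -
    have yU: "y \<in> U" using y VU by blast
    have f: "s y (w y v) \<in> vb_fibre E y" using c(4)[OF yU w] .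
    have "k (P (s y (w y v))) i = w y v i" for i
    proof (cases "i < n")
      case True
      have "k (P (s y (w y v))) i = (\<Sum>j<n. p i j y * w y v j)"
        using kP[OF yU f] c(5)[OF yU w] by simp
      also have "\<dots> = (\<Sum>j<n. (\<Sum>b<m. L i b y * R b j y) * (\<Sum>a<m. L j a y * v a))"
        using LRp[OF y True] by (simp add: w_def)
      also have "\<dots> = (\<Sum>j<n. \<Sum>b<m. \<Sum>a<m. L i b y * (R b j y * L j a y) * v a)"
        by (simp only: sum_product) (simp add: mult_ac)
      also have "\<dots> = (\<Sum>b<m. \<Sum>a<m. \<Sum>j<n. L i b y * (R b j y * L j a y) * v a)"
        by (subst sum.swap) (rule sum.cong[OF refl], rule sum.swap)
      also have "\<dots> = (\<Sum>b<m. \<Sum>a<m. L i b y * (\<Sum>j<n. R b j y * L j a y) * v a)"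
        by (simp add: sum_distrib_left sum_distrib_right)
      also have "\<dots> = (\<Sum>b<m. L i b y * (\<Sum>a<m. (if b = a then 1 else 0) * v a))"
        using RL[OF y] by (simp add: sum_distrib_left mult.assoc)
      also have "\<dots> = w y v i" using True by (simp add: sum_delta_mult w_def)
      finally show ?thesis .
    next
      case False
      then show ?thesis using c(7)[OF yU E.bm_in[OF P f]] w by (simp add: topspace_complex_space)
    qed
    then have "k (P (s y (w y v))) = k (s y (w y v))" using c(5)[OF yU w] by auto
    then show ?thesis using c(6)[OF yU f] c(6)[OF yU E.bm_in[OF P f]] by metis
  qed
  have "vb_chart (gs_total Y) (vb_sub P E) V m l (\<lambda>y v. s y (w y v))"
    unfolding vb_chart_def
  proof (intro conjI ballI allI)
    show "openin (gs_total Y) V" by (rule oV)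
    let ?W = "subtopology (vb_total (vb_sub P E)) {e. vb_proj (vb_sub P E) e \<in> V}"
    have iW: "continuous_map ?W (vb_total E) (\<lambda>e. e)"
      by (simp add: vb_sub_def subtopology_subtopology continuous_map_sub_id)
    have kW: "continuous_map ?W (complex_space n) k"
      by (rule continuous_map_comp2[OF continuous_map_into_sub[OF iW] c(2)]) (use VU in auto)
    have pW: "continuous_map ?W (subtopology (gs_total Y) V) (vb_proj E)"
      by (rule continuous_map_into_sub[OF continuous_map_comp2[OF iW E.proj_cont]]) auto
    show "continuous_map ?W (complex_space m) l"
      unfolding continuous_map_complex_space
    proof (intro conjI allI ballI impI)
      fix a
      have "continuous_map ?W euclidean (\<lambda>e. R a i (vb_proj E e) * k e i)" if "a < m" "i < n" for i
        using kW[unfolded continuous_map_complex_space] continuous_map_comp2[OF pW, of euclidean "R a i"] LR[OF that(2,1)]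
        by (auto intro!: continuous_map_mult simp: sub)
      then show "continuous_map ?W euclidean (\<lambda>e. l e a)"
        by (cases "a < m") (auto simp: l_def intro!: continuous_map_sum)
    qed (simp add: l_def)
    let ?Z = "prod_topology (subtopology (gs_total Y) V) (complex_space m)"
    have fs: "continuous_map ?Z (subtopology (gs_total Y) V) fst" "continuous_map ?Z (complex_space m) snd"
      by (simp_all add: continuous_map_fst continuous_map_snd)
    have "continuous_map ?Z (complex_space n) (\<lambda>z. w (fst z) (snd z))"
      unfolding continuous_map_complex_space
    proof (intro conjI allI ballI impI)
      fix i
      have "continuous_map ?Z euclidean (\<lambda>z. L i a (fst z) * snd z a)" if "a < m" "i < n" for a
        using fs(2)[unfolded continuous_map_complex_space] continuous_map_comp2[OF fs(1), of euclidean "L i a"] LR[OF that(2,1)]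
        by (auto intro!: continuous_map_mult simp: sub)
      then show "continuous_map ?Z euclidean (\<lambda>z. w (fst z) (snd z) i)"
        by (cases "i < n") (auto simp: w_def intro!: continuous_map_sum)
    qed (simp add: w_def)
    moreover have "continuous_map ?Z ?X fst"
      using fs(1) VU by (auto simp: continuous_map_in_subtopology)
    ultimately have "continuous_map ?Z (prod_topology ?X (complex_space n)) (\<lambda>z. (fst z, w (fst z) (snd z)))"
      by (simp add: continuous_map_pairwise o_def)
    from continuous_map_comp2[OF this c(3)]
    show "continuous_map ?Z (vb_total (vb_sub P E)) (\<lambda>(y, v). s y (w y v))"
      unfolding vb_sub_cont using Ps by (auto simp: case_prod_unfold)
    fix y assume y: "y \<in> V"
    then have yU: "y \<in> U" using VU by blast
    { fix v assume v: "v \<in> topspace (complex_space m)"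
      show "s y (w y v) \<in> vb_fibre (vb_sub P E) y"
        using c(4)[OF yU w] Ps[OF y] by (simp add: in_fibre_vb_sub)
      have pr: "vb_proj E (s y (w y v)) = y" using c(4)[OF yU w] by (simp add: vb_fibre_def)
      have "l (s y (w y v)) a = v a" for a
      proof (cases "a < m")
        case True
        have "l (s y (w y v)) a = (\<Sum>i<n. R a i y * (\<Sum>b<m. L i b y * v b))"
          using True pr c(5)[OF yU w] by (simp add: l_def w_def)
        also have "\<dots> = (\<Sum>b<m. (\<Sum>i<n. R a i y * L i b y) * v b)"
          by (simp add: sum_distrib_left sum_distrib_right mult.assoc) (rule sum.swap)
        also have "\<dots> = (\<Sum>b<m. (if a = b then 1 else 0) * v b)" using RL[OF y True] by simp
        finally show ?thesis using sum_delta_mult[OF True] by simp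
      next
        case False
        then show ?thesis using v by (simp add: l_def topspace_complex_space)
      qed
      then show "l (s y (w y v)) = v" by blast }
    fix e assume "e \<in> vb_fibre (vb_sub P E) y"
    then have e: "e \<in> vb_fibre E y" "P e = e" by (simp_all add: in_fibre_vb_sub)
    then have pe: "vb_proj E e = y" by (simp add: vb_fibre_def)
    \<comment> \<open>\<open>L R = p\<close>, and \<open>p\<close> fixes the coordinates of a vector
      fixed by \<open>P\<close>.\<close>
    have "w y (l e) i = k e i" for i
    proof (cases "i < n")
      case True
      have "w y (l e) i = (\<Sum>a<m. L i a y * (\<Sum>j<n. R a j y * k e j))"
        using True pe by (simp add: w_def l_def)
      also have "\<dots> = (\<Sum>j<n. (\<Sum>a<m. L i a y * R a j y) * k e j)"
        by (simp add: sum_distrib_left sum_distrib_right mult.assoc) (rule sum.swap)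
      also have "\<dots> = (\<Sum>j<n. p i j y * k e j)" using LRp[OF y True] by simp
      also have "\<dots> = k e i" using kP[OF yU e(1), of i] e(2) by simp
      finally show ?thesis .
    next
      case False
      then show ?thesis using c(7)[OF yU e(1)] by (simp add: w_def topspace_complex_space)
    qed
    then have "w y (l e) = k e" by blast
    then show "s y (w y (l e)) = e" using c(6)[OF yU e(1)] by simp
    { fix e' assume "e' \<in> vb_fibre (vb_sub P E) y"
      then have e': "e' \<in> vb_fibre E y" "P e' = e'" by (simp_all add: in_fibre_vb_sub)
      show "vb_add (vb_sub P E) e e' \<in> vb_fibre (vb_sub P E) y"
        using e e' E.add_in[OF e(1) e'(1)] by (simp add: in_fibre_vb_sub) (simp add: vb_fibre_def)
      show "l (vb_add (vb_sub P E) e e') = (\<lambda>i. l e i + l e' i)"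
        using e'(1) E.add_in[OF e(1) e'(1)] pe c(9)[OF yU e(1) e'(1)]
        by (auto simp: l_def vb_fibre_def algebra_simps sum.distrib) }
    fix a
    show "vb_scale (vb_sub P E) a e \<in> vb_fibre (vb_sub P E) y"
      using e E.scale_in[OF e(1)] by (simp add: in_fibre_vb_sub) (simp add: vb_fibre_def)
    show "l (vb_scale (vb_sub P E) a e) = (\<lambda>i. a * l e i)"
      using E.scale_in[OF e(1), of a] pe c(11)[OF yU e(1)]
      by (auto simp: l_def vb_fibre_def algebra_simps sum_distrib_left)
  qed
  then show ?thesis using V(2) by blast
qed

lemma g_vector_bundle_vb_sub:
  assumes E: "g_vector_bundle GG Y E" and P: "g_bundle_map GG Y E E P"
    and idem: "\<And>e. e \<in> topspace (vb_total E) \<Longrightarrow> P (P e) = P e"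
  shows "g_vector_bundle GG Y (vb_sub P E)"
proof -
  interpret E: g_bundle GG Y E using E by unfold_locales
  let ?S = "vb_sub P E"
  show ?thesis
  proof (rule g_vector_bundleI)
    show "vector_bundle (gs_total Y) ?S"
      unfolding vector_bundle_iff_chart
    proof (intro conjI ballI)
      show "continuous_map (vb_total ?S) (gs_total Y) (vb_proj ?S)"
        using E.proj_cont by (simp add: vb_sub_def continuous_map_from_subtopology)
    qed (rule vb_chart_vb_sub[OF E P idem])
    let ?X = "subtopology (prod_topology (gb_total GG) (vb_total ?S)) {(g, p). gb_proj GG g = gs_proj Y (vb_proj ?S p)}"
    have g: "continuous_map ?X (gb_total GG) fst" and p: "continuous_map ?X (vb_total ?S) snd"
      by (simp_all add: continuous_map_from_subtopology continuous_map_fst continuous_map_snd)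
    have "continuous_map ?X (vb_total E) (\<lambda>x. vb_act E (fst x) (snd x))"
      by (rule E.act_cont[OF g conjunct1[OF p[unfolded vb_sub_cont]]]) (auto simp: split_beta)
    then show "continuous_map ?X (vb_total ?S) (\<lambda>(g, p). vb_act ?S g p)"
      unfolding vb_sub_cont by (auto simp: case_prod_unfold gb_fibre_def E.bm_act[OF P])
  qed auto
qed

lemma g_bundle_map_vb_sub_incl: "g_bundle_map GG Y (vb_sub P E) E (\<lambda>e. e)"
  by (rule g_bundle_mapI) (auto simp: vb_sub_def continuous_map_sub_id)

lemma g_bundle_map_into_vb_sub:
  assumes "g_bundle_map GG Y D E h" "\<And>e. e \<in> topspace (vb_total D) \<Longrightarrow> P (h e) = h e"
  shows "g_bundle_map GG Y D (vb_sub P E) h"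
  using assms unfolding g_bundle_map_def vb_sub_cont by simp

section \<open>Clifford modules described by their generators\<close>

section \<open>Clifford modules from anticommuting families\<close>

text \<open>In \<open>cl_mult\<close> the range of summation is tied to \<open>p + q\<close>. Here
  the number \<open>N\<close> of generators is separated from \<open>p\<close>, which fixes the
  signs of the squares, so that induction on \<open>N\<close> is possible, also through values
  \<open>N < p\<close>.\<close>

definition cl_mult_upto :: "nat \<Rightarrow> nat \<Rightarrow> clifford \<Rightarrow> clifford \<Rightarrow> clifford" where
  "cl_mult_upto p N a b =
     (\<lambda>R. \<Sum>S\<in>Pow {..<N}. cl_sign p S (sym_diff S R) * a S * b (sym_diff S R))"

lemma cl_mult_eq_upto: "cl_mult p q = cl_mult_upto p (p + q)"
  by (simp add: cl_mult_def cl_mult_upto_def fun_eq_iff)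

lemma finite_below: "S \<subseteq> {..<N::nat} \<Longrightarrow> finite S"
  using finite_subset by blast

text \<open>The new index \<open>N\<close> is larger than all others. In the left factor it has to
  pass every element of \<open>T\<close>, at the cost of \<open>(- 1) ^ card T\<close>; in the right
  factor it already stands last. If it occurs in both, its square contributes a further sign when
  \<open>N < p\<close>.\<close>

lemma cl_sign_insert:
  assumes S: "S \<subseteq> {..<N}" and T: "T \<subseteq> {..<N}"
  shows "cl_sign p S (insert N T) = cl_sign p S T"
    and "cl_sign p (insert N S) T = (- 1) ^ card T * cl_sign p S T"
    and "cl_sign p (insert N S) (insert N T) = (if N < p then - 1 else 1) * (- 1) ^ card T * cl_sign p S T"
proof -
  have N: "N \<notin> S" "N \<notin> T" using assms by auto
  have fin: "finite S" "finite T" using assms finite_below by auto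
  have finP: "finite {(i, j). i \<in> S \<and> j \<in> T \<and> j < i}"
    by (rule finite_subset[of _ "S \<times> T"]) (use fin in auto)
  have 1: "{(i, j). i \<in> S \<and> j \<in> insert N T \<and> j < i} = {(i, j). i \<in> S \<and> j \<in> T \<and> j < i}"
    using S by auto
  have 2: "{(i, j). i \<in> insert N S \<and> j \<in> insert N T \<and> j < i} = {(i, j). i \<in> insert N S \<and> j \<in> T \<and> j < i}"
    using S by auto
  have 3: "{(i, j). i \<in> insert N S \<and> j \<in> T \<and> j < i} = {(i, j). i \<in> S \<and> j \<in> T \<and> j < i} \<union> {N} \<times> T"
    using T by auto
  have "card ({(i, j). i \<in> S \<and> j \<in> T \<and> j < i} \<union> {N} \<times> T) = card {(i, j). i \<in> S \<and> j \<in> T \<and> j < i} + card ({N} \<times> T)"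
    by (rule card_Un_disjoint) (use finP fin N in auto)
  then have 4: "card {(i, j). i \<in> insert N S \<and> j \<in> T \<and> j < i} = card {(i, j). i \<in> S \<and> j \<in> T \<and> j < i} + card T"
    unfolding 3 by (simp add: card_cartesian_product_singleton)
  have 5: "{i \<in> S \<inter> insert N T. i < p} = {i \<in> S \<inter> T. i < p}" "{i \<in> insert N S \<inter> T. i < p} = {i \<in> S \<inter> T. i < p}"
    using N by auto
  have 6: "{i \<in> insert N S \<inter> insert N T. i < p} = (if N < p then insert N {i \<in> S \<inter> T. i < p} else {i \<in> S \<inter> T. i < p})"
    by auto
  show "cl_sign p S (insert N T) = cl_sign p S T"
    unfolding cl_sign_def 1 5 ..
  show "cl_sign p (insert N S) T = (- 1) ^ card T * cl_sign p S T"
    unfolding cl_sign_def 4 5 by (simp add: power_add)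
  show "cl_sign p (insert N S) (insert N T) = (if N < p then - 1 else 1) * (- 1) ^ card T * cl_sign p S T"
    unfolding cl_sign_def 2 4 6 using N fin by (simp add: power_add)
qed

text \<open>With \<open>N\<close> the largest index, an element on \<open>Suc N\<close> generators
  is \<open>a\<^sub>0 + a\<^sub>1 e\<^sub>N\<close> with \<open>a\<^sub>0\<close>,
  \<open>a\<^sub>1\<close> on the first \<open>N\<close> generators. On subsets of
  \<open>{..<N}\<close> this is \<open>a\<^sub>1\<close>, and \<open>a\<close> itself is
  \<open>a\<^sub>0\<close>.\<close>

definition cl_shift :: "nat \<Rightarrow> clifford \<Rightarrow> clifford" where
  "cl_shift N a = (\<lambda>S. a (insert N S))"

text \<open>The main automorphism of the Clifford algebra, which negates every generator. It appears
  when \<open>e\<^sub>N\<close> is moved across an element on lower generators.\<close>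

definition cl_alt :: "clifford \<Rightarrow> clifford" where
  "cl_alt a = (\<lambda>S. (- 1) ^ card S * a S)"

lemma sum_Pow_Suc:
  "(\<Sum>S\<in>Pow {..<Suc N}. f S) = (\<Sum>S\<in>Pow {..<N}. f S) + (\<Sum>S\<in>Pow {..<N}. f (insert N S) :: real)"
proof -
  have inj: "inj_on (insert N) (Pow {..<N})"
    by (rule inj_onI) (metis PowD insert_ident lessThan_iff less_irrefl subsetD)
  have "(\<Sum>S\<in>Pow {..<Suc N}. f S) = (\<Sum>S\<in>Pow {..<N} \<union> insert N ` Pow {..<N}. f S)"
    by (simp only: lessThan_Suc Pow_insert)
  also have "\<dots> = (\<Sum>S\<in>Pow {..<N}. f S) + (\<Sum>S\<in>insert N ` Pow {..<N}. f S)"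
    by (rule sum.union_disjoint) auto
  finally show ?thesis by (simp add: sum.reindex[OF inj])
qed

lemma sym_diff_below: "S \<subseteq> {..<N} \<Longrightarrow> R \<subseteq> {..<N} \<Longrightarrow> sym_diff S R \<subseteq> {..<N::nat}"
  by auto

text \<open>The last equation has on its left the form in which the simplifier leaves the symmetric
  difference of two insertions of \<open>N\<close>.\<close>

lemma sym_diff_insert:
  assumes "S \<subseteq> {..<N}" "R \<subseteq> {..<N::nat}"
  shows "sym_diff (insert N S) R = insert N (sym_diff S R)"
    and "sym_diff S (insert N R) = insert N (sym_diff S R)"
    and "sym_diff (insert N S) (insert N R) = sym_diff S R"
    and "S - insert N R \<union> (R - insert N S) = sym_diff S R"
  using assms by auto

lemma cl_sign_sym_diff_insert:
  assumes S: "S \<subseteq> {..<N}" and R: "R \<subseteq> {..<N}"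
  shows "cl_sign p S (insert N (sym_diff S R)) = cl_sign p S (sym_diff S R)"
    and "cl_sign p (insert N S) (sym_diff S R) = (- 1) ^ card (sym_diff S R) * cl_sign p S (sym_diff S R)"
    and "cl_sign p (insert N S) (insert N (sym_diff S R)) =
      (if N < p then - 1 else 1) * (- 1) ^ card (sym_diff S R) * cl_sign p S (sym_diff S R)"
  using cl_sign_insert[OF S sym_diff_below[OF S R]] by blast+

text \<open>From \<open>e\<^sub>N x = alt x e\<^sub>N\<close> the product of
  \<open>a\<^sub>0 + a\<^sub>1 e\<^sub>N\<close> and \<open>b\<^sub>0 + b\<^sub>1 e\<^sub>N\<close>
  has the part \<open>a\<^sub>0 b\<^sub>0 + a\<^sub>1 (alt b\<^sub>1) e\<^sub>N\<^sup>2\<close>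
  without \<open>e\<^sub>N\<close> and the coefficient
  \<open>a\<^sub>0 b\<^sub>1 + a\<^sub>1 (alt b\<^sub>0)\<close> of
  \<open>e\<^sub>N\<close>.\<close>

lemma cl_mult_upto_Suc:
  assumes R: "R \<subseteq> {..<N}"
  shows "cl_mult_upto p (Suc N) a b R =
      cl_mult_upto p N a b R + (if N < p then - 1 else 1) * cl_mult_upto p N (cl_shift N a) (cl_alt (cl_shift N b)) R"
    and "cl_mult_upto p (Suc N) a b (insert N R) =
      cl_mult_upto p N a (cl_shift N b) R + cl_mult_upto p N (cl_shift N a) (cl_alt b) R"
proof -
  show "cl_mult_upto p (Suc N) a b R =
      cl_mult_upto p N a b R + (if N < p then - 1 else 1) * cl_mult_upto p N (cl_shift N a) (cl_alt (cl_shift N b)) R"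
    unfolding cl_mult_upto_def sum_Pow_Suc sum_distrib_left
    by (intro arg_cong2[where f = "(+)"] sum.cong refl)
      (use R in \<open>simp_all add: sym_diff_insert cl_sign_sym_diff_insert cl_shift_def cl_alt_def\<close>)
  show "cl_mult_upto p (Suc N) a b (insert N R) =
      cl_mult_upto p N a (cl_shift N b) R + cl_mult_upto p N (cl_shift N a) (cl_alt b) R"
    unfolding cl_mult_upto_def sum_Pow_Suc
    by (intro arg_cong2[where f = "(+)"] sum.cong refl)
      (use R in \<open>simp_all add: sym_diff_insert cl_sign_sym_diff_insert cl_shift_def cl_alt_def\<close>)
qed

text \<open>The same decomposition on operators: \<open>a\<^sub>0 + a\<^sub>1 e\<^sub>N\<close> acts
  as \<open>a\<^sub>0\<close> plus \<open>a\<^sub>1\<close> after \<open>g N\<close>, so a basis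
  element acts by the ordered product of the \<open>g i\<close>. With no generators only the scalar
  part is left.\<close>

primrec cl_rep :: "('e, 'y, 'g) vbundle \<Rightarrow> (nat \<Rightarrow> 'e \<Rightarrow> 'e) \<Rightarrow> nat \<Rightarrow> clifford \<Rightarrow> 'e \<Rightarrow> 'e" where
  "cl_rep E g 0 a e = vb_scale E (complex_of_real (a {})) e"
| "cl_rep E g (Suc N) a e = vb_add E (cl_rep E g N a e) (cl_rep E g N (cl_shift N a) (g N e))"

lemma cl_rep_cong: "(\<And>S. S \<subseteq> {..<N} \<Longrightarrow> a S = b S) \<Longrightarrow> cl_rep E g N a e = cl_rep E g N b e"
proof (induction N arbitrary: a b e)
  case (Suc N)
  have 1: "cl_rep E g N a e = cl_rep E g N b e"
    by (rule Suc.IH) (rule Suc.prems, auto)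
  have 2: "cl_rep E g N (cl_shift N a) (g N e) = cl_rep E g N (cl_shift N b) (g N e)"
  proof (rule Suc.IH)
    fix S assume "S \<subseteq> {..<N}"
    then have "insert N S \<subseteq> {..<Suc N}" by auto
    then show "cl_shift N a S = cl_shift N b S" using Suc.prems by (simp add: cl_shift_def)
  qed
  show ?case by (simp only: cl_rep.simps 1 2)
qed simp

text \<open>The bound \<open>M\<close> stays fixed while the lemmas are proved for all
  \<open>N \<le> M\<close>, so that induction on \<open>N\<close> never leaves the family.\<close>

locale anticommuting_family = g_bundle GG Y E
  for GG :: "('g, 'b) group_bundle" and Y :: "('y, 'g, 'b) gspace" and E :: "('e, 'y, 'g) vbundle" +
  fixes p M :: nat and g :: "nat \<Rightarrow> 'e \<Rightarrow> 'e"
  assumes gen_map: "\<And>i. i < M \<Longrightarrow> g_bundle_map GG Y E E (g i)"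
    and gen_square: "\<And>i e. i < M \<Longrightarrow> e \<in> topspace (vb_total E) \<Longrightarrow>
           g i (g i e) = vb_scale E (if i < p then - 1 else 1) e"
    and gen_anticommute: "\<And>i j e. i < M \<Longrightarrow> j < M \<Longrightarrow> i \<noteq> j \<Longrightarrow> e \<in> topspace (vb_total E) \<Longrightarrow>
           g i (g j e) = vb_scale E (- 1) (g j (g i e))"
begin

lemma gen_total:
  "i < M \<Longrightarrow> e \<in> topspace (vb_total E) \<Longrightarrow> g i e \<in> topspace (vb_total E)"
  "i < M \<Longrightarrow> e \<in> topspace (vb_total E) \<Longrightarrow> vb_proj E (g i e) = vb_proj E e"
  using bm_total[OF gen_map] by blast+

lemma rep_map: "N \<le> M \<Longrightarrow> g_bundle_map GG Y E E (cl_rep E g N a)"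
proof (induction N arbitrary: a)
  case 0
  show ?case
    using g_bundle_map_scale[OF g_vector_bundle g_vector_bundle g_bundle_map_id, where c = "complex_of_real (a {})"] by simp
next
  case (Suc N)
  have "g_bundle_map GG Y E E (\<lambda>e. vb_add E (cl_rep E g N a e) (cl_rep E g N (cl_shift N a) (g N e)))"
    using Suc.prems
    by (intro g_bundle_map_add[OF g_vector_bundle g_vector_bundle Suc.IH
          g_bundle_map_comp[OF g_vector_bundle gen_map Suc.IH]]) auto
  then show ?case by simp
qed

lemma rep_total:
  "N \<le> M \<Longrightarrow> e \<in> topspace (vb_total E) \<Longrightarrow> cl_rep E g N a e \<in> topspace (vb_total E)"
  "N \<le> M \<Longrightarrow> e \<in> topspace (vb_total E) \<Longrightarrow> vb_proj E (cl_rep E g N a e) = vb_proj E e"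
  using bm_total[OF rep_map] by blast+

lemma rep_lin:
  "N \<le> M \<Longrightarrow> e \<in> topspace (vb_total E) \<Longrightarrow> cl_rep E g N a (vb_scale E c e) = vb_scale E c (cl_rep E g N a e)"
  "N \<le> M \<Longrightarrow> e \<in> topspace (vb_total E) \<Longrightarrow> e' \<in> topspace (vb_total E) \<Longrightarrow> vb_proj E e' = vb_proj E e \<Longrightarrow>
     cl_rep E g N a (vb_add E e e') = vb_add E (cl_rep E g N a e) (cl_rep E g N a e')"
  using bm_scale[OF rep_map] bm_add[OF rep_map] by blast+

abbreviation "crd \<equiv> vb_coord (gs_total Y) E"

lemma rep_add: "N \<le> M \<Longrightarrow> e \<in> topspace (vb_total E) \<Longrightarrow>
    crd (cl_rep E g N (\<lambda>S. a S + b S) e) i = crd (cl_rep E g N a e) i + crd (cl_rep E g N b e) i"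
proof (induction N arbitrary: a b e)
  case (Suc N)
  have "cl_shift N (\<lambda>S. a S + b S) = (\<lambda>S. cl_shift N a S + cl_shift N b S)" by (simp add: cl_shift_def)
  then show ?case using Suc by (simp add: rep_total gen_total)
qed (simp add: algebra_simps)

lemma rep_scale: "N \<le> M \<Longrightarrow> e \<in> topspace (vb_total E) \<Longrightarrow>
    crd (cl_rep E g N (\<lambda>S. c * a S) e) i = complex_of_real c * crd (cl_rep E g N a e) i"
proof (induction N arbitrary: a e)
  case (Suc N)
  have "cl_shift N (\<lambda>S. c * a S) = (\<lambda>S. c * cl_shift N a S)" by (simp add: cl_shift_def)
  then show ?case using Suc by (simp add: rep_total gen_total algebra_simps)
qed (simp add: algebra_simps)

lemma rep_zero: "N \<le> M \<Longrightarrow> e \<in> topspace (vb_total E) \<Longrightarrow> (\<And>S. S \<subseteq> {..<N} \<Longrightarrow> a S = 0) \<Longrightarrow>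
    crd (cl_rep E g N a e) i = 0"
  using rep_scale[of N e 0 a i] cl_rep_cong[of N a "\<lambda>S. 0 * a S" E g e] by simp

lemma rep_one: "N \<le> M \<Longrightarrow> e \<in> topspace (vb_total E) \<Longrightarrow> cl_rep E g N cl_one e = e"
proof (induction N)
  case 0
  then show ?case by (intro eqI) (simp_all add: cl_basis_def)
next
  case (Suc N)
  then show ?case
    by (intro eqI) (simp_all add: rep_total gen_total rep_zero cl_basis_def cl_shift_def)
qed

text \<open>The top generator has zero lower part and coefficient one at \<open>e\<^sub>N\<close>;
  every other generator has no \<open>e\<^sub>N\<close> part and is settled by the induction
  hypothesis.\<close>

lemma rep_gen: "N \<le> M \<Longrightarrow> e \<in> topspace (vb_total E) \<Longrightarrow> i < N \<Longrightarrow> cl_rep E g N (cl_gen i) e = g i e"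
proof (induction N)
  case (Suc N)
  have e: "e \<in> topspace (vb_total E)" and NM: "N < M" using Suc.prems by auto
  show ?case
  proof (cases "i = N")
    case True
    have a: "crd (cl_rep E g N (cl_gen i) e) j = 0" for j
      by (rule rep_zero) (use e NM True in \<open>auto simp: cl_basis_def\<close>)
    have b: "cl_rep E g N (cl_shift N (cl_gen i)) (g N e) = cl_rep E g N cl_one (g N e)"
      by (rule cl_rep_cong) (use True in \<open>auto simp: cl_basis_def cl_shift_def\<close>)
    have c: "cl_rep E g N cl_one (g N e) = g N e" using NM e by (simp add: rep_one gen_total)
    show ?thesis
      by (rule eqI) (use e NM True in \<open>simp_all add: rep_total gen_total a[unfolded True] b[unfolded True] c\<close>)
  next
    case False
    then have a: "cl_rep E g N (cl_gen i) e = g i e" using Suc by simp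
    have b: "crd (cl_rep E g N (cl_shift N (cl_gen i)) (g N e)) j = 0" for j
      by (rule rep_zero) (use e NM False in \<open>auto simp: cl_basis_def cl_shift_def gen_total\<close>)
    show ?thesis
      by (rule eqI) (use e NM False Suc.prems in \<open>simp_all add: rep_total gen_total a b\<close>)
  qed
qed simp

text \<open>Passing the \<open>card S\<close> generators of a basis element costs one sign each.
  With \<open>h = g N\<close> this is the rule \<open>e\<^sub>N x = alt x e\<^sub>N\<close> on the
  level of operators.\<close>

lemma rep_alt:
  assumes h: "g_bundle_map GG Y E E h"
  shows "N \<le> M \<Longrightarrow> (\<And>i e. i < N \<Longrightarrow> e \<in> topspace (vb_total E) \<Longrightarrow> h (g i e) = vb_scale E (- 1) (g i (h e))) \<Longrightarrow>
    e \<in> topspace (vb_total E) \<Longrightarrow> h (cl_rep E g N a e) = cl_rep E g N (cl_alt a) (h e)"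
proof (induction N arbitrary: a e)
  case 0
  then show ?case by (simp add: bm_scale[OF h] cl_alt_def)
next
  case (Suc N)
  note e = Suc.prems(3) and NM = Suc.prems(1)
  note [simp] = bm_total[OF h]
  have IH: "h (cl_rep E g N a e) = cl_rep E g N (cl_alt a) (h e)" if "e \<in> topspace (vb_total E)" for a e
    using Suc that by simp
  \<comment> \<open>Adding \<open>N\<close> to \<open>S\<close> changes the parity of its
    cardinality, hence the factor \<open>- 1\<close> when \<open>cl_shift\<close> and
    \<open>cl_alt\<close> are interchanged.\<close>
  have c: "cl_rep E g N (cl_shift N (cl_alt a)) x = cl_rep E g N (\<lambda>S. (- 1) * cl_alt (cl_shift N a) S) x" for x
  proof (rule cl_rep_cong)
    fix S assume S: "S \<subseteq> {..<N}"
    then have "N \<notin> S" "finite S" using finite_below by auto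
    then show "cl_shift N (cl_alt a) S = (- 1) * cl_alt (cl_shift N a) S"
      by (simp add: cl_shift_def cl_alt_def)
  qed
  have "h (cl_rep E g (Suc N) a e) = vb_add E (cl_rep E g N (cl_alt a) (h e))
      (vb_scale E (- 1) (cl_rep E g N (cl_alt (cl_shift N a)) (g N (h e))))"
    using e NM Suc.prems(2)[of N e] by (simp add: bm_add[OF h] rep_total gen_total IH rep_lin)
  also have "vb_scale E (- 1) (cl_rep E g N (cl_alt (cl_shift N a)) (g N (h e))) =
      cl_rep E g N (cl_shift N (cl_alt a)) (g N (h e))"
    unfolding c by (rule eqI) (use e NM in \<open>simp_all only: rep_scale rep_total gen_total coord_scale scale_total Suc_le_eq less_imp_le bm_total[OF h]\<close>, simp)
  finally show ?case by simp
qed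

text \<open>The induction step compares \<open>cl_mult_upto_Suc\<close> with the product of two
  operators of the form \<open>A\<^sub>0 + A\<^sub>1 g\<close>. There \<open>rep_alt\<close> moves
  \<open>g\<close> to the right and \<open>gen_square\<close> evaluates its square; the four
  resulting terms are matched in coordinates.\<close>

lemma rep_mult: "N \<le> M \<Longrightarrow> e \<in> topspace (vb_total E) \<Longrightarrow>
   cl_rep E g N (cl_mult_upto p N a b) e = cl_rep E g N a (cl_rep E g N b e)"
proof (induction N arbitrary: a b e)
  case 0
  show ?case by (rule eqI) (use 0 in \<open>simp_all add: cl_mult_upto_def cl_sign_def\<close>)
next
  case (Suc N)
  note e = Suc.prems(2)
  have NM: "N < M" "N \<le> M" using Suc.prems by auto
  have IH: "cl_rep E g N (cl_mult_upto p N a b) e = cl_rep E g N a (cl_rep E g N b e)"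
    if "e \<in> topspace (vb_total E)" for a b e
    using Suc that by simp
  let ?\<sigma> = "if N < p then - 1 else 1 :: real"
  note t = rep_total[OF NM(2)] gen_total[OF NM(1)]
  have h: "g N (cl_rep E g N a e) = cl_rep E g N (cl_alt a) (g N e)" if "e \<in> topspace (vb_total E)" for a e
    by (rule rep_alt[OF gen_map[OF NM(1)] NM(2) _ that], rule gen_anticommute) (use NM in auto)
  have "cl_rep E g N (cl_mult_upto p (Suc N) a b) e =
      cl_rep E g N (\<lambda>R. cl_mult_upto p N a b R + ?\<sigma> * cl_mult_upto p N (cl_shift N a) (cl_alt (cl_shift N b)) R) e"
    by (rule cl_rep_cong) (rule cl_mult_upto_Suc(1))
  then have 1: "crd (cl_rep E g N (cl_mult_upto p (Suc N) a b) e) i = crd (cl_rep E g N a (cl_rep E g N b e)) i +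
      complex_of_real ?\<sigma> * crd (cl_rep E g N (cl_shift N a) (cl_rep E g N (cl_alt (cl_shift N b)) e)) i" for i
    by (simp only: rep_add[OF NM(2) e] rep_scale[OF NM(2) e] IH[OF e])
  have ge: "g N e \<in> topspace (vb_total E)" using e by (simp add: t)
  have "cl_rep E g N (cl_shift N (cl_mult_upto p (Suc N) a b)) (g N e) =
      cl_rep E g N (\<lambda>R. cl_mult_upto p N a (cl_shift N b) R + cl_mult_upto p N (cl_shift N a) (cl_alt b) R) (g N e)"
    by (rule cl_rep_cong) (simp add: cl_shift_def[of N "cl_mult_upto p (Suc N) a b"] cl_mult_upto_Suc(2))
  then have 2: "crd (cl_rep E g N (cl_shift N (cl_mult_upto p (Suc N) a b)) (g N e)) i =
      crd (cl_rep E g N a (cl_rep E g N (cl_shift N b) (g N e))) i +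
      crd (cl_rep E g N (cl_shift N a) (cl_rep E g N (cl_alt b) (g N e))) i" for i
    by (simp only: rep_add[OF NM(2) ge] IH[OF ge])
  have sq: "g N (g N e) = vb_scale E (complex_of_real ?\<sigma>) e" using gen_square[OF NM(1) e] by simp
  have "g N (cl_rep E g (Suc N) b e) = vb_add E (cl_rep E g N (cl_alt b) (g N e))
      (vb_scale E (complex_of_real ?\<sigma>) (cl_rep E g N (cl_alt (cl_shift N b)) e))"
    using e bm_add[OF gen_map[OF NM(1)]] by (simp add: t h rep_lin[OF NM(2)] sq)
  then have "cl_rep E g (Suc N) a (cl_rep E g (Suc N) b e) =
     vb_add E (vb_add E (cl_rep E g N a (cl_rep E g N b e)) (cl_rep E g N a (cl_rep E g N (cl_shift N b) (g N e))))
       (vb_add E (cl_rep E g N (cl_shift N a) (cl_rep E g N (cl_alt b) (g N e)))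
          (vb_scale E (complex_of_real ?\<sigma>) (cl_rep E g N (cl_shift N a) (cl_rep E g N (cl_alt (cl_shift N b)) e))))"
    using e by (simp add: t rep_lin[OF NM(2)] del: of_real_minus of_real_1)
  then have 3: "crd (cl_rep E g (Suc N) a (cl_rep E g (Suc N) b e)) i =
      crd (cl_rep E g N a (cl_rep E g N b e)) i + crd (cl_rep E g N a (cl_rep E g N (cl_shift N b) (g N e))) i +
      (crd (cl_rep E g N (cl_shift N a) (cl_rep E g N (cl_alt b) (g N e))) i +
       complex_of_real ?\<sigma> * crd (cl_rep E g N (cl_shift N a) (cl_rep E g N (cl_alt (cl_shift N b)) e)) i)" for i
    using e by (simp add: t)
  show ?case
  proof (rule eqI)
    show "crd (cl_rep E g (Suc N) (cl_mult_upto p (Suc N) a b) e) i = crd (cl_rep E g (Suc N) a (cl_rep E g (Suc N) b e)) i" for i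
      unfolding 3 using e 1 2 by (simp add: t)
  qed (use e Suc.prems in \<open>simp_all add: rep_total del: cl_rep.simps\<close>)
qed

end

lemma clifford_module_cl_rep:
  assumes "anticommuting_family GG Y E p (p + q) g"
  shows "clifford_module GG Y p q E (cl_rep E g (p + q))"
proof -
  interpret anticommuting_family GG Y E p "p + q" g by fact
  show ?thesis
    unfolding clifford_module_def cl_mult_eq_upto
  proof (intro conjI ballI allI)
    fix a b e c assume e: "e \<in> topspace (vb_total E)"
    show "cl_rep E g (p + q) (\<lambda>S. c * a S) e = vb_scale E (complex_of_real c) (cl_rep E g (p + q) a e)"
      by (rule eqI) (use e in \<open>simp_all add: rep_total rep_scale\<close>)
    show "cl_rep E g (p + q) (\<lambda>S. a S + b S) e = vb_add E (cl_rep E g (p + q) a e) (cl_rep E g (p + q) b e)"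
      by (rule eqI) (use e in \<open>simp_all add: rep_total rep_add\<close>)
  qed (simp_all add: g_vector_bundle rep_map rep_one rep_mult)
qed

text \<open>For \<open>S\<close> below \<open>k\<close> the product of \<open>e\<^sub>S\<close> and
  \<open>e\<^sub>k\<close> is the basis element of \<open>insert k S\<close> with sign
  \<open>1\<close>: no index has to be passed and none is repeated.\<close>

lemma cl_mult_gen_right:
  assumes k: "k < p + q" and a: "\<And>S. \<not> S \<subseteq> {..<k} \<Longrightarrow> a S = 0"
  shows "cl_mult p q a (cl_gen k) = (\<lambda>S. if k \<in> S then a (S - {k}) else 0)"
proof
  fix R
  have "cl_mult p q a (cl_gen k) R =
      (\<Sum>S\<in>Pow {..<p + q}. if S = sym_diff R {k} then (if k \<in> R then a (R - {k}) else 0) else 0)"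
    unfolding cl_mult_def
  proof (rule sum.cong[OF refl])
    fix S assume S: "S \<in> Pow {..<p + q}"
    show "cl_sign p S (sym_diff S R) * a S * cl_gen k (sym_diff S R) =
        (if S = sym_diff R {k} then (if k \<in> R then a (R - {k}) else 0) else 0)"
    proof (cases "S = sym_diff R {k}")
      case True
      then have d: "sym_diff S R = {k}" by auto
      show ?thesis
      proof (cases "k \<in> R")
        case kR: True
        then have S': "S = R - {k}" using True by auto
        have "cl_sign p S {k} = 1" if "S \<subseteq> {..<k}"
        proof -
          have "{(i, j). i \<in> S \<and> j \<in> {k} \<and> j < i} = {}" "{i \<in> S \<inter> {k}. i < p} = {}" using that by auto
          then show ?thesis by (simp only: cl_sign_def card.empty power_0 mult_1)
        qed
        then show ?thesis using a[of S] S' kR unfolding d True[symmetric] by (auto simp: cl_basis_def)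
      next
        case False
        then have "k \<in> S" using True by auto
        then have "a S = 0" by (intro a) auto
        then show ?thesis using False by simp
      qed
    next
      case False
      then have "sym_diff S R \<noteq> {k}" by auto
      then show ?thesis using False by (simp add: cl_basis_def)
    qed
  qed
  also have "\<dots> = (if k \<in> R then a (R - {k}) else 0)"
  \<comment> \<open>The only set that can contribute may lie outside the range of summation. Then
    \<open>R - {k}\<close> is not below \<open>k\<close>, so the coefficient on the right is zero as
    well.\<close>
  proof (cases "sym_diff R {k} \<subseteq> {..<p + q}")
    case True
    then show ?thesis by (simp add: sum.delta')
  next
    case False
    then have "\<not> R - {k} \<subseteq> {..<k}" using k by auto
    then show ?thesis using a False by (auto simp: sum.delta')
  qed
  finally show "cl_mult p q a (cl_gen k) R = (if k \<in> R then a (R - {k}) else 0)" .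
qed

text \<open>The generators generate the algebra: an element on the first \<open>k + 1\<close>
  generators is \<open>b + d e\<^sub>k\<close> with \<open>b\<close> and \<open>d\<close> on the
  first \<open>k\<close>, and induction on \<open>k\<close> reduces the claim to the
  generators.\<close>

lemma clifford_module_intertwine:
  assumes r: "clifford_module GG Y p q E r" and s: "clifford_module GG Y p q F s"
    and h: "g_bundle_map GG Y E F h"
    and gen: "\<And>i e. i < p + q \<Longrightarrow> e \<in> topspace (vb_total E) \<Longrightarrow> h (r (cl_gen i) e) = s (cl_gen i) (h e)"
    and a: "a \<in> cl_carrier p q" and e: "e \<in> topspace (vb_total E)"
  shows "h (r a e) = s a (h e)"
proof -
  have E: "g_vector_bundle GG Y E" and F: "g_vector_bundle GG Y F" using r s by (simp_all add: clifford_module_def)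
  interpret E: g_bundle GG Y E using E by unfold_locales
  interpret F: g_bundle GG Y F using F by unfold_locales
  note [simp] = E.bm_total[OF h]
  have R: "r cl_one e = e" "b \<in> cl_carrier p q \<Longrightarrow> r (\<lambda>S. c * b S) e = vb_scale E (complex_of_real c) (r b e)"
    "b \<in> cl_carrier p q \<Longrightarrow> d \<in> cl_carrier p q \<Longrightarrow> r (\<lambda>S. b S + d S) e = vb_add E (r b e) (r d e)"
    "b \<in> cl_carrier p q \<Longrightarrow> d \<in> cl_carrier p q \<Longrightarrow> r (cl_mult p q b d) e = r b (r d e)"
    if "e \<in> topspace (vb_total E)" for e b c d
    using r that unfolding clifford_module_def by blast+
  have S: "s cl_one e = e" "b \<in> cl_carrier p q \<Longrightarrow> s (\<lambda>S. c * b S) e = vb_scale F (complex_of_real c) (s b e)"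
    "b \<in> cl_carrier p q \<Longrightarrow> d \<in> cl_carrier p q \<Longrightarrow> s (\<lambda>S. b S + d S) e = vb_add F (s b e) (s d e)"
    "b \<in> cl_carrier p q \<Longrightarrow> d \<in> cl_carrier p q \<Longrightarrow> s (cl_mult p q b d) e = s b (s d e)"
    if "e \<in> topspace (vb_total F)" for e b c d
    using s that unfolding clifford_module_def by blast+
  have rt: "r b e \<in> topspace (vb_total E)" "vb_proj E (r b e) = vb_proj E e"
    if "b \<in> cl_carrier p q" "e \<in> topspace (vb_total E)" for b e
    using E.bm_total[of E "r b" e] r that unfolding clifford_module_def by blast+
  have one: "cl_one \<in> cl_carrier p q" by (auto simp: cl_carrier_def cl_basis_def)
  have "h (r a e) = s a (h e)"
    if "\<And>S. \<not> S \<subseteq> {..<k} \<Longrightarrow> a S = 0" "k \<le> p + q" "e \<in> topspace (vb_total E)" for k a e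
    using that
  proof (induction k arbitrary: a e)
    case 0
    have "a = (\<lambda>S. a {} * cl_one S)" using 0 by (auto simp: cl_basis_def)
    then have "r a e = vb_scale E (complex_of_real (a {})) e" "s a (h e) = vb_scale F (complex_of_real (a {})) (h e)"
      using R(2)[OF 0(3) one, of "a {}"] S(2)[OF _ one, of "h e" "a {}"] R(1) S(1) 0(3) by simp_all
    then show ?case using E.bm_scale[OF h 0(3)] by simp
  next
    case (Suc k)
    \<comment> \<open>Both parts are set to zero on sets containing \<open>k\<close>. Thus they
      vanish off the subsets of \<open>{..<k}\<close>, as the induction hypothesis and
      \<open>cl_mult_gen_right\<close> require.\<close>
    define b where "b = (\<lambda>S. if k \<in> S then 0 else a S)"
    define d where "d = (\<lambda>S. if k \<in> S then 0 else a (insert k S))"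
    have a: "a S = 0" if "\<not> S \<subseteq> {..<Suc k}" for S using Suc.prems that by blast
    have b: "b S = 0" if "\<not> S \<subseteq> {..<k}" for S
      using a[of S] that by (auto simp: b_def lessThan_Suc)
    have d: "d S = 0" if "\<not> S \<subseteq> {..<k}" for S
      using a[of "insert k S"] that by (auto simp: d_def lessThan_Suc)
    have k: "k < p + q" "k \<le> p + q" using Suc.prems by auto
    have bc: "b \<in> cl_carrier p q" and dc: "d \<in> cl_carrier p q"
      unfolding cl_carrier_def using b d k(2) subset_trans[of _ "{..<k}" "{..<p + q}"]
      by (simp_all add: lessThan_subset_iff) blast+
    have gc: "cl_gen k \<in> cl_carrier p q" using k by (auto simp: cl_carrier_def cl_basis_def)
    have mg: "cl_mult p q d (cl_gen k) = (\<lambda>S. if k \<in> S then d (S - {k}) else 0)"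
      by (rule cl_mult_gen_right[OF k(1)]) (rule d)
    have ab: "a = (\<lambda>S. b S + cl_mult p q d (cl_gen k) S)"
      unfolding mg by (auto simp: b_def d_def insert_absorb)
    have mc: "cl_mult p q d (cl_gen k) \<in> cl_carrier p q"
    proof -
      have "d (S - {k}) = 0" if "\<not> S \<subseteq> {..<p + q}" for S
      proof -
        have "\<not> S - {k} \<subseteq> {..<p + q}" using that k by auto
        then show ?thesis using dc by (simp add: cl_carrier_def)
      qed
      then show ?thesis unfolding mg cl_carrier_def by auto
    qed
    note e = Suc.prems(3)
    have he: "h e \<in> topspace (vb_total F)" using e by simp
    have "h (r a e) = vb_add F (h (r b e)) (h (r d (r (cl_gen k) e)))"
      by (subst ab) (simp add: R bc dc gc mc e rt E.bm_add[OF h])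
    also have "\<dots> = vb_add F (s b (h e)) (s d (s (cl_gen k) (h e)))"
      using Suc.IH[OF b k(2) e] Suc.IH[OF d k(2) rt(1)[OF gc e]] gen[OF k(1) e] by simp
    also have "\<dots> = s a (h e)"
      by (subst ab) (simp add: S bc dc gc mc he)
    finally show ?case .
  qed
  from this[of "p + q" a e] show ?thesis using a e by (auto simp: cl_carrier_def)
qed

section \<open>Systems of involutions as a replacement for triples\<close>

section \<open>Systems of anticommuting involutions\<close>

text \<open>The squares are arbitrary scalars \<open>\<sigma> i\<close>. So both the generators of a
  Clifford module, with squares \<open>- 1\<close> and \<open>1\<close>, and the normalized
  involutions are instances, and rescaling leads from one to the other.\<close>

definition anticommuting :: "('g, 'b) group_bundle \<Rightarrow> ('y, 'g, 'b) gspace \<Rightarrow> ('e, 'y, 'g) vbundle \<Rightarrow> nat \<Rightarrow>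
    (nat \<Rightarrow> complex) \<Rightarrow> (nat \<Rightarrow> 'e \<Rightarrow> 'e) \<Rightarrow> bool" where
  "anticommuting GG Y E N \<sigma> g \<longleftrightarrow> (\<forall>i<N. g_bundle_map GG Y E E (g i) \<and>
     (\<forall>e\<in>topspace (vb_total E). g i (g i e) = vb_scale E (\<sigma> i) e \<and>
        (\<forall>j<N. i \<noteq> j \<longrightarrow> g i (g j e) = vb_scale E (- 1) (g j (g i e)))))"

lemma anticommutingD:
  assumes "anticommuting GG Y E N \<sigma> g"
  shows "i < N \<Longrightarrow> g_bundle_map GG Y E E (g i)"
    and "i < N \<Longrightarrow> e \<in> topspace (vb_total E) \<Longrightarrow> g i (g i e) = vb_scale E (\<sigma> i) e"
    and "i < N \<Longrightarrow> j < N \<Longrightarrow> i \<noteq> j \<Longrightarrow> e \<in> topspace (vb_total E) \<Longrightarrow>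
      g i (g j e) = vb_scale E (- 1) (g j (g i e))"
  using assms unfolding anticommuting_def by blast+

lemma anticommuting_familyI:
  assumes "g_vector_bundle GG Y E" "anticommuting GG Y E M (\<lambda>i. if i < p then - 1 else 1) g"
  shows "anticommuting_family GG Y E p M g"
  using assms(1) anticommutingD[OF assms(2)] by unfold_locales

definition sys_grading :: "('g, 'b) group_bundle \<Rightarrow> ('y, 'g, 'b) gspace \<Rightarrow> ('e, 'y, 'g) vbundle \<Rightarrow> nat \<Rightarrow>
    (nat \<Rightarrow> 'e \<Rightarrow> 'e) \<Rightarrow> ('e \<Rightarrow> 'e) \<Rightarrow> bool" where
  "sys_grading GG Y E N g \<eta> \<longleftrightarrow> g_bundle_map GG Y E E \<eta> \<and>
     (\<forall>e\<in>topspace (vb_total E). \<eta> (\<eta> e) = e \<and> (\<forall>i<N. \<eta> (g i e) = vb_scale E (- 1) (g i (\<eta> e))))"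

record ('e, 'y, 'g) ksys =
  ks_bundle :: "('e, 'y, 'g) vbundle"
  ks_gen    :: "nat \<Rightarrow> 'e \<Rightarrow> 'e"
  ks_eta1   :: "'e \<Rightarrow> 'e"
  ks_eta2   :: "'e \<Rightarrow> 'e"

text \<open>The counterpart of \<open>is_ktriple\<close> after normalization. Of the pair
  \<open>(p, q)\<close> only the number \<open>N\<close> of involutions remains, so the theory of
  triples depends on \<open>p + q\<close> alone.\<close>

definition is_ksys :: "('g, 'b) group_bundle \<Rightarrow> ('y, 'g, 'b) gspace \<Rightarrow> 'y set \<Rightarrow> nat \<Rightarrow> ('e, 'y, 'g) ksys \<Rightarrow> bool" where
  "is_ksys GG Y Y' N X \<longleftrightarrow> g_vector_bundle GG Y (ks_bundle X) \<and>
     anticommuting GG Y (ks_bundle X) N (\<lambda>_. 1) (ks_gen X) \<and>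
     sys_grading GG Y (ks_bundle X) N (ks_gen X) (ks_eta1 X) \<and>
     sys_grading GG Y (ks_bundle X) N (ks_gen X) (ks_eta2 X) \<and>
     (\<forall>e\<in>topspace (vb_total (ks_bundle X)). vb_proj (ks_bundle X) e \<in> Y' \<longrightarrow> ks_eta1 X e = ks_eta2 X e)"

text \<open>Naming the inverse \<open>k\<close> lets later proofs build the inverse on a sum, a
  pullback or a double from it, or restrict it to a summand.\<close>

definition ksys_iso_via :: "('g, 'b) group_bundle \<Rightarrow> ('y, 'g, 'b) gspace \<Rightarrow> nat \<Rightarrow> ('e, 'y, 'g) ksys \<Rightarrow>
    ('f, 'y, 'g) ksys \<Rightarrow> ('e \<Rightarrow> 'f) \<Rightarrow> ('f \<Rightarrow> 'e) \<Rightarrow> bool" where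
  "ksys_iso_via GG Y N X Z h k \<longleftrightarrow>
     homeomorphic_maps (vb_total (ks_bundle X)) (vb_total (ks_bundle Z)) h k \<and>
     g_bundle_map GG Y (ks_bundle X) (ks_bundle Z) h \<and>
     (\<forall>e\<in>topspace (vb_total (ks_bundle X)). (\<forall>i<N. h (ks_gen X i e) = ks_gen Z i (h e)) \<and>
        h (ks_eta1 X e) = ks_eta1 Z (h e) \<and> h (ks_eta2 X e) = ks_eta2 Z (h e))"

definition ksys_iso :: "('g, 'b) group_bundle \<Rightarrow> ('y, 'g, 'b) gspace \<Rightarrow> nat \<Rightarrow> ('e, 'y, 'g) ksys \<Rightarrow>
    ('f, 'y, 'g) ksys \<Rightarrow> bool" where
  "ksys_iso GG Y N X Z \<longleftrightarrow> (\<exists>h k. ksys_iso_via GG Y N X Z h k)"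

locale ksystem =
  fixes GG :: "('g, 'b) group_bundle" and Y :: "('y, 'g, 'b) gspace" and Y' :: "'y set" and N :: nat
    and X :: "('e, 'y, 'g) ksys"
  assumes is_ksys: "is_ksys GG Y Y' N X"

sublocale ksystem \<subseteq> g_bundle GG Y "ks_bundle X"
  using is_ksys by unfold_locales (simp add: is_ksys_def)

context ksystem
begin

abbreviation "tot \<equiv> topspace (vb_total (ks_bundle X))"

lemma ks_gen_map: "i < N \<Longrightarrow> g_bundle_map GG Y (ks_bundle X) (ks_bundle X) (ks_gen X i)"
  and ks_eta1: "sys_grading GG Y (ks_bundle X) N (ks_gen X) (ks_eta1 X)"
  and ks_eta2: "sys_grading GG Y (ks_bundle X) N (ks_gen X) (ks_eta2 X)"
  using is_ksys by (simp_all add: is_ksys_def anticommuting_def)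

lemma ks_eta_eq: "e \<in> tot \<Longrightarrow> vb_proj (ks_bundle X) e \<in> Y' \<Longrightarrow> ks_eta1 X e = ks_eta2 X e"
  using is_ksys by (simp add: is_ksys_def)

lemma ks_eta_map: "g_bundle_map GG Y (ks_bundle X) (ks_bundle X) (ks_eta1 X)"
  "g_bundle_map GG Y (ks_bundle X) (ks_bundle X) (ks_eta2 X)"
  using ks_eta1 ks_eta2 by (simp_all add: sys_grading_def)

lemma ks_gen [simp]:
  "i < N \<Longrightarrow> e \<in> tot \<Longrightarrow> ks_gen X i e \<in> tot"
  "i < N \<Longrightarrow> e \<in> tot \<Longrightarrow> vb_proj (ks_bundle X) (ks_gen X i e) = vb_proj (ks_bundle X) e"
  "i < N \<Longrightarrow> e \<in> tot \<Longrightarrow> e' \<in> tot \<Longrightarrow> vb_proj (ks_bundle X) e' = vb_proj (ks_bundle X) e \<Longrightarrow>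
     ks_gen X i (vb_add (ks_bundle X) e e') = vb_add (ks_bundle X) (ks_gen X i e) (ks_gen X i e')"
  "i < N \<Longrightarrow> e \<in> tot \<Longrightarrow> ks_gen X i (vb_scale (ks_bundle X) c e) = vb_scale (ks_bundle X) c (ks_gen X i e)"
  using bm_total[OF ks_gen_map] bm_add[OF ks_gen_map] bm_scale[OF ks_gen_map] by blast+

lemma scale_one [simp]: "e \<in> tot \<Longrightarrow> vb_scale (ks_bundle X) 1 e = e"
  by (rule eqI) simp_all

lemma ks_gen_gen [simp]: "i < N \<Longrightarrow> e \<in> tot \<Longrightarrow> ks_gen X i (ks_gen X i e) = e"
  using is_ksys scale_one by (simp add: is_ksys_def anticommuting_def)

lemma ks_anticommute: "i < N \<Longrightarrow> j < N \<Longrightarrow> i \<noteq> j \<Longrightarrow> e \<in> tot \<Longrightarrow>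
    ks_gen X i (ks_gen X j e) = vb_scale (ks_bundle X) (- 1) (ks_gen X j (ks_gen X i e))"
  using is_ksys unfolding is_ksys_def anticommuting_def by blast

lemma grading:
  assumes "sys_grading GG Y (ks_bundle X) N (ks_gen X) \<eta>"
  shows "e \<in> tot \<Longrightarrow> \<eta> e \<in> tot"
    and "e \<in> tot \<Longrightarrow> vb_proj (ks_bundle X) (\<eta> e) = vb_proj (ks_bundle X) e"
    and "e \<in> tot \<Longrightarrow> e' \<in> tot \<Longrightarrow> vb_proj (ks_bundle X) e' = vb_proj (ks_bundle X) e \<Longrightarrow>
       \<eta> (vb_add (ks_bundle X) e e') = vb_add (ks_bundle X) (\<eta> e) (\<eta> e')"
    and "e \<in> tot \<Longrightarrow> \<eta> (vb_scale (ks_bundle X) c e) = vb_scale (ks_bundle X) c (\<eta> e)"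
    and "e \<in> tot \<Longrightarrow> \<eta> (\<eta> e) = e"
    and "i < N \<Longrightarrow> e \<in> tot \<Longrightarrow> \<eta> (ks_gen X i e) = vb_scale (ks_bundle X) (- 1) (ks_gen X i (\<eta> e))"
proof -
  have h: "g_bundle_map GG Y (ks_bundle X) (ks_bundle X) \<eta>" using assms by (simp add: sys_grading_def)
  note r = bm_total[OF h] bm_add[OF h] bm_scale[OF h]
  show "e \<in> tot \<Longrightarrow> \<eta> e \<in> tot"
    "e \<in> tot \<Longrightarrow> vb_proj (ks_bundle X) (\<eta> e) = vb_proj (ks_bundle X) e"
    "e \<in> tot \<Longrightarrow> e' \<in> tot \<Longrightarrow> vb_proj (ks_bundle X) e' = vb_proj (ks_bundle X) e \<Longrightarrow>
       \<eta> (vb_add (ks_bundle X) e e') = vb_add (ks_bundle X) (\<eta> e) (\<eta> e')"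
    "e \<in> tot \<Longrightarrow> \<eta> (vb_scale (ks_bundle X) c e) = vb_scale (ks_bundle X) c (\<eta> e)"
    by (simp_all add: r)
qed (use assms in \<open>unfold sys_grading_def, blast+\<close>)

lemmas ks_etas [simp] = grading[OF ks_eta1] grading[OF ks_eta2]

end

lemma ksys_iso_refl: "ksys_iso GG Y N X X"
  unfolding ksys_iso_def ksys_iso_via_def homeomorphic_maps_def
  by (rule exI[of _ "\<lambda>e. e"], rule exI[of _ "\<lambda>e. e"]) (simp add: g_bundle_map_id)

lemma ksys_iso_viaD:
  assumes "ksys_iso_via GG Y N X Z h k"
  shows "g_bundle_map GG Y (ks_bundle X) (ks_bundle Z) h"
    and "homeomorphic_maps (vb_total (ks_bundle X)) (vb_total (ks_bundle Z)) h k"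
    and "\<And>e. e \<in> topspace (vb_total (ks_bundle X)) \<Longrightarrow> k (h e) = e"
    and "\<And>f. f \<in> topspace (vb_total (ks_bundle Z)) \<Longrightarrow> h (k f) = f"
    and "\<And>e. e \<in> topspace (vb_total (ks_bundle X)) \<Longrightarrow> h e \<in> topspace (vb_total (ks_bundle Z))"
    and "\<And>f. f \<in> topspace (vb_total (ks_bundle Z)) \<Longrightarrow> k f \<in> topspace (vb_total (ks_bundle X))"
    and "\<And>i e. i < N \<Longrightarrow> e \<in> topspace (vb_total (ks_bundle X)) \<Longrightarrow> h (ks_gen X i e) = ks_gen Z i (h e)"
    and "\<And>e. e \<in> topspace (vb_total (ks_bundle X)) \<Longrightarrow> h (ks_eta1 X e) = ks_eta1 Z (h e)"
    and "\<And>e. e \<in> topspace (vb_total (ks_bundle X)) \<Longrightarrow> h (ks_eta2 X e) = ks_eta2 Z (h e)"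
  using assms unfolding ksys_iso_via_def homeomorphic_maps_def by (auto simp: continuous_map_in)

lemma ksys_iso_via_sym:
  assumes X: "is_ksys GG Y Y' N X" and Z: "is_ksys GG Y Y'' N Z" and h: "ksys_iso_via GG Y N X Z h k"
  shows "ksys_iso_via GG Y N Z X k h"
proof -
  interpret X: ksystem GG Y Y' N X using X by unfold_locales
  interpret Z: ksystem GG Y Y'' N Z using Z by unfold_locales
  note v = ksys_iso_viaD[OF h]
  have *: "k f = e" if "h e = f" "e \<in> X.tot" for e f using that v(3) by auto
  show ?thesis
    unfolding ksys_iso_via_def
  proof (intro conjI ballI allI impI)
    show "homeomorphic_maps (vb_total (ks_bundle Z)) (vb_total (ks_bundle X)) k h"
      using v(2) homeomorphic_maps_sym by blast
    show "g_bundle_map GG Y (ks_bundle Z) (ks_bundle X) k"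
      by (rule g_bundle_map_inverse[OF X.g_vector_bundle Z.g_vector_bundle v(1,2)])
  qed (auto intro!: * simp: v(4,6,7,8,9))
qed

lemma ksys_iso_sym:
  "is_ksys GG Y Y' N X \<Longrightarrow> is_ksys GG Y Y'' N Z \<Longrightarrow> ksys_iso GG Y N X Z \<Longrightarrow> ksys_iso GG Y N Z X"
  unfolding ksys_iso_def using ksys_iso_via_sym by blast

lemma ksys_iso_trans:
  assumes X: "is_ksys GG Y Y' N X" and "ksys_iso GG Y N X Z" and "ksys_iso GG Y N Z W"
  shows "ksys_iso GG Y N X W"
proof -
  obtain h k where h: "ksys_iso_via GG Y N X Z h k" using assms(2) unfolding ksys_iso_def by blast
  obtain h' k' where h': "ksys_iso_via GG Y N Z W h' k'" using assms(3) unfolding ksys_iso_def by blast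
  note v = ksys_iso_viaD[OF h] and w = ksys_iso_viaD[OF h']
  have E: "g_vector_bundle GG Y (ks_bundle X)" using X by (simp add: is_ksys_def)
  have "ksys_iso_via GG Y N X W (h' \<circ> h) (k \<circ> k')"
    unfolding ksys_iso_via_def
    using homeomorphic_maps_compose[OF conjI[OF v(2) w(2)]] g_bundle_map_comp[OF E v(1) w(1)]
    by (auto simp: o_def v w)
  then show ?thesis unfolding ksys_iso_def by blast
qed

lemma anticommuting_scale:
  assumes E: "g_vector_bundle GG Y E" and g: "anticommuting GG Y E N \<sigma> g"
  shows "anticommuting GG Y E N (\<lambda>i. u i * u i * \<sigma> i) (\<lambda>i e. vb_scale E (u i) (g i e))"
proof -
  interpret E: g_bundle GG Y E using E by unfold_locales
  have m: "g_bundle_map GG Y E E (g i)" if "i < N" for i using g that by (rule anticommutingD)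
  note t = E.bm_total[OF m] E.bm_scale[OF m]
  show ?thesis
    unfolding anticommuting_def
  proof (intro conjI ballI allI impI)
    fix i assume i: "i < N"
    show "g_bundle_map GG Y E E (\<lambda>e. vb_scale E (u i) (g i e))"
      by (rule g_bundle_map_scale[OF E E m[OF i]])
    fix e assume e: "e \<in> topspace (vb_total E)"
    have "g i (g i e) = vb_scale E (\<sigma> i) e" using g i e by (rule anticommutingD)
    then show "vb_scale E (u i) (g i (vb_scale E (u i) (g i e))) = vb_scale E (u i * u i * \<sigma> i) e"
      by (intro E.eqI) (use e i in \<open>simp_all add: t\<close>)
    fix j assume j: "j < N" "i \<noteq> j"
    have "g i (g j e) = vb_scale E (- 1) (g j (g i e))"
      using g e i j unfolding anticommuting_def by blast
    then show "vb_scale E (u i) (g i (vb_scale E (u j) (g j e))) =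
        vb_scale E (- 1) (vb_scale E (u j) (g j (vb_scale E (u i) (g i e))))"
      by (intro E.eqI) (use e i j in \<open>simp_all add: t\<close>)
  qed
qed

lemma anticommuting_cong:
  assumes "g_vector_bundle GG Y E" "anticommuting GG Y E N \<sigma> g"
    and "\<And>i. i < N \<Longrightarrow> \<sigma> i = \<tau> i" and "\<And>i e. i < N \<Longrightarrow> e \<in> topspace (vb_total E) \<Longrightarrow> g i e = g' i e"
  shows "anticommuting GG Y E N \<tau> g'"
proof -
  interpret E: g_bundle GG Y E using assms by unfold_locales
  have m: "g_bundle_map GG Y E E (g i)" if "i < N" for i using assms(2) that by (rule anticommutingD)
  have eq: "g' i e = g i e" if "i < N" "e \<in> topspace (vb_total E)" for i e using assms(4)[OF that] by simp
  have eq2: "g' i (g' j e) = g i (g j e)" if "i < N" "j < N" "e \<in> topspace (vb_total E)" for i j e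
    using that E.bm_total[OF m] by (simp add: eq)
  show ?thesis
    unfolding anticommuting_def
  proof (intro conjI allI impI ballI)
    fix i e assume i: "i < N"
    show "g_bundle_map GG Y E E (g' i)" by (rule g_bundle_map_eq[OF assms(1) m[OF i] assms(4)[OF i]])
    assume e: "e \<in> topspace (vb_total E)"
    show "g' i (g' i e) = vb_scale E (\<tau> i) e"
      using assms(2) i e unfolding eq2[OF i i e] anticommuting_def by (simp add: assms(3))
    fix j assume j: "j < N" "i \<noteq> j"
    show "g' i (g' j e) = vb_scale E (- 1) (g' j (g' i e))"
      using assms(2) i e j unfolding eq2[OF i j(1) e] eq2[OF j(1) i e] anticommuting_def by blast
  qed
qed

text \<open>A grading is complex linear, so the non-zero scalar \<open>u i\<close> passes through it
  and cancels.\<close>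

lemma sys_grading_scale:
  assumes E: "g_vector_bundle GG Y E" and g: "\<And>i. i < N \<Longrightarrow> g_bundle_map GG Y E E (g i)"
    and u: "\<And>i. i < N \<Longrightarrow> u i \<noteq> 0"
    and f: "\<And>i e. i < N \<Longrightarrow> e \<in> topspace (vb_total E) \<Longrightarrow> f i e = vb_scale E (u i) (g i e)"
  shows "sys_grading GG Y E N f \<eta> \<longleftrightarrow> sys_grading GG Y E N g \<eta>"
proof -
  interpret E: g_bundle GG Y E using E by unfold_locales
  have "\<eta> (f i e) = vb_scale E (- 1) (f i (\<eta> e)) \<longleftrightarrow> \<eta> (g i e) = vb_scale E (- 1) (g i (\<eta> e))" (is "?L \<longleftrightarrow> ?R")
    if \<eta>: "g_bundle_map GG Y E E \<eta>" and i: "i < N" and e: "e \<in> topspace (vb_total E)" for i e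
  proof -
    note t = E.bm_total[OF \<eta>] E.bm_total[OF g[OF i]] E.bm_scale[OF \<eta>]
    show ?thesis
    proof
      assume ?L
      then have eq: "vb_scale E (u i) (\<eta> (g i e)) = vb_scale E (- 1) (vb_scale E (u i) (g i (\<eta> e)))"
        using e i by (simp add: f t)
      have "u i * vb_coord (gs_total Y) E (\<eta> (g i e)) j = u i * (- vb_coord (gs_total Y) E (g i (\<eta> e)) j)" for j
        using arg_cong[OF eq, of "\<lambda>x. vb_coord (gs_total Y) E x j"] e i by (simp add: t)
      then have "vb_coord (gs_total Y) E (\<eta> (g i e)) j = - vb_coord (gs_total Y) E (g i (\<eta> e)) j" for j
        using u[OF i] mult_left_cancel by blast
      then show ?R
        by (intro E.eqI) (use e i in \<open>simp_all add: t\<close>)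
    next
      assume ?R
      then show ?L
        by (intro E.eqI) (use e i in \<open>simp_all add: t f\<close>)
    qed
  qed
  then show ?thesis unfolding sys_grading_def by blast
qed

section \<open>Triples and systems\<close>

text \<open>The factor \<open>- \<i>\<close> turns the square \<open>- 1\<close> of a generator with
  index below \<open>p\<close> into \<open>1\<close>. Although the Clifford algebra is real, complex
  scalars are available on the fibres.\<close>

definition sys_of :: "nat \<Rightarrow> ('e, 'y, 'g) ktriple \<Rightarrow> ('e, 'y, 'g) ksys" where
  "sys_of p T = \<lparr>ks_bundle = kt_bundle T,
     ks_gen = (\<lambda>i e. vb_scale (kt_bundle T) (if i < p then - \<i> else 1) (kt_rep T (cl_gen i) e)),
     ks_eta1 = kt_eta1 T, ks_eta2 = kt_eta2 T\<rparr>"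

text \<open>The factor \<open>\<i>\<close> undoes the \<open>- \<i>\<close> of
  \<open>sys_of\<close>; \<open>cl_rep\<close> then extends the rescaled operators from the
  generators to the whole algebra.\<close>

definition triple_of :: "nat \<Rightarrow> nat \<Rightarrow> ('e, 'y, 'g) ksys \<Rightarrow> ('e, 'y, 'g) ktriple" where
  "triple_of p q X = \<lparr>kt_bundle = ks_bundle X,
     kt_rep = cl_rep (ks_bundle X) (\<lambda>i e. vb_scale (ks_bundle X) (if i < p then \<i> else 1) (ks_gen X i e)) (p + q),
     kt_eta1 = ks_eta1 X, kt_eta2 = ks_eta2 X\<rparr>"

lemma grading_iff_sys_grading: "grading GG Y p q E r \<eta> \<longleftrightarrow> sys_grading GG Y E (p + q) (\<lambda>i. r (cl_gen i)) \<eta>"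
  by (simp add: grading_def sys_grading_def)

lemma cl_gen_carrier: "i < p + q \<Longrightarrow> cl_gen i \<in> cl_carrier p q"
  by (auto simp: cl_carrier_def cl_basis_def)

lemma cl_one_carrier: "cl_one \<in> cl_carrier p q"
  by (auto simp: cl_carrier_def cl_basis_def)

lemma cl_mult_carrier: "cl_mult p q a b \<in> cl_carrier p q" if "a \<in> cl_carrier p q" "b \<in> cl_carrier p q"
  unfolding cl_carrier_def
proof (intro CollectI allI impI)
  fix R assume R: "\<not> R \<subseteq> {..<p + q}"
  show "cl_mult p q a b R = 0"
    unfolding cl_mult_def
  proof (rule sum.neutral, rule ballI)
    fix S assume S: "S \<in> Pow {..<p + q}"
    have "R \<subseteq> S \<union> sym_diff S R" by auto
    then have "\<not> sym_diff S R \<subseteq> {..<p + q}" using R S by (meson PowD Un_least subset_trans)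
    then have "b (sym_diff S R) = 0" using that(2) by (simp add: cl_carrier_def)
    then show "cl_sign p S (sym_diff S R) * a S * b (sym_diff S R) = 0" by simp
  qed
qed

lemma clifford_module_anticommuting:
  assumes r: "clifford_module GG Y p q E r"
  shows "anticommuting GG Y E (p + q) (\<lambda>i. if i < p then - 1 else 1) (\<lambda>i. r (cl_gen i))"
proof -
  have m: "g_bundle_map GG Y E E (r (cl_gen i))" if "i < p + q" for i
    using r cl_gen_carrier[OF that] unfolding clifford_module_def by blast
  have R: "r cl_one e = e" "b \<in> cl_carrier p q \<Longrightarrow> r (\<lambda>S. c * b S) e = vb_scale E (complex_of_real c) (r b e)"
    "b \<in> cl_carrier p q \<Longrightarrow> d \<in> cl_carrier p q \<Longrightarrow> r (cl_mult p q b d) e = r b (r d e)"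
    if "e \<in> topspace (vb_total E)" for e b c d
    using r that unfolding clifford_module_def by blast+
  show ?thesis
    unfolding anticommuting_def
  proof (intro conjI allI impI ballI m)
    fix i e assume i: "i < p + q" and e: "e \<in> topspace (vb_total E)"
    show "r (cl_gen i) (r (cl_gen i) e) = vb_scale E (if i < p then - 1 else 1) e"
      using R(3)[OF e cl_gen_carrier[OF i] cl_gen_carrier[OF i]] R(2)[OF e cl_one_carrier, of "if i < p then - 1 else 1"]
        R(1)[OF e] unfolding cl_gen_square[OF i] by (simp split: if_splits)
    fix j assume j: "j < p + q" "i \<noteq> j"
    have "(\<lambda>R. - cl_mult p q (cl_gen j) (cl_gen i) R) = (\<lambda>R. (- 1) * cl_mult p q (cl_gen j) (cl_gen i) R)" by simp
    then show "r (cl_gen i) (r (cl_gen j) e) = vb_scale E (- 1) (r (cl_gen j) (r (cl_gen i) e))"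
      using R(3)[OF e cl_gen_carrier[OF i] cl_gen_carrier[OF j(1)]] R(3)[OF e cl_gen_carrier[OF j(1)] cl_gen_carrier[OF i]]
        R(2)[OF e cl_mult_carrier[OF cl_gen_carrier[OF j(1)] cl_gen_carrier[OF i]], of "- 1"]
      unfolding cl_gen_anticommute[OF i j(1) j(2)] by simp
  qed
qed

lemma is_ksys_sys_of:
  assumes T: "is_ktriple GG Y Y' p q T"
  shows "is_ksys GG Y Y' (p + q) (sys_of p T)"
proof -
  have r: "clifford_module GG Y p q (kt_bundle T) (kt_rep T)" using T by (simp add: is_ktriple_def)
  then have E: "g_vector_bundle GG Y (kt_bundle T)" by (simp add: clifford_module_def)
  note a = clifford_module_anticommuting[OF r]
  have m: "g_bundle_map GG Y (kt_bundle T) (kt_bundle T) (kt_rep T (cl_gen i))" if "i < p + q" for i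
    using a that by (rule anticommutingD)
  have "anticommuting GG Y (kt_bundle T) (p + q) (\<lambda>_. 1) (\<lambda>i e. vb_scale (kt_bundle T) (if i < p then - \<i> else 1) (kt_rep T (cl_gen i) e))"
    by (rule anticommuting_cong[OF E anticommuting_scale[OF E a]]) auto
  moreover have "sys_grading GG Y (kt_bundle T) (p + q) (\<lambda>i e. vb_scale (kt_bundle T) (if i < p then - \<i> else 1) (kt_rep T (cl_gen i) e)) \<eta>
      \<longleftrightarrow> grading GG Y p q (kt_bundle T) (kt_rep T) \<eta>" for \<eta>
    unfolding grading_iff_sys_grading by (rule sys_grading_scale[OF E m, where u = "\<lambda>i. if i < p then - \<i> else 1"]) auto
  ultimately show ?thesis using T E by (simp add: is_ksys_def sys_of_def is_ktriple_def)
qed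

text \<open>The second claim is witnessed by the identity map. It is not an equality of records,
  since the operators agree only on the total space and for indices below
  \<open>p + q\<close>.\<close>

lemma is_ktriple_triple_of:
  assumes X: "is_ksys GG Y Y' (p + q) X"
  shows "is_ktriple GG Y Y' p q (triple_of p q X)"
    and "ksys_iso GG Y (p + q) (sys_of p (triple_of p q X)) X"
proof -
  interpret X: ksystem GG Y Y' "p + q" X using X by unfold_locales
  let ?E = "ks_bundle X" and ?f = "\<lambda>i e. vb_scale (ks_bundle X) (if i < p then \<i> else 1) (ks_gen X i e)"
  have "anticommuting GG Y ?E (p + q) (\<lambda>i. if i < p then - 1 else 1) ?f"
    by (rule anticommuting_cong[OF X.g_vector_bundle anticommuting_scale[OF X.g_vector_bundle, of "p + q" "\<lambda>_. 1" "ks_gen X"]])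
      (use X in \<open>auto simp: is_ksys_def\<close>)
  then interpret f: anticommuting_family GG Y ?E p "p + q" ?f
    by (rule anticommuting_familyI[OF X.g_vector_bundle])
  have g: "sys_grading GG Y ?E (p + q) (\<lambda>i. cl_rep ?E ?f (p + q) (cl_gen i)) \<eta> \<longleftrightarrow>
      sys_grading GG Y ?E (p + q) (ks_gen X) \<eta>" for \<eta>
    by (rule sys_grading_scale[OF X.g_vector_bundle X.ks_gen_map, where u = "\<lambda>i. if i < p then \<i> else 1"])
      (simp_all add: f.rep_gen)
  show "is_ktriple GG Y Y' p q (triple_of p q X)"
    using X clifford_module_cl_rep[OF f.anticommuting_family_axioms]
    by (simp add: is_ktriple_def triple_of_def grading_iff_sys_grading g is_ksys_def)
  have eq: "vb_scale ?E (if i < p then - \<i> else 1) (?f i e) = ks_gen X i e" if "i < p + q" "e \<in> X.tot" for i e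
    by (rule X.eqI) (use that in auto)
  show "ksys_iso GG Y (p + q) (sys_of p (triple_of p q X)) X"
    unfolding ksys_iso_def ksys_iso_via_def homeomorphic_maps_def
    by (rule exI[of _ "\<lambda>e. e"], rule exI[of _ "\<lambda>e. e"])
      (simp add: sys_of_def triple_of_def g_bundle_map_id f.rep_gen eq)
qed

text \<open>The left side intertwines all algebra elements, the right side only rescaled generators.
  The gap is closed by \<open>clifford_module_intertwine\<close> and by cancelling the non-zero
  scalars. Questions about isomorphic triples thereby become questions about systems.\<close>

lemma ktriple_iso_iff:
  assumes S: "is_ktriple GG Y Y' p q S" and T: "is_ktriple GG Y Y'' p q T"
  shows "ktriple_iso GG Y p q S T \<longleftrightarrow> ksys_iso GG Y (p + q) (sys_of p S) (sys_of p T)"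
proof -
  have rS: "clifford_module GG Y p q (kt_bundle S) (kt_rep S)" and rT: "clifford_module GG Y p q (kt_bundle T) (kt_rep T)"
    using S T by (simp_all add: is_ktriple_def)
  then have E: "g_vector_bundle GG Y (kt_bundle S)" and F: "g_vector_bundle GG Y (kt_bundle T)"
    by (simp_all add: clifford_module_def)
  interpret E: g_bundle GG Y "kt_bundle S" using E by unfold_locales
  interpret F: g_bundle GG Y "kt_bundle T" using F by unfold_locales
  have mS: "g_bundle_map GG Y (kt_bundle S) (kt_bundle S) (kt_rep S (cl_gen i))" if "i < p + q" for i
    using clifford_module_anticommuting[OF rS] that by (rule anticommutingD)
  have mT: "g_bundle_map GG Y (kt_bundle T) (kt_bundle T) (kt_rep T (cl_gen i))" if "i < p + q" for i
    using clifford_module_anticommuting[OF rT] that by (rule anticommutingD)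
  have main: "(\<forall>a\<in>cl_carrier p q. \<forall>e\<in>topspace (vb_total (kt_bundle S)). h (kt_rep S a e) = kt_rep T a (h e)) \<longleftrightarrow>
      (\<forall>i<p + q. \<forall>e\<in>topspace (vb_total (kt_bundle S)). h (ks_gen (sys_of p S) i e) = ks_gen (sys_of p T) i (h e))"
    (is "?L \<longleftrightarrow> ?R") if h: "g_bundle_map GG Y (kt_bundle S) (kt_bundle T) h" for h
  proof
    assume ?L
    then show ?R using E.bm_scale[OF h] E.bm_total[OF mS] by (auto simp: sys_of_def cl_gen_carrier)
  next
    assume R: ?R
    have "h (kt_rep S (cl_gen i) e) = kt_rep T (cl_gen i) (h e)"
      if i: "i < p + q" and e: "e \<in> topspace (vb_total (kt_bundle S))" for i e
    proof (rule F.eqI)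
      have "h (vb_scale (kt_bundle S) (if i < p then - \<i> else 1) (kt_rep S (cl_gen i) e)) =
          vb_scale (kt_bundle T) (if i < p then - \<i> else 1) (kt_rep T (cl_gen i) (h e))"
        using R i e unfolding sys_of_def ksys.simps by blast
      then have "vb_scale (kt_bundle T) (if i < p then - \<i> else 1) (h (kt_rep S (cl_gen i) e)) =
          vb_scale (kt_bundle T) (if i < p then - \<i> else 1) (kt_rep T (cl_gen i) (h e))"
        unfolding E.bm_scale[OF h E.bm_total(1)[OF mS[OF i] e]] .
      then have "(if i < p then - \<i> else 1) * vb_coord (gs_total Y) (kt_bundle T) (h (kt_rep S (cl_gen i) e)) j =
          (if i < p then - \<i> else 1) * vb_coord (gs_total Y) (kt_bundle T) (kt_rep T (cl_gen i) (h e)) j" for j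
        using e E.bm_total[OF h] E.bm_total[OF mS[OF i]] F.bm_total[OF mT[OF i]] F.coord_scale by metis
      then show "vb_coord (gs_total Y) (kt_bundle T) (h (kt_rep S (cl_gen i) e)) j =
          vb_coord (gs_total Y) (kt_bundle T) (kt_rep T (cl_gen i) (h e)) j" for j
        by (simp add: if_distrib[of "\<lambda>x. x = 0"] cong: if_cong)
    qed (use e E.bm_total[OF h] E.bm_total[OF mS[OF i]] F.bm_total[OF mT[OF i]] in simp_all)
    then show ?L using clifford_module_intertwine[OF rS rT h] by blast
  qed
  show ?thesis
  proof
    assume "ktriple_iso GG Y p q S T"
    then obtain h where h: "homeomorphic_map (vb_total (kt_bundle S)) (vb_total (kt_bundle T)) h"
      "g_bundle_map GG Y (kt_bundle S) (kt_bundle T) h"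
      "\<forall>e\<in>topspace (vb_total (kt_bundle S)). (\<forall>a\<in>cl_carrier p q. h (kt_rep S a e) = kt_rep T a (h e)) \<and>
           h (kt_eta1 S e) = kt_eta1 T (h e) \<and> h (kt_eta2 S e) = kt_eta2 T (h e)"
      unfolding ktriple_iso_def by blast
    obtain k where "homeomorphic_maps (vb_total (kt_bundle S)) (vb_total (kt_bundle T)) h k"
      using h(1) homeomorphic_map_maps by blast
    then have "ksys_iso_via GG Y (p + q) (sys_of p S) (sys_of p T) h k"
      unfolding ksys_iso_via_def using h main[OF h(2)] by (simp add: sys_of_def)
    then show "ksys_iso GG Y (p + q) (sys_of p S) (sys_of p T)" unfolding ksys_iso_def by blast
  next
    assume "ksys_iso GG Y (p + q) (sys_of p S) (sys_of p T)"
    then obtain h k where h: "ksys_iso_via GG Y (p + q) (sys_of p S) (sys_of p T) h k"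
      unfolding ksys_iso_def by blast
    note v = ksys_iso_viaD[OF h]
    have h': "g_bundle_map GG Y (kt_bundle S) (kt_bundle T) h" using v(1) by (simp add: sys_of_def)
    have "homeomorphic_map (vb_total (kt_bundle S)) (vb_total (kt_bundle T)) h"
      using v(2) homeomorphic_map_maps by (auto simp: sys_of_def)
    then show "ktriple_iso GG Y p q S T"
      unfolding ktriple_iso_def using main[OF h'] v(7,8,9) h' by (auto simp: sys_of_def)
  qed
qed

section \<open>Operations on systems\<close>

lemma is_ksysI:
  assumes "g_vector_bundle GG Y (ks_bundle X)"
    and "anticommuting GG Y (ks_bundle X) N (\<lambda>_. 1) (ks_gen X)"
    and "sys_grading GG Y (ks_bundle X) N (ks_gen X) (ks_eta1 X)"
    and "sys_grading GG Y (ks_bundle X) N (ks_gen X) (ks_eta2 X)"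
    and "\<And>e. e \<in> topspace (vb_total (ks_bundle X)) \<Longrightarrow> vb_proj (ks_bundle X) e \<in> Y' \<Longrightarrow> ks_eta1 X e = ks_eta2 X e"
  shows "is_ksys GG Y Y' N X"
  using assms by (simp add: is_ksys_def)

lemma anticommutingI:
  assumes "\<And>i. i < N \<Longrightarrow> g_bundle_map GG Y E E (g i)"
    and "\<And>i e. i < N \<Longrightarrow> e \<in> topspace (vb_total E) \<Longrightarrow> g i (g i e) = vb_scale E (\<sigma> i) e"
    and "\<And>i j e. i < N \<Longrightarrow> j < N \<Longrightarrow> i \<noteq> j \<Longrightarrow> e \<in> topspace (vb_total E) \<Longrightarrow>
      g i (g j e) = vb_scale E (- 1) (g j (g i e))"
  shows "anticommuting GG Y E N \<sigma> g"
  unfolding anticommuting_def using assms by blast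

lemma sys_gradingI:
  assumes "g_bundle_map GG Y E E \<eta>" "\<And>e. e \<in> topspace (vb_total E) \<Longrightarrow> \<eta> (\<eta> e) = e"
    and "\<And>i e. i < N \<Longrightarrow> e \<in> topspace (vb_total E) \<Longrightarrow> \<eta> (g i e) = vb_scale E (- 1) (g i (\<eta> e))"
  shows "sys_grading GG Y E N g \<eta>"
  unfolding sys_grading_def using assms by blast

text \<open>All operators are conjugated by \<open>h\<close>, with \<open>k\<close> as its inverse;
  the target bundle \<open>F\<close> is given in advance, for instance as a copy.\<close>

definition ksys_transport :: "('f, 'y, 'g) vbundle \<Rightarrow> ('e \<Rightarrow> 'f) \<Rightarrow> ('f \<Rightarrow> 'e) \<Rightarrow> ('e, 'y, 'g) ksys \<Rightarrow> ('f, 'y, 'g) ksys" where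
  "ksys_transport F h k X = \<lparr>ks_bundle = F, ks_gen = (\<lambda>i f. h (ks_gen X i (k f))),
     ks_eta1 = (\<lambda>f. h (ks_eta1 X (k f))), ks_eta2 = (\<lambda>f. h (ks_eta2 X (k f)))\<rparr>"

lemma grading_transport:
  assumes E: "g_vector_bundle GG Y E" and F: "g_vector_bundle GG Y F"
    and h: "g_bundle_map GG Y E F h" and hk: "homeomorphic_maps (vb_total E) (vb_total F) h k"
    and g: "\<And>i. i < N \<Longrightarrow> g_bundle_map GG Y E E (g i)" and \<eta>: "sys_grading GG Y E N g \<eta>"
    and g': "\<And>i f. i < N \<Longrightarrow> f \<in> topspace (vb_total F) \<Longrightarrow> g' i f = h (g i (k f))"
  shows "sys_grading GG Y F N g' (\<lambda>f. h (\<eta> (k f)))"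
proof -
  interpret E: g_bundle GG Y E using E by unfold_locales
  interpret F: g_bundle GG Y F using F by unfold_locales
  have k: "g_bundle_map GG Y F E k" by (rule g_bundle_map_inverse[OF E F h hk])
  have \<eta>m: "g_bundle_map GG Y E E \<eta>" using \<eta> by (simp add: sys_grading_def)
  have kh: "k (h e) = e" if "e \<in> topspace (vb_total E)" for e using hk that by (simp add: homeomorphic_maps_def)
  note t = E.bm_total[OF h] F.bm_total[OF k] E.bm_total[OF \<eta>m] E.bm_total[OF g] kh E.bm_scale[OF h]
  have hkf: "h (k f) = f" if "f \<in> topspace (vb_total F)" for f using hk that by (simp add: homeomorphic_maps_def)
  show ?thesis
  proof (rule sys_gradingI)
    show "g_bundle_map GG Y F F (\<lambda>f. h (\<eta> (k f)))"
      by (rule g_bundle_map_comp[OF F g_bundle_map_comp[OF F k \<eta>m] h])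
    fix f assume f: "f \<in> topspace (vb_total F)"
    have "\<eta> (\<eta> (k f)) = k f" using \<eta> f F.bm_total[OF k] unfolding sys_grading_def by blast
    then show "h (\<eta> (k (h (\<eta> (k f))))) = f" using f by (simp add: t hkf)
    fix i assume i: "i < N"
    have "\<eta> (g i (k f)) = vb_scale E (- 1) (g i (\<eta> (k f)))"
      using \<eta> f i F.bm_total[OF k] unfolding sys_grading_def by blast
    then show "h (\<eta> (k (g' i f))) = vb_scale F (- 1) (g' i (h (\<eta> (k f))))"
      using f i by (simp add: t g')
  qed
qed

lemma is_ksys_transport:
  assumes X: "is_ksys GG Y Y' N X" and F: "g_vector_bundle GG Y F"
    and h: "g_bundle_map GG Y (ks_bundle X) F h" and hk: "homeomorphic_maps (vb_total (ks_bundle X)) (vb_total F) h k"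
  shows "is_ksys GG Y Y' N (ksys_transport F h k X)"
    and "ksys_iso_via GG Y N X (ksys_transport F h k X) h k"
proof -
  interpret X: ksystem GG Y Y' N X using X by unfold_locales
  interpret F: g_bundle GG Y F using F by unfold_locales
  have k: "g_bundle_map GG Y F (ks_bundle X) k" by (rule g_bundle_map_inverse[OF X.g_vector_bundle F h hk])
  have kh: "k (h e) = e" if "e \<in> X.tot" for e using hk that by (simp add: homeomorphic_maps_def)
  have hkf: "h (k f) = f" if "f \<in> topspace (vb_total F)" for f using hk that by (simp add: homeomorphic_maps_def)
  note t = X.bm_total[OF h] F.bm_total[OF k] kh X.bm_scale[OF h]
  let ?Z = "ksys_transport F h k X"
  have Z: "ks_bundle ?Z = F" "ks_gen ?Z i f = h (ks_gen X i (k f))"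
    "ks_eta1 ?Z = (\<lambda>f. h (ks_eta1 X (k f)))" "ks_eta2 ?Z = (\<lambda>f. h (ks_eta2 X (k f)))" for i f
    by (simp_all add: ksys_transport_def)
  show "is_ksys GG Y Y' N ?Z"
  proof (rule is_ksysI; unfold Z(1,3,4))
    show "anticommuting GG Y F N (\<lambda>_. 1) (ks_gen ?Z)"
    proof (rule anticommutingI)
      fix i assume i: "i < N"
      show "g_bundle_map GG Y F F (ks_gen ?Z i)"
        unfolding ksys_transport_def ksys.simps
        by (rule g_bundle_map_comp[OF F g_bundle_map_comp[OF F k X.ks_gen_map[OF i]] h])
      fix f assume f: "f \<in> topspace (vb_total F)"
      show "ks_gen ?Z i (ks_gen ?Z i f) = vb_scale F 1 f"
        using f i by (simp add: Z t hkf) (rule F.eqI, simp_all)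
      fix j assume j: "j < N" "i \<noteq> j"
      show "ks_gen ?Z i (ks_gen ?Z j f) = vb_scale F (- 1) (ks_gen ?Z j (ks_gen ?Z i f))"
        using f i j by (simp add: Z t X.ks_anticommute[of i j])
    qed
    show "sys_grading GG Y F N (ks_gen ?Z) (\<lambda>f. h (ks_eta1 X (k f)))"
      "sys_grading GG Y F N (ks_gen ?Z) (\<lambda>f. h (ks_eta2 X (k f)))"
      by (rule grading_transport[OF X.g_vector_bundle F h hk X.ks_gen_map]; simp add: Z X.ks_eta1 X.ks_eta2)+
    show "h (ks_eta1 X (k f)) = h (ks_eta2 X (k f))" if "f \<in> topspace (vb_total F)" "vb_proj F f \<in> Y'" for f
      using X.ks_eta_eq[of "k f"] that by (simp add: t)
  qed (rule F)
  show "ksys_iso_via GG Y N X ?Z h k"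
    unfolding ksys_iso_via_def using hk h by (simp add: Z t)
qed

text \<open>Base point and coordinates together determine a vector, which gives an injection into
  the type of the generators. Continuity of \<open>vb_coord\<close> is no issue, since
  \<open>vb_copy\<close> transports the topology along the injection.\<close>

lemma ksys_copy:
  fixes X :: "('e, 'y, 'g) ksys"
  assumes X: "is_ksys GG Y Y' N X"
  obtains Z :: "('y \<times> (nat \<Rightarrow> complex), 'y, 'g) ksys" where "is_ksys GG Y Y' N Z" "ksys_iso GG Y N Z X"
proof -
  interpret X: ksystem GG Y Y' N X using X by unfold_locales
  let ?E = "ks_bundle X"
  define j where "j e = (vb_proj ?E e, vb_coord (gs_total Y) ?E e)" for e
  have j: "inj_on j X.tot"
  proof (rule inj_onI)
    fix e e' assume "e \<in> X.tot" "e' \<in> X.tot" "j e = j e'"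
    then show "e = e'" by (intro X.eqI) (auto simp: j_def)
  qed
  note t = is_ksys_transport[OF X g_vector_bundle_copy[OF X.g_vector_bundle j] vb_copy_homeomorphic[OF j]]
  show thesis
    by (rule that[OF t(1)]) (use ksys_iso_via_sym[OF X t(1) t(2)] in \<open>auto simp: ksys_iso_def\<close>)
qed

definition ksys_sum :: "('e, 'y, 'g) ksys \<Rightarrow> ('f, 'y, 'g) ksys \<Rightarrow> ('e \<times> 'f, 'y, 'g) ksys" where
  "ksys_sum X Z = \<lparr>ks_bundle = whitney_sum (ks_bundle X) (ks_bundle Z),
     ks_gen = (\<lambda>i. map_prod (ks_gen X i) (ks_gen Z i)),
     ks_eta1 = map_prod (ks_eta1 X) (ks_eta1 Z), ks_eta2 = map_prod (ks_eta2 X) (ks_eta2 Z)\<rparr>"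

definition ksys_pullback :: "('y, 'g, 'b) gspace \<Rightarrow> ('y \<Rightarrow> 'z) \<Rightarrow> ('e, 'z, 'g) ksys \<Rightarrow> ('y \<times> 'e, 'y, 'g) ksys" where
  "ksys_pullback Y f X = \<lparr>ks_bundle = pullback_bundle Y f (ks_bundle X),
     ks_gen = (\<lambda>i. map_prod id (ks_gen X i)),
     ks_eta1 = map_prod id (ks_eta1 X), ks_eta2 = map_prod id (ks_eta2 X)\<rparr>"

lemma sys_of_sum: "sys_of p (ktriple_sum S T) = ksys_sum (sys_of p S) (sys_of p T)"
  by (simp add: sys_of_def ktriple_sum_def ksys_sum_def map_prod_def case_prod_unfold)

lemma sys_of_pullback: "sys_of p (ktriple_pullback Y f T) = ksys_pullback Y f (sys_of p T)"
  by (simp add: sys_of_def ktriple_pullback_def ksys_pullback_def map_prod_def case_prod_unfold)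

lemma clifford_moduleD:
  assumes "clifford_module GG Y p q E r"
  shows "g_vector_bundle GG Y E"
    and "\<And>a. a \<in> cl_carrier p q \<Longrightarrow> g_bundle_map GG Y E E (r a)"
    and "\<And>e. e \<in> topspace (vb_total E) \<Longrightarrow> r cl_one e = e"
    and "\<And>a c e. e \<in> topspace (vb_total E) \<Longrightarrow> a \<in> cl_carrier p q \<Longrightarrow>
       r (\<lambda>S. c * a S) e = vb_scale E (complex_of_real c) (r a e)"
    and "\<And>a b e. e \<in> topspace (vb_total E) \<Longrightarrow> a \<in> cl_carrier p q \<Longrightarrow> b \<in> cl_carrier p q \<Longrightarrow>
       r (\<lambda>S. a S + b S) e = vb_add E (r a e) (r b e)"
    and "\<And>a b e. e \<in> topspace (vb_total E) \<Longrightarrow> a \<in> cl_carrier p q \<Longrightarrow> b \<in> cl_carrier p q \<Longrightarrow>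
       r (cl_mult p q a b) e = r a (r b e)"
  using assms unfolding clifford_module_def by blast+

lemma clifford_moduleI:
  assumes "g_vector_bundle GG Y E"
    and "\<And>a. a \<in> cl_carrier p q \<Longrightarrow> g_bundle_map GG Y E E (r a)"
    and "\<And>e. e \<in> topspace (vb_total E) \<Longrightarrow> r cl_one e = e"
    and "\<And>a c e. e \<in> topspace (vb_total E) \<Longrightarrow> a \<in> cl_carrier p q \<Longrightarrow>
       r (\<lambda>S. c * a S) e = vb_scale E (complex_of_real c) (r a e)"
    and "\<And>a b e. e \<in> topspace (vb_total E) \<Longrightarrow> a \<in> cl_carrier p q \<Longrightarrow> b \<in> cl_carrier p q \<Longrightarrow>
       r (\<lambda>S. a S + b S) e = vb_add E (r a e) (r b e)"
    and "\<And>a b e. e \<in> topspace (vb_total E) \<Longrightarrow> a \<in> cl_carrier p q \<Longrightarrow> b \<in> cl_carrier p q \<Longrightarrow>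
       r (cl_mult p q a b) e = r a (r b e)"
  shows "clifford_module GG Y p q E r"
  unfolding clifford_module_def using assms by blast

lemma clifford_module_sum:
  assumes r: "clifford_module GG Y p q E r" and s: "clifford_module GG Y p q F s"
  shows "clifford_module GG Y p q (whitney_sum E F) (\<lambda>a. map_prod (r a) (s a))"
proof (rule clifford_moduleI)
  note R = clifford_moduleD[OF r] and S = clifford_moduleD[OF s]
  show "g_vector_bundle GG Y (whitney_sum E F)" using R(1) S(1) by simp
  show "g_bundle_map GG Y (whitney_sum E F) (whitney_sum E F) (map_prod (r a) (s a))" if "a \<in> cl_carrier p q" for a
    by (rule g_bundle_map_map_prod[OF R(1) S(1) R(2)[OF that] S(2)[OF that]])
qed (simp_all add: clifford_moduleD(3-6)[OF r] clifford_moduleD(3-6)[OF s] prod_eq_iff)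

lemma is_ktriple_sum:
  assumes S: "is_ktriple GG Y Y' p q S" and T: "is_ktriple GG Y Y' p q T"
  shows "is_ktriple GG Y Y' p q (ktriple_sum S T)"
proof -
  have E: "g_vector_bundle GG Y (kt_bundle S)" and F: "g_vector_bundle GG Y (kt_bundle T)"
    using S T by (simp_all add: is_ktriple_def clifford_module_def)
  have "grading GG Y p q (whitney_sum (kt_bundle S) (kt_bundle T)) (\<lambda>a. map_prod (kt_rep S a) (kt_rep T a)) (map_prod \<eta> \<xi>)"
    if "grading GG Y p q (kt_bundle S) (kt_rep S) \<eta>" "grading GG Y p q (kt_bundle T) (kt_rep T) \<xi>" for \<eta> \<xi>
    using that g_bundle_map_map_prod[OF E F, of "kt_bundle S" \<eta> "kt_bundle T" \<xi>]
    by (auto simp: grading_def prod_eq_iff)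
  moreover have "clifford_module GG Y p q (whitney_sum (kt_bundle S) (kt_bundle T)) (\<lambda>a. map_prod (kt_rep S a) (kt_rep T a))"
    using S T by (intro clifford_module_sum) (simp_all add: is_ktriple_def)
  ultimately show ?thesis
    using S T by (auto simp: is_ktriple_def ktriple_sum_def prod_eq_iff)
qed

lemma is_ktriple_pullback:
  assumes T: "is_ktriple GG Z Z' p q T" and f: "equivariant_map GG Y Z f" and fY: "f ` Y' \<subseteq> Z'"
  shows "is_ktriple GG Y Y' p q (ktriple_pullback Y f T)"
proof -
  let ?E = "kt_bundle T" and ?P = "pullback_bundle Y f (kt_bundle T)" and ?r = "\<lambda>a. map_prod id (kt_rep T a)"
  have r: "clifford_module GG Z p q ?E (kt_rep T)" using T by (simp add: is_ktriple_def)
  note R = clifford_moduleD[OF r]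
  have "clifford_module GG Y p q ?P ?r"
  proof (rule clifford_moduleI)
    show "g_vector_bundle GG Y ?P" by (rule g_vector_bundle_pullback[OF R(1) f])
    show "g_bundle_map GG Y ?P ?P (?r a)" if "a \<in> cl_carrier p q" for a
      by (rule g_bundle_map_pullback[OF R(1) f R(2)[OF that]])
  qed (simp_all add: R(3-6) prod_eq_iff)
  moreover have "grading GG Y p q ?P ?r (map_prod id \<eta>)" if "grading GG Z p q ?E (kt_rep T) \<eta>" for \<eta>
    using that g_bundle_map_pullback[OF R(1) f, of ?E \<eta>] by (auto simp: grading_def prod_eq_iff)
  ultimately show ?thesis
    using T fY by (auto simp: is_ktriple_def ktriple_pullback_def prod_eq_iff)
qed

lemma is_ksys_sum:
  assumes X: "is_ksys GG Y Y' N X" and Z: "is_ksys GG Y Y' N Z"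
  shows "is_ksys GG Y Y' N (ksys_sum X Z)"
proof -
  interpret X: ksystem GG Y Y' N X using X by unfold_locales
  interpret Z: ksystem GG Y Y' N Z using Z by unfold_locales
  let ?W = "whitney_sum (ks_bundle X) (ks_bundle Z)" and ?g = "\<lambda>i. map_prod (ks_gen X i) (ks_gen Z i)"
  have m: "g_bundle_map GG Y ?W ?W (map_prod h k)"
    if "g_bundle_map GG Y (ks_bundle X) (ks_bundle X) h" "g_bundle_map GG Y (ks_bundle Z) (ks_bundle Z) k" for h k
    by (rule g_bundle_map_map_prod[OF X.g_vector_bundle Z.g_vector_bundle that])
  have gr: "sys_grading GG Y ?W N ?g (map_prod \<eta> \<xi>)"
    if "sys_grading GG Y (ks_bundle X) N (ks_gen X) \<eta>" "sys_grading GG Y (ks_bundle Z) N (ks_gen Z) \<xi>" for \<eta> \<xi>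
    by (rule sys_gradingI)
      (use that m in \<open>auto simp: sys_grading_def X.grading[OF that(1)] Z.grading[OF that(2)] prod_eq_iff\<close>)
  have "anticommuting GG Y ?W N (\<lambda>_. 1) ?g"
    by (rule anticommutingI)
      (use m X.ks_gen_map Z.ks_gen_map in \<open>simp_all add: prod_eq_iff X.ks_anticommute[symmetric] Z.ks_anticommute[symmetric]\<close>)
  then show ?thesis
    using X.g_vector_bundle Z.g_vector_bundle gr[OF X.ks_eta1 Z.ks_eta1] gr[OF X.ks_eta2 Z.ks_eta2] X.ks_eta_eq Z.ks_eta_eq
    by (intro is_ksysI) (auto simp: ksys_sum_def prod_eq_iff)
qed

lemma ksys_iso_sum:
  assumes X: "is_ksys GG Y Y' N X" and Z: "is_ksys GG Y Y' N Z"
    and "ksys_iso GG Y N X X1" and "ksys_iso GG Y N Z Z1"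
  shows "ksys_iso GG Y N (ksys_sum X Z) (ksys_sum X1 Z1)"
proof -
  obtain h k where h: "ksys_iso_via GG Y N X X1 h k" using assms(3) unfolding ksys_iso_def by blast
  obtain h' k' where h': "ksys_iso_via GG Y N Z Z1 h' k'" using assms(4) unfolding ksys_iso_def by blast
  interpret X: ksystem GG Y Y' N X using X by unfold_locales
  interpret Z: ksystem GG Y Y' N Z using Z by unfold_locales
  note v = ksys_iso_viaD[OF h] and w = ksys_iso_viaD[OF h']
  have b: "g_bundle_map GG Y (whitney_sum (ks_bundle X) (ks_bundle Z)) (whitney_sum (ks_bundle X1) (ks_bundle Z1)) (map_prod h h')"
    by (rule g_bundle_map_map_prod[OF X.g_vector_bundle Z.g_vector_bundle v(1) w(1)])
  have p: "vb_proj (ks_bundle X) (k e) = vb_proj (ks_bundle X1) e" if "e \<in> topspace (vb_total (ks_bundle X1))" for e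
    using X.bm_total(2)[OF v(1) v(6)[OF that]] v(4)[OF that] by simp
  have p': "vb_proj (ks_bundle Z) (k' e) = vb_proj (ks_bundle Z1) e" if "e \<in> topspace (vb_total (ks_bundle Z1))" for e
    using Z.bm_total(2)[OF w(1) w(6)[OF that]] w(4)[OF that] by simp
  have c: "continuous_map (vb_total (ks_bundle X1)) (vb_total (ks_bundle X)) k"
    "continuous_map (vb_total (ks_bundle Z1)) (vb_total (ks_bundle Z)) k'"
    using v(2) w(2) by (simp_all add: homeomorphic_maps_def)
  have "continuous_map (vb_total (whitney_sum (ks_bundle X1) (ks_bundle Z1))) (vb_total (whitney_sum (ks_bundle X) (ks_bundle Z))) (map_prod k k')"
    unfolding whitney_sum_cont using continuous_map_comp2[OF whitney_sum_cont_fst c(1)] continuous_map_comp2[OF whitney_sum_cont_snd c(2)]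
    by (auto simp: p p')
  then have "homeomorphic_maps (vb_total (whitney_sum (ks_bundle X) (ks_bundle Z))) (vb_total (whitney_sum (ks_bundle X1) (ks_bundle Z1)))
      (map_prod h h') (map_prod k k')"
    unfolding homeomorphic_maps_def using g_bundle_map_cont[OF b] by (auto simp: v w)
  then have "ksys_iso_via GG Y N (ksys_sum X Z) (ksys_sum X1 Z1) (map_prod h h') (map_prod k k')"
    unfolding ksys_iso_via_def using b by (auto simp: ksys_sum_def v w)
  then show ?thesis unfolding ksys_iso_def by blast
qed

lemma ksys_iso_pullback:
  assumes X: "is_ksys GG Z Z' N X" and X1: "is_ksys GG Z Z'' N X1" and "ksys_iso GG Z N X X1"
    and f: "equivariant_map GG Y Z f"
  shows "ksys_iso GG Y N (ksys_pullback Y f X) (ksys_pullback Y f X1)"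
proof -
  obtain h k where h: "ksys_iso_via GG Z N X X1 h k" using assms(3) unfolding ksys_iso_def by blast
  interpret X: ksystem GG Z Z' N X using X by unfold_locales
  interpret X1: ksystem GG Z Z'' N X1 using X1 by unfold_locales
  note v = ksys_iso_viaD[OF h] and w = ksys_iso_viaD[OF ksys_iso_via_sym[OF X X1 h]]
  have b: "g_bundle_map GG Y (pullback_bundle Y f (ks_bundle X)) (pullback_bundle Y f (ks_bundle X1)) (map_prod id h)"
    by (rule g_bundle_map_pullback[OF X.g_vector_bundle f v(1)])
  have b': "g_bundle_map GG Y (pullback_bundle Y f (ks_bundle X1)) (pullback_bundle Y f (ks_bundle X)) (map_prod id k)"
    by (rule g_bundle_map_pullback[OF X1.g_vector_bundle f w(1)])
  have "homeomorphic_maps (vb_total (pullback_bundle Y f (ks_bundle X))) (vb_total (pullback_bundle Y f (ks_bundle X1)))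
      (map_prod id h) (map_prod id k)"
    unfolding homeomorphic_maps_def using g_bundle_map_cont[OF b] g_bundle_map_cont[OF b'] by (auto simp: v)
  then have "ksys_iso_via GG Y N (ksys_pullback Y f X) (ksys_pullback Y f X1) (map_prod id h) (map_prod id k)"
    unfolding ksys_iso_via_def using b by (auto simp: ksys_pullback_def v)
  then show ?thesis unfolding ksys_iso_def by blast
qed

lemma ksys_pullback_sum_iso:
  assumes X: "is_ksys GG Z Z' N X" and X1: "is_ksys GG Z Z' N X1" and f: "equivariant_map GG Y Z f"
  shows "ksys_iso GG Y N (ksys_pullback Y f (ksys_sum X X1)) (ksys_sum (ksys_pullback Y f X) (ksys_pullback Y f X1))"
proof -
  have E: "g_vector_bundle GG Z (ks_bundle X)" "g_vector_bundle GG Z (ks_bundle X1)"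
    using X X1 by (simp_all add: is_ksys_def)
  show ?thesis
    unfolding ksys_iso_def ksys_iso_via_def
    using pullback_whitney_sum[OF E f]
    by (intro exI conjI) (auto simp: ksys_pullback_def ksys_sum_def)
qed

section \<open>Null-homotopic systems\<close>

text \<open>\<open>gradings_homotopic\<close> expressed for systems, with the path \<open>H\<close>
  and the norm \<open>\<nu>\<close> as parameters so that \<open>ksys_null_transfer\<close> can
  refer to them.\<close>

definition ksys_null_via :: "('g, 'b) group_bundle \<Rightarrow> ('y, 'g, 'b) gspace \<Rightarrow> 'y set \<Rightarrow> nat \<Rightarrow> ('e, 'y, 'g) ksys \<Rightarrow>
    (real \<Rightarrow> 'e \<Rightarrow> 'e) \<Rightarrow> ('e \<Rightarrow> real) \<Rightarrow> bool" where
  "ksys_null_via GG Y Y' N X H \<nu> \<longleftrightarrow> fibre_norm (ks_bundle X) \<nu> \<and>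
     (\<forall>t\<in>{0..1}. sys_grading GG Y (ks_bundle X) N (ks_gen X) (H t)) \<and>
     (\<forall>e\<in>topspace (vb_total (ks_bundle X)). H 0 e = ks_eta1 X e \<and> H 1 e = ks_eta2 X e) \<and>
     (\<forall>t\<in>{0..1}. \<forall>e\<in>topspace (vb_total (ks_bundle X)). vb_proj (ks_bundle X) e \<in> Y' \<longrightarrow> H t e = H 0 e) \<and>
     (\<forall>t\<in>{0..1}. \<forall>\<epsilon>>0. \<exists>\<delta>>0. \<forall>s\<in>{0..1}. \<bar>s - t\<bar> < \<delta> \<longrightarrow>
        (\<forall>e\<in>topspace (vb_total (ks_bundle X)).
           \<nu> (vb_add (ks_bundle X) (H s e) (vb_scale (ks_bundle X) (- 1) (H t e))) \<le> \<epsilon> * \<nu> e))"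

definition ksys_null :: "('g, 'b) group_bundle \<Rightarrow> ('y, 'g, 'b) gspace \<Rightarrow> 'y set \<Rightarrow> nat \<Rightarrow> ('e, 'y, 'g) ksys \<Rightarrow> bool" where
  "ksys_null GG Y Y' N X \<longleftrightarrow> (\<exists>H \<nu>. ksys_null_via GG Y Y' N X H \<nu>)"

lemma gradings_homotopic_iff:
  assumes T: "is_ktriple GG Y Y' p q T"
  shows "gradings_homotopic GG Y Y' p q (kt_bundle T) (kt_rep T) (kt_eta1 T) (kt_eta2 T) \<longleftrightarrow>
     ksys_null GG Y Y' (p + q) (sys_of p T)"
proof -
  have r: "clifford_module GG Y p q (kt_bundle T) (kt_rep T)" using T by (simp add: is_ktriple_def)
  have E: "g_vector_bundle GG Y (kt_bundle T)" using r by (simp add: clifford_module_def)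
  have "sys_grading GG Y (kt_bundle T) (p + q) (\<lambda>i e. vb_scale (kt_bundle T) (if i < p then - \<i> else 1) (kt_rep T (cl_gen i) e)) \<eta>
      \<longleftrightarrow> grading GG Y p q (kt_bundle T) (kt_rep T) \<eta>" for \<eta>
    unfolding grading_iff_sys_grading
    by (rule sys_grading_scale[OF E anticommutingD(1)[OF clifford_module_anticommuting[OF r]], where u = "\<lambda>i. if i < p then - \<i> else 1"]) auto
  then show ?thesis
    unfolding gradings_homotopic_def ksys_null_def ksys_null_via_def sys_of_def by simp
qed

text \<open>The assumptions say what a new path \<open>K\<close> has to satisfy at single parameters
  and vectors, given the same for \<open>H\<close>. As the estimate keeps its
  \<open>\<epsilon>\<close>, the \<open>\<delta>\<close> of \<open>H\<close> also serves
  \<open>K\<close>, and the quantifiers of continuity are treated once for isomorphisms, pullbacks,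
  doubles and restrictions of doubles.\<close>

lemma ksys_null_transfer:
  assumes n: "ksys_null_via GG Y Y' N X H \<nu>"
    and \<nu>: "fibre_norm (ks_bundle Z) \<mu>"
    and gr: "\<And>t. sys_grading GG Y (ks_bundle X) N (ks_gen X) (H t) \<Longrightarrow>
      sys_grading GG W (ks_bundle Z) M (ks_gen Z) (K t)"
    and ends: "\<And>f. f \<in> topspace (vb_total (ks_bundle Z)) \<Longrightarrow>
      (\<And>e. e \<in> topspace (vb_total (ks_bundle X)) \<Longrightarrow> H 0 e = ks_eta1 X e \<and> H 1 e = ks_eta2 X e) \<Longrightarrow>
      K 0 f = ks_eta1 Z f \<and> K 1 f = ks_eta2 Z f"
    and const: "\<And>t f. t \<in> {0..1} \<Longrightarrow> f \<in> topspace (vb_total (ks_bundle Z)) \<Longrightarrow> vb_proj (ks_bundle Z) f \<in> W' \<Longrightarrow>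
      (\<And>e. e \<in> topspace (vb_total (ks_bundle X)) \<Longrightarrow> vb_proj (ks_bundle X) e \<in> Y' \<Longrightarrow> H t e = H 0 e) \<Longrightarrow> K t f = K 0 f"
    and est: "\<And>s t f \<epsilon>. sys_grading GG Y (ks_bundle X) N (ks_gen X) (H s) \<Longrightarrow>
      sys_grading GG Y (ks_bundle X) N (ks_gen X) (H t) \<Longrightarrow> f \<in> topspace (vb_total (ks_bundle Z)) \<Longrightarrow>
      (\<And>e. e \<in> topspace (vb_total (ks_bundle X)) \<Longrightarrow>
         \<nu> (vb_add (ks_bundle X) (H s e) (vb_scale (ks_bundle X) (- 1) (H t e))) \<le> \<epsilon> * \<nu> e) \<Longrightarrow>
      \<mu> (vb_add (ks_bundle Z) (K s f) (vb_scale (ks_bundle Z) (- 1) (K t f))) \<le> \<epsilon> * \<mu> f"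
  shows "ksys_null GG W W' M Z"
proof -
  have H: "sys_grading GG Y (ks_bundle X) N (ks_gen X) (H t)" if "t \<in> {0..1}" for t
    using n that unfolding ksys_null_via_def by blast
  have "ksys_null_via GG W W' M Z K \<mu>"
    unfolding ksys_null_via_def
  proof (intro conjI ballI allI impI)
    fix f assume f: "f \<in> topspace (vb_total (ks_bundle Z))"
    show "K 0 f = ks_eta1 Z f" "K 1 f = ks_eta2 Z f"
      using ends[OF f] n unfolding ksys_null_via_def by blast+
  next
    fix t f assume "t \<in> {0..1::real}" "f \<in> topspace (vb_total (ks_bundle Z))" "vb_proj (ks_bundle Z) f \<in> W'"
    then show "K t f = K 0 f" using const n unfolding ksys_null_via_def by blast
  next
    fix t \<epsilon> :: real assume t: "t \<in> {0..1}" and \<epsilon>: "0 < \<epsilon>"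
    then obtain \<delta> where \<delta>: "\<delta> > 0" "\<And>s e. s \<in> {0..1} \<Longrightarrow> \<bar>s - t\<bar> < \<delta> \<Longrightarrow> e \<in> topspace (vb_total (ks_bundle X)) \<Longrightarrow>
      \<nu> (vb_add (ks_bundle X) (H s e) (vb_scale (ks_bundle X) (- 1) (H t e))) \<le> \<epsilon> * \<nu> e"
      using n unfolding ksys_null_via_def by meson
    show "\<exists>\<delta>>0. \<forall>s\<in>{0..1}. \<bar>s - t\<bar> < \<delta> \<longrightarrow> (\<forall>f\<in>topspace (vb_total (ks_bundle Z)).
        \<mu> (vb_add (ks_bundle Z) (K s f) (vb_scale (ks_bundle Z) (- 1) (K t f))) \<le> \<epsilon> * \<mu> f)"
    proof (intro exI[of _ \<delta>] conjI ballI impI)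
      fix s f assume "s \<in> {0..1}" "\<bar>s - t\<bar> < \<delta>" "f \<in> topspace (vb_total (ks_bundle Z))"
      then show "\<mu> (vb_add (ks_bundle Z) (K s f) (vb_scale (ks_bundle Z) (- 1) (K t f))) \<le> \<epsilon> * \<mu> f"
        by (intro est H t \<delta>(2))
    qed (rule \<delta>(1))
  qed (use H gr \<nu> in auto)
  then show ?thesis unfolding ksys_null_def by blast
qed

text \<open>\<open>\<phi>\<close> is linear on fibres and has zero kernel. It may cover a map of
  base spaces, as the projection from a pullback to the original bundle does.\<close>

lemma fibre_norm_comp:
  assumes \<nu>: "fibre_norm E \<nu>" and cont: "continuous_map (vb_total F) (vb_total E) \<phi>"
    and scale: "\<And>f c. f \<in> topspace (vb_total F) \<Longrightarrow> \<phi> (vb_scale F c f) = vb_scale E c (\<phi> f)"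
    and add: "\<And>f f'. f \<in> topspace (vb_total F) \<Longrightarrow> f' \<in> topspace (vb_total F) \<Longrightarrow> vb_proj F f' = vb_proj F f \<Longrightarrow>
      \<phi> (vb_add F f f') = vb_add E (\<phi> f) (\<phi> f') \<and> vb_proj E (\<phi> f') = vb_proj E (\<phi> f)"
    and inj: "\<And>f. f \<in> topspace (vb_total F) \<Longrightarrow> \<phi> f = \<phi> (vb_scale F 0 f) \<Longrightarrow> f = vb_scale F 0 f"
  shows "fibre_norm F (\<lambda>f. \<nu> (\<phi> f))"
  unfolding fibre_norm_def
proof (intro conjI ballI allI)
  have N: "0 \<le> \<nu> e \<and> (\<nu> e = 0 \<longleftrightarrow> e = vb_scale E 0 e) \<and> (\<forall>c. \<nu> (vb_scale E c e) = cmod c * \<nu> e) \<and>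
        (\<forall>e'\<in>vb_fibre E (vb_proj E e). \<nu> (vb_add E e e') \<le> \<nu> e + \<nu> e')" if "e \<in> topspace (vb_total E)" for e
    using \<nu> that unfolding fibre_norm_def by blast
  have t: "\<phi> f \<in> topspace (vb_total E)" if "f \<in> topspace (vb_total F)" for f
    using continuous_map_in[OF cont that] .
  show "continuous_map (vb_total F) euclideanreal (\<lambda>f. \<nu> (\<phi> f))"
    by (rule continuous_map_comp2[OF cont]) (use \<nu> in \<open>simp add: fibre_norm_def\<close>)
  fix f assume f: "f \<in> topspace (vb_total F)"
  show "0 \<le> \<nu> (\<phi> f)" using N t f by blast
  have "\<nu> (\<phi> f) = 0 \<longleftrightarrow> \<phi> f = \<phi> (vb_scale F 0 f)" using N[OF t[OF f]] scale[OF f, of 0] by simp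
  then show "\<nu> (\<phi> f) = 0 \<longleftrightarrow> f = vb_scale F 0 f" using inj[OF f] by metis
  show "\<nu> (\<phi> (vb_scale F c f)) = cmod c * \<nu> (\<phi> f)" for c using N[OF t[OF f]] scale[OF f] by simp
  fix f' assume "f' \<in> vb_fibre F (vb_proj F f)"
  then have f': "f' \<in> topspace (vb_total F)" "vb_proj F f' = vb_proj F f" by (simp_all add: vb_fibre_def)
  have "\<phi> f' \<in> vb_fibre E (vb_proj E (\<phi> f))" using add[OF f f'] t f' by (simp add: vb_fibre_def)
  then show "\<nu> (\<phi> (vb_add F f f')) \<le> \<nu> (\<phi> f) + \<nu> (\<phi> f')"
    using N[OF t[OF f]] add[OF f f'] by simp
qed

text \<open>The homotopy is conjugated by the isomorphism, and vectors of \<open>Z\<close> are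
  measured by the norm of \<open>X\<close> through \<open>k\<close>, so the estimate carries over
  literally.\<close>

lemma ksys_null_iso:
  assumes X: "is_ksys GG Y Y' N X" and Z: "is_ksys GG Y Y' N Z" and "ksys_iso GG Y N X Z"
    and null: "ksys_null GG Y Y' N X"
  shows "ksys_null GG Y Y' N Z"
proof -
  obtain h k where h: "ksys_iso_via GG Y N X Z h k" using assms(3) unfolding ksys_iso_def by blast
  interpret X: ksystem GG Y Y' N X using X by unfold_locales
  interpret Z: ksystem GG Y Y' N Z using Z by unfold_locales
  note v = ksys_iso_viaD[OF h] and w = ksys_iso_viaD[OF ksys_iso_via_sym[OF X Z h]]
  obtain H \<nu> where n: "ksys_null_via GG Y Y' N X H \<nu>" using null unfolding ksys_null_def by blast
  show ?thesis
  proof (rule ksys_null_transfer[OF n, where \<mu> = "\<lambda>f. \<nu> (k f)" and K = "\<lambda>t f. h (H t (k f))"])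
    show "fibre_norm (ks_bundle Z) (\<lambda>f. \<nu> (k f))"
    proof (rule fibre_norm_comp[where E = "ks_bundle X" and \<nu> = \<nu> and \<phi> = k])
      show "fibre_norm (ks_bundle X) \<nu>" using n by (simp add: ksys_null_via_def)
      fix f assume f: "f \<in> Z.tot" "k f = k (vb_scale (ks_bundle Z) 0 f)"
      then have "h (k f) = h (k (vb_scale (ks_bundle Z) 0 f))" by simp
      then show "f = vb_scale (ks_bundle Z) 0 f" using f(1) by (simp add: v(4))
    qed (simp_all add: Z.bm_scale[OF w(1)] Z.bm_add[OF w(1)] Z.bm_total[OF w(1)] g_bundle_map_cont[OF w(1)])
    show "sys_grading GG Y (ks_bundle Z) N (ks_gen Z) (\<lambda>f. h (H t (k f)))"
      if "sys_grading GG Y (ks_bundle X) N (ks_gen X) (H t)" for t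
      by (rule grading_transport[OF X.g_vector_bundle Z.g_vector_bundle v(1) v(2) X.ks_gen_map that])
        (simp_all add: v(4,6,7))
    show "\<nu> (k (vb_add (ks_bundle Z) (h (H s (k f))) (vb_scale (ks_bundle Z) (- 1) (h (H t (k f)))))) \<le> \<epsilon> * \<nu> (k f)"
      if "sys_grading GG Y (ks_bundle X) N (ks_gen X) (H s)" "sys_grading GG Y (ks_bundle X) N (ks_gen X) (H t)"
        "f \<in> Z.tot" "\<And>e. e \<in> X.tot \<Longrightarrow>
         \<nu> (vb_add (ks_bundle X) (H s e) (vb_scale (ks_bundle X) (- 1) (H t e))) \<le> \<epsilon> * \<nu> e" for s t f \<epsilon>
      using that(4)[OF v(6)[OF that(3)]] that(3)
      by (simp add: Z.bm_add[OF w(1)] Z.bm_scale[OF w(1)] X.bm_total[OF v(1)] Z.bm_total[OF w(1)]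
          X.grading(1,2)[OF that(1)] X.grading(1,2)[OF that(2)] v(3))
  qed (simp_all add: v Z.bm_total[OF w(1)])
qed

lemma ksys_null_pullback:
  assumes null: "ksys_null GG Z Z' N X" and X: "is_ksys GG Z Z' N X"
    and f: "equivariant_map GG Y Z f" and fY: "f ` Y' \<subseteq> Z'"
  shows "ksys_null GG Y Y' N (ksys_pullback Y f X)"
proof -
  interpret X: ksystem GG Z Z' N X using X by unfold_locales
  obtain H \<nu> where n: "ksys_null_via GG Z Z' N X H \<nu>" using null unfolding ksys_null_def by blast
  have nn: "fibre_norm (ks_bundle X) \<nu>" using n by (simp add: ksys_null_via_def)
  have P: "ks_bundle (ksys_pullback Y f X) = pullback_bundle Y f (ks_bundle X)" by (simp add: ksys_pullback_def)
  show ?thesis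
  proof (rule ksys_null_transfer[OF n, where \<mu> = "\<lambda>p. \<nu> (snd p)" and K = "\<lambda>t. map_prod id (H t)"]; unfold P)
    show "fibre_norm (pullback_bundle Y f (ks_bundle X)) (\<lambda>p. \<nu> (snd p))"
    proof (rule fibre_norm_comp[OF nn pullback_bundle_cont_snd])
      fix p assume "snd p = snd (vb_scale (pullback_bundle Y f (ks_bundle X)) 0 p)"
      then show "p = vb_scale (pullback_bundle Y f (ks_bundle X)) 0 p"
        by (rule prod_eqI[rotated]) simp
    qed auto
    show "sys_grading GG Y (pullback_bundle Y f (ks_bundle X)) N (ks_gen (ksys_pullback Y f X)) (map_prod id (H t))"
      if "sys_grading GG Z (ks_bundle X) N (ks_gen X) (H t)" for t
      using that g_bundle_map_pullback[OF X.g_vector_bundle f, of "ks_bundle X" "H t"]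
      by (auto simp: sys_grading_def ksys_pullback_def)
  qed (use fY in \<open>auto simp: ksys_pullback_def\<close>)
qed

section \<open>Doubling as an equivalence between \<open>N\<close> and \<open>N + 2\<close>
  involutions\<close>

section \<open>Doubling a system\<close>

text \<open>The operator \<open>\<eta> \<otimes> \<sigma>\<^sub>z\<close> on
  \<open>E \<otimes> \<complex>\<^sup>2\<close>. The sign on the second summand makes it anticommute
  with \<open>\<sigma>\<^sub>x\<close> and \<open>\<sigma>\<^sub>y\<close>; it cancels in a product
  of two such operators, so their mutual relations persist. Gradings are doubled in this way
  too.\<close>

definition graded_double :: "('e, 'y, 'g) vbundle \<Rightarrow> ('e \<Rightarrow> 'e) \<Rightarrow> 'e \<times> 'e \<Rightarrow> 'e \<times> 'e" where
  "graded_double E \<eta> = (\<lambda>p. (\<eta> (fst p), vb_scale E (- 1) (\<eta> (snd p))))"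

text \<open>The generators act on \<open>E \<otimes> \<complex>\<^sup>2\<close> through the Pauli matrices: \<open>g\<^sub>i \<otimes> \<sigma>\<^sub>z\<close> for the old ones, and
  \<open>1 \<otimes> \<sigma>\<^sub>x\<close>, \<open>1 \<otimes> \<sigma>\<^sub>y\<close> for the two new ones.\<close>

definition ksys_double :: "nat \<Rightarrow> ('e, 'y, 'g) ksys \<Rightarrow> ('e \<times> 'e, 'y, 'g) ksys" where
  "ksys_double N X = \<lparr>ks_bundle = whitney_sum (ks_bundle X) (ks_bundle X),
     ks_gen = (\<lambda>i. if i < N then graded_double (ks_bundle X) (ks_gen X i)
        else if i = N then (\<lambda>p. (snd p, fst p))
        else (\<lambda>p. (vb_scale (ks_bundle X) (- \<i>) (snd p), vb_scale (ks_bundle X) \<i> (fst p)))),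
     ks_eta1 = graded_double (ks_bundle X) (ks_eta1 X),
     ks_eta2 = graded_double (ks_bundle X) (ks_eta2 X)\<rparr>"

lemma ksys_double_simps [simp]:
  "ks_bundle (ksys_double N X) = whitney_sum (ks_bundle X) (ks_bundle X)"
  "i < N \<Longrightarrow> ks_gen (ksys_double N X) i p = graded_double (ks_bundle X) (ks_gen X i) p"
  "ks_gen (ksys_double N X) N p = (snd p, fst p)"
  "ks_gen (ksys_double N X) (Suc N) p = (vb_scale (ks_bundle X) (- \<i>) (snd p), vb_scale (ks_bundle X) \<i> (fst p))"
  "ks_eta1 (ksys_double N X) = graded_double (ks_bundle X) (ks_eta1 X)"
  "ks_eta2 (ksys_double N X) = graded_double (ks_bundle X) (ks_eta2 X)"
  by (simp_all add: ksys_double_def)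

lemma g_bundle_map_graded_double:
  assumes E: "g_vector_bundle GG Y E" and h: "g_bundle_map GG Y E E h"
  shows "g_bundle_map GG Y (whitney_sum E E) (whitney_sum E E) (graded_double E h)"
proof -
  have W: "g_vector_bundle GG Y (whitney_sum E E)" using E by simp
  show ?thesis
    unfolding graded_double_def
    by (rule g_bundle_map_pair[OF g_bundle_map_comp[OF W g_bundle_map_fst h]
          g_bundle_map_scale[OF W E g_bundle_map_comp[OF W g_bundle_map_snd h]] W])
qed

lemma less_Suc_SucE: "i < Suc (Suc N) \<Longrightarrow> i < N \<or> i = N \<or> i = Suc N"
  by auto

lemma sys_grading_double:
  assumes X: "is_ksys GG Y Y' N X" and \<eta>: "sys_grading GG Y (ks_bundle X) N (ks_gen X) \<eta>"
  shows "sys_grading GG Y (whitney_sum (ks_bundle X) (ks_bundle X)) (Suc (Suc N)) (ks_gen (ksys_double N X))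
    (graded_double (ks_bundle X) \<eta>)"
proof -
  interpret X: ksystem GG Y Y' N X using X by unfold_locales
  note [simp] = X.grading[OF \<eta>] graded_double_def
  show ?thesis
  proof (rule sys_gradingI)
    show "g_bundle_map GG Y (whitney_sum (ks_bundle X) (ks_bundle X)) (whitney_sum (ks_bundle X) (ks_bundle X))
        (graded_double (ks_bundle X) \<eta>)"
      using \<eta> by (intro g_bundle_map_graded_double[OF X.g_vector_bundle]) (simp add: sys_grading_def)
    fix p assume p: "p \<in> topspace (vb_total (whitney_sum (ks_bundle X) (ks_bundle X)))"
    show "graded_double (ks_bundle X) \<eta> (graded_double (ks_bundle X) \<eta> p) = p"
      by (intro prod_eqI X.eqI) (use p in simp_all)
    fix i assume "i < Suc (Suc N)"
    then show "graded_double (ks_bundle X) \<eta> (ks_gen (ksys_double N X) i p) =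
        vb_scale (whitney_sum (ks_bundle X) (ks_bundle X)) (- 1) (ks_gen (ksys_double N X) i (graded_double (ks_bundle X) \<eta> p))"
      using p by (elim less_Suc_SucE[THEN disjE] disjE; intro prod_eqI X.eqI; simp)
  qed
qed

lemma is_ksys_double:
  assumes X: "is_ksys GG Y Y' N X"
  shows "is_ksys GG Y Y' (Suc (Suc N)) (ksys_double N X)"
proof -
  interpret X: ksystem GG Y Y' N X using X by unfold_locales
  let ?E = "ks_bundle X" and ?W = "whitney_sum (ks_bundle X) (ks_bundle X)"
  have W: "g_vector_bundle GG Y ?W" using X.g_vector_bundle by simp
  show ?thesis
  proof (rule is_ksysI; unfold ksys_double_simps(1,5,6))
    show "anticommuting GG Y ?W (Suc (Suc N)) (\<lambda>_. 1) (ks_gen (ksys_double N X))"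
    proof (rule anticommutingI)
      fix i assume i: "i < Suc (Suc N)"
      have "g_bundle_map GG Y ?W ?W (\<lambda>p. (snd p, fst p))"
        by (rule g_bundle_map_pair[OF g_bundle_map_snd g_bundle_map_fst W])
      moreover have "g_bundle_map GG Y ?W ?W (\<lambda>p. (vb_scale ?E (- \<i>) (snd p), vb_scale ?E \<i> (fst p)))"
        by (rule g_bundle_map_pair[OF g_bundle_map_scale[OF W X.g_vector_bundle g_bundle_map_snd]
              g_bundle_map_scale[OF W X.g_vector_bundle g_bundle_map_fst] W])
      ultimately show "g_bundle_map GG Y ?W ?W (ks_gen (ksys_double N X) i)"
        using g_bundle_map_graded_double[OF X.g_vector_bundle X.ks_gen_map[of i]]
        by (simp add: ksys_double_def)
      fix p assume p: "p \<in> topspace (vb_total ?W)"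
      show "ks_gen (ksys_double N X) i (ks_gen (ksys_double N X) i p) = vb_scale ?W 1 p"
        using i p by (elim less_Suc_SucE[THEN disjE] disjE; intro prod_eqI X.eqI; simp add: graded_double_def)
      fix j assume j: "j < Suc (Suc N)" "i \<noteq> j"
      show "ks_gen (ksys_double N X) i (ks_gen (ksys_double N X) j p) =
          vb_scale ?W (- 1) (ks_gen (ksys_double N X) j (ks_gen (ksys_double N X) i p))"
        using less_Suc_SucE[OF i] less_Suc_SucE[OF j(1)] j(2) p
        by (elim disjE; intro prod_eqI X.eqI; simp add: graded_double_def X.ks_anticommute[of i j])
    qed
    show "graded_double ?E (ks_eta1 X) p = graded_double ?E (ks_eta2 X) p"
      if "p \<in> topspace (vb_total ?W)" "vb_proj ?W p \<in> Y'" for p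
      using that X.ks_eta_eq by (simp add: graded_double_def)
  qed (rule W sys_grading_double[OF X X.ks_eta1] sys_grading_double[OF X X.ks_eta2])+
qed

lemma ksys_iso_double:
  assumes X: "is_ksys GG Y Y' N X" and Z: "is_ksys GG Y Y' N Z" and "ksys_iso GG Y N X Z"
  shows "ksys_iso GG Y (Suc (Suc N)) (ksys_double N X) (ksys_double N Z)"
proof -
  obtain h k where h: "ksys_iso_via GG Y N X Z h k" using assms(3) unfolding ksys_iso_def by blast
  interpret X: ksystem GG Y Y' N X using X by unfold_locales
  interpret Z: ksystem GG Y Y' N Z using Z by unfold_locales
  note v = ksys_iso_viaD[OF h] and w = ksys_iso_viaD[OF ksys_iso_via_sym[OF X Z h]]
  let ?W = "whitney_sum (ks_bundle X) (ks_bundle X)" and ?V = "whitney_sum (ks_bundle Z) (ks_bundle Z)"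
  have b: "g_bundle_map GG Y ?W ?V (map_prod h h)"
    by (rule g_bundle_map_map_prod[OF X.g_vector_bundle X.g_vector_bundle v(1) v(1)])
  have b': "g_bundle_map GG Y ?V ?W (map_prod k k)"
    by (rule g_bundle_map_map_prod[OF Z.g_vector_bundle Z.g_vector_bundle w(1) w(1)])
  have "homeomorphic_maps (vb_total ?W) (vb_total ?V) (map_prod h h) (map_prod k k)"
    unfolding homeomorphic_maps_def using g_bundle_map_cont[OF b] g_bundle_map_cont[OF b'] by (auto simp: v)
  then have "ksys_iso_via GG Y (Suc (Suc N)) (ksys_double N X) (ksys_double N Z) (map_prod h h) (map_prod k k)"
    unfolding ksys_iso_via_def using b
    by (auto dest!: less_Suc_SucE simp: v graded_double_def X.bm_scale[OF v(1)])
  then show ?thesis unfolding ksys_iso_def by blast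
qed

text \<open>Let \<open>J\<close> be \<open>\<i>\<close> on the first and \<open>- \<i>\<close> on
  the second summand. On the first summand \<open>J\<close> is the scalar \<open>\<i>\<close>, so a
  complex linear map commuting with \<open>J\<close> sends it to vectors on which \<open>J\<close>
  is again \<open>\<i>\<close>, and those have second component zero. The term
  \<open>vb_scale E 0 x\<close> stands for the zero vector in the fibre of \<open>x\<close>.\<close>

lemma double_half:
  assumes E: "g_vector_bundle GG Y E" and F: "g_vector_bundle GG Y F"
    and \<phi>: "g_bundle_map GG Y (whitney_sum E E) (whitney_sum F F) \<phi>"
    and J: "\<And>p. p \<in> topspace (vb_total (whitney_sum E E)) \<Longrightarrow>
      \<phi> (vb_scale E \<i> (fst p), vb_scale E (- \<i>) (snd p)) = (vb_scale F \<i> (fst (\<phi> p)), vb_scale F (- \<i>) (snd (\<phi> p)))"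
    and x: "x \<in> topspace (vb_total E)"
  shows "\<phi> (x, vb_scale E 0 x) = (fst (\<phi> (x, vb_scale E 0 x)), vb_scale F 0 (fst (\<phi> (x, vb_scale E 0 x))))"
proof -
  interpret E: g_bundle GG Y E using E by unfold_locales
  interpret F: g_bundle GG Y F using F by unfold_locales
  interpret W: g_bundle GG Y "whitney_sum E E" using E by unfold_locales simp
  let ?p = "(x, vb_scale E 0 x)"
  have p: "?p \<in> topspace (vb_total (whitney_sum E E))" using x by simp
  have b: "fst (\<phi> ?p) \<in> topspace (vb_total F)" "snd (\<phi> ?p) \<in> topspace (vb_total F)"
      "vb_proj F (snd (\<phi> ?p)) = vb_proj F (fst (\<phi> ?p))"
    using W.bm_total(1)[OF \<phi> p] by simp_all
  have "(vb_scale E \<i> (fst ?p), vb_scale E (- \<i>) (snd ?p)) = vb_scale (whitney_sum E E) \<i> ?p"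
    by (intro prod_eqI E.eqI) (use x in simp_all)
  then have "vb_scale (whitney_sum F F) \<i> (\<phi> ?p) = (vb_scale F \<i> (fst (\<phi> ?p)), vb_scale F (- \<i>) (snd (\<phi> ?p)))"
    using J[OF p] W.bm_scale[OF \<phi> p] by metis
  then have "vb_scale F \<i> (snd (\<phi> ?p)) = vb_scale F (- \<i>) (snd (\<phi> ?p))" by simp
  then have "\<i> * vb_coord (gs_total Y) F (snd (\<phi> ?p)) i = - \<i> * vb_coord (gs_total Y) F (snd (\<phi> ?p)) i" for i
    using F.coord_scale[OF b(2)] by metis
  then have "vb_coord (gs_total Y) F (snd (\<phi> ?p)) i = 0" for i by simp
  then have "snd (\<phi> ?p) = vb_scale F 0 (fst (\<phi> ?p))"
    by (intro F.eqI) (use b in simp_all)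
  then show ?thesis by (metis prod.collapse)
qed

lemma g_bundle_map_half:
  assumes E: "g_vector_bundle GG Y E"
    and \<phi>: "g_bundle_map GG Y (whitney_sum E E) (whitney_sum F F) \<phi>"
  shows "g_bundle_map GG Y E F (\<lambda>x. fst (\<phi> (x, vb_scale E 0 x)))"
  by (rule g_bundle_map_comp[OF E g_bundle_map_comp[OF E
        g_bundle_map_pair[OF g_bundle_map_id g_bundle_map_scale[OF E E g_bundle_map_id] E] \<phi>] g_bundle_map_fst])

text \<open>An isomorphism of doubles commutes with both new generators, hence with their product
  \<open>J\<close>. So it restricts to the first summands, on which the remaining operators are
  those of \<open>X\<close> and \<open>Z\<close>.\<close>

lemma ksys_iso_double_reflect:
  assumes X: "is_ksys GG Y Y' N X" and Z: "is_ksys GG Y Y' N Z"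
    and "ksys_iso GG Y (Suc (Suc N)) (ksys_double N X) (ksys_double N Z)"
  shows "ksys_iso GG Y N X Z"
proof -
  obtain h k where h: "ksys_iso_via GG Y (Suc (Suc N)) (ksys_double N X) (ksys_double N Z) h k"
    using assms(3) unfolding ksys_iso_def by blast
  interpret X: ksystem GG Y Y' N X using X by unfold_locales
  interpret Z: ksystem GG Y Y' N Z using Z by unfold_locales
  note v = ksys_iso_viaD[OF h]
    and w = ksys_iso_viaD[OF ksys_iso_via_sym[OF is_ksys_double[OF X] is_ksys_double[OF Z] h]]
  let ?E = "ks_bundle X" and ?F = "ks_bundle Z"
  let ?W = "whitney_sum ?E ?E" and ?V = "whitney_sum ?F ?F"
  have hm: "g_bundle_map GG Y ?W ?V h" and km: "g_bundle_map GG Y ?V ?W k" using v(1) w(1) by simp_all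
  \<comment> \<open>Generator \<open>N\<close> applied after generator \<open>Suc N\<close> is
    \<open>J\<close>: the swap turns \<open>(- \<i> y, \<i> x)\<close> into
    \<open>(\<i> x, - \<i> y)\<close>.\<close>
  have hJ: "h (vb_scale ?E \<i> (fst p), vb_scale ?E (- \<i>) (snd p)) = (vb_scale ?F \<i> (fst (h p)), vb_scale ?F (- \<i>) (snd (h p)))"
    if p: "p \<in> topspace (vb_total ?W)" for p
    using v(7)[of N "ks_gen (ksys_double N X) (Suc N) p"] v(7)[of "Suc N" p] p by simp
  have kJ: "k (vb_scale ?F \<i> (fst p), vb_scale ?F (- \<i>) (snd p)) = (vb_scale ?E \<i> (fst (k p)), vb_scale ?E (- \<i>) (snd (k p)))"
    if p: "p \<in> topspace (vb_total ?V)" for p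
    using w(7)[of N "ks_gen (ksys_double N Z) (Suc N) p"] w(7)[of "Suc N" p] p by simp
  define h0 where "h0 x = fst (h (x, vb_scale ?E 0 x))" for x
  define k0 where "k0 x = fst (k (x, vb_scale ?F 0 x))" for x
  have hh: "h (x, vb_scale ?E 0 x) = (h0 x, vb_scale ?F 0 (h0 x))" if "x \<in> X.tot" for x
    unfolding h0_def by (rule double_half[OF X.g_vector_bundle Z.g_vector_bundle hm _ that]) (rule hJ)
  have kk: "k (x, vb_scale ?F 0 x) = (k0 x, vb_scale ?E 0 (k0 x))" if "x \<in> Z.tot" for x
    unfolding k0_def by (rule double_half[OF Z.g_vector_bundle X.g_vector_bundle km _ that]) (rule kJ)
  have m: "g_bundle_map GG Y ?E ?F h0" "g_bundle_map GG Y ?F ?E k0"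
    unfolding h0_def k0_def
    by (rule g_bundle_map_half[OF X.g_vector_bundle hm] g_bundle_map_half[OF Z.g_vector_bundle km])+
  have kh: "k0 (h0 x) = x" if "x \<in> X.tot" for x
  proof -
    have "k (h0 x, vb_scale ?F 0 (h0 x)) = (x, vb_scale ?E 0 x)"
      unfolding hh[OF that, symmetric] using that by (intro v(3)) simp
    then show ?thesis by (simp add: k0_def)
  qed
  have hk: "h0 (k0 x) = x" if "x \<in> Z.tot" for x
  proof -
    have "h (k0 x, vb_scale ?E 0 (k0 x)) = (x, vb_scale ?F 0 x)"
      unfolding kk[OF that, symmetric] using that by (intro v(4)) simp
    then show ?thesis by (simp add: h0_def)
  qed
  \<comment> \<open>The sign in \<open>graded_double\<close> sits on the second summand and has no
    effect on vectors whose second component is zero.\<close>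
  have int: "h0 (a x) = b (h0 x)"
    if x: "x \<in> X.tot" and a: "g_bundle_map GG Y ?E ?E a"
      and ab: "h (graded_double ?E a (x, vb_scale ?E 0 x)) = graded_double ?F b (h (x, vb_scale ?E 0 x))" for x a b
  proof -
    have "graded_double ?E a (x, vb_scale ?E 0 x) = (a x, vb_scale ?E 0 (a x))"
      unfolding graded_double_def
      by (intro prod_eqI X.eqI) (use x X.bm_total[OF a] X.bm_scale[OF a] in simp_all)
    then show ?thesis using ab by (simp add: h0_def graded_double_def)
  qed
  have "ksys_iso_via GG Y N X Z h0 k0"
    unfolding ksys_iso_via_def homeomorphic_maps_def
  proof (intro conjI ballI allI impI)
    fix e assume e: "e \<in> X.tot"
    then have p: "(e, vb_scale ?E 0 e) \<in> topspace (vb_total (ks_bundle (ksys_double N X)))" by simp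
    show "h0 (ks_gen X i e) = ks_gen Z i (h0 e)" if "i < N" for i
      by (rule int[OF e X.ks_gen_map[OF that]]) (use v(7)[OF _ p, of i] that in simp)
    show "h0 (ks_eta1 X e) = ks_eta1 Z (h0 e)"
      by (rule int[OF e X.ks_eta_map(1)]) (use v(8)[OF p] in simp)
    show "h0 (ks_eta2 X e) = ks_eta2 Z (h0 e)"
      by (rule int[OF e X.ks_eta_map(2)]) (use v(9)[OF p] in simp)
  qed (simp_all add: m kh hk g_bundle_map_cont[OF m(1)] g_bundle_map_cont[OF m(2)])
  then show ?thesis unfolding ksys_iso_def by blast
qed

lemma whitney_sum_shuffle:
  assumes "g_vector_bundle GG Y E" "g_vector_bundle GG Y F" "g_vector_bundle GG Y G" "g_vector_bundle GG Y H"
  shows "g_bundle_map GG Y (whitney_sum (whitney_sum E F) (whitney_sum G H)) (whitney_sum (whitney_sum E G) (whitney_sum F H))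
     (\<lambda>p. ((fst (fst p), fst (snd p)), (snd (fst p), snd (snd p))))"
proof -
  have W: "g_vector_bundle GG Y (whitney_sum (whitney_sum E F) (whitney_sum G H))" using assms by simp
  note c = g_bundle_map_comp[OF W g_bundle_map_fst] g_bundle_map_comp[OF W g_bundle_map_snd]
  show ?thesis
    by (rule g_bundle_map_pair[OF
          g_bundle_map_pair[OF c(1)[OF g_bundle_map_fst] c(2)[OF g_bundle_map_fst] W]
          g_bundle_map_pair[OF c(1)[OF g_bundle_map_snd] c(2)[OF g_bundle_map_snd] W] W])
qed

text \<open>The middle two of the four summands are exchanged. The same formula gives the
  inverse.\<close>

lemma ksys_double_sum_iso:
  assumes X: "is_ksys GG Y Y' N X" and Z: "is_ksys GG Y Y' N Z"
  shows "ksys_iso GG Y (Suc (Suc N)) (ksys_double N (ksys_sum X Z)) (ksys_sum (ksys_double N X) (ksys_double N Z))"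
proof -
  interpret X: ksystem GG Y Y' N X using X by unfold_locales
  interpret Z: ksystem GG Y Y' N Z using Z by unfold_locales
  let ?s = "\<lambda>p. ((fst (fst p), fst (snd p)), (snd (fst p), snd (snd p)))"
  have "ksys_iso_via GG Y (Suc (Suc N)) (ksys_double N (ksys_sum X Z)) (ksys_sum (ksys_double N X) (ksys_double N Z)) ?s ?s"
    unfolding ksys_iso_via_def homeomorphic_maps_def
    using whitney_sum_shuffle[OF X.g_vector_bundle Z.g_vector_bundle X.g_vector_bundle Z.g_vector_bundle]
      whitney_sum_shuffle[OF X.g_vector_bundle X.g_vector_bundle Z.g_vector_bundle Z.g_vector_bundle]
    by (auto dest!: less_Suc_SucE simp: ksys_sum_def graded_double_def g_bundle_map_cont)
  then show ?thesis unfolding ksys_iso_def by blast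
qed

lemma ksys_pullback_double_iso:
  assumes X: "is_ksys GG Z Z' N X" and f: "equivariant_map GG Y Z f"
  shows "ksys_iso GG Y (Suc (Suc N)) (ksys_pullback Y f (ksys_double N X)) (ksys_double N (ksys_pullback Y f X))"
proof -
  have E: "g_vector_bundle GG Z (ks_bundle X)" using X by (simp add: is_ksys_def)
  show ?thesis
    unfolding ksys_iso_def ksys_iso_via_def
    using pullback_whitney_sum[OF E E f]
    by (intro exI conjI) (auto dest!: less_Suc_SucE simp: ksys_pullback_def graded_double_def)
qed

lemma fibre_norm_sum:
  assumes E: "g_vector_bundle GG Y E" and \<nu>: "fibre_norm E \<nu>"
  shows "fibre_norm (whitney_sum E E) (\<lambda>p. \<nu> (fst p) + \<nu> (snd p))"
proof -
  have N: "0 \<le> \<nu> e" "\<nu> e = 0 \<longleftrightarrow> e = vb_scale E 0 e" "\<nu> (vb_scale E c e) = cmod c * \<nu> e"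
    if "e \<in> topspace (vb_total E)" for e c
    using \<nu> that unfolding fibre_norm_def by blast+
  have tri: "\<nu> (vb_add E e e') \<le> \<nu> e + \<nu> e'"
    if "e \<in> topspace (vb_total E)" "e' \<in> topspace (vb_total E)" "vb_proj E e' = vb_proj E e" for e e'
    using \<nu> that unfolding fibre_norm_def vb_fibre_def by blast
  have c: "continuous_map (vb_total E) euclideanreal \<nu>" using \<nu> by (simp add: fibre_norm_def)
  show ?thesis
    unfolding fibre_norm_def
  proof (intro conjI ballI allI)
    show "continuous_map (vb_total (whitney_sum E E)) euclideanreal (\<lambda>p. \<nu> (fst p) + \<nu> (snd p))"
      by (intro continuous_map_add continuous_map_comp2[OF whitney_sum_cont_fst c] continuous_map_comp2[OF whitney_sum_cont_snd c])
    fix p assume "p \<in> topspace (vb_total (whitney_sum E E))"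
    then have p: "fst p \<in> topspace (vb_total E)" "snd p \<in> topspace (vb_total E)" "vb_proj E (snd p) = vb_proj E (fst p)"
      by simp_all
    show "0 \<le> \<nu> (fst p) + \<nu> (snd p)" using N(1) p by simp
    show "\<nu> (fst p) + \<nu> (snd p) = 0 \<longleftrightarrow> p = vb_scale (whitney_sum E E) 0 p"
      using N(1,2)[OF p(1)] N(1,2)[OF p(2)] by (auto simp: prod_eq_iff)
    show "\<nu> (fst (vb_scale (whitney_sum E E) c p)) + \<nu> (snd (vb_scale (whitney_sum E E) c p)) = cmod c * (\<nu> (fst p) + \<nu> (snd p))" for c
      using N(3)[OF p(1)] N(3)[OF p(2)] by (simp add: algebra_simps)
    fix q assume "q \<in> vb_fibre (whitney_sum E E) (vb_proj (whitney_sum E E) p)"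
    then have q: "fst q \<in> topspace (vb_total E)" "snd q \<in> topspace (vb_total E)"
      "vb_proj E (fst q) = vb_proj E (fst p)" "vb_proj E (snd q) = vb_proj E (snd p)"
      using p by (auto simp: vb_fibre_def)
    show "\<nu> (fst (vb_add (whitney_sum E E) p q)) + \<nu> (snd (vb_add (whitney_sum E E) p q)) \<le>
        \<nu> (fst p) + \<nu> (snd p) + (\<nu> (fst q) + \<nu> (snd q))"
      using tri[OF p(1) q(1,3)] tri[OF p(2) q(2,4)] by simp
  qed
qed

text \<open>The homotopy is doubled parameter by parameter. If a pair is measured by the sum of the
  norms of its components, the estimate holds with the same \<open>\<epsilon>\<close>.\<close>

lemma ksys_null_double:
  assumes X: "is_ksys GG Y Y' N X" and null: "ksys_null GG Y Y' N X"
  shows "ksys_null GG Y Y' (Suc (Suc N)) (ksys_double N X)"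
proof -
  interpret X: ksystem GG Y Y' N X using X by unfold_locales
  let ?E = "ks_bundle X"
  obtain H \<nu> where n: "ksys_null_via GG Y Y' N X H \<nu>" using null unfolding ksys_null_def by blast
  have nn: "fibre_norm ?E \<nu>" using n by (simp add: ksys_null_via_def)
  show ?thesis
  proof (rule ksys_null_transfer[OF n, where \<mu> = "\<lambda>p. \<nu> (fst p) + \<nu> (snd p)" and K = "\<lambda>t. graded_double ?E (H t)"];
      unfold ksys_double_simps(1,5,6))
    show "fibre_norm (whitney_sum ?E ?E) (\<lambda>p. \<nu> (fst p) + \<nu> (snd p))"
      by (rule fibre_norm_sum[OF X.g_vector_bundle nn])
    show "sys_grading GG Y (whitney_sum ?E ?E) (Suc (Suc N)) (ks_gen (ksys_double N X)) (graded_double ?E (H t))"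
      if "sys_grading GG Y ?E N (ks_gen X) (H t)" for t
      by (rule sys_grading_double[OF X that])
    fix s t p \<epsilon> assume s: "sys_grading GG Y ?E N (ks_gen X) (H s)" and t: "sys_grading GG Y ?E N (ks_gen X) (H t)"
      and p: "p \<in> topspace (vb_total (whitney_sum ?E ?E))"
      and est: "\<And>e. e \<in> X.tot \<Longrightarrow> \<nu> (vb_add ?E (H s e) (vb_scale ?E (- 1) (H t e))) \<le> \<epsilon> * \<nu> e"
    note [simp] = X.grading(1,2)[OF s] X.grading(1,2)[OF t]
    let ?d = "\<lambda>e. vb_add ?E (H s e) (vb_scale ?E (- 1) (H t e))"
    \<comment> \<open>On the second summand the difference of two gradings only changes its sign,
      which the norm ignores.\<close>
    have "vb_add ?E (vb_scale ?E (- 1) (H s (snd p))) (vb_scale ?E (- 1) (vb_scale ?E (- 1) (H t (snd p)))) =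
        vb_scale ?E (- 1) (?d (snd p))"
      by (rule X.eqI) (use p in simp_all)
    moreover have "\<nu> (vb_scale ?E (- 1) (?d (snd p))) = \<nu> (?d (snd p))"
    proof -
      have "?d (snd p) \<in> X.tot" using p by simp
      then have "\<nu> (vb_scale ?E (- 1) (?d (snd p))) = cmod (- 1) * \<nu> (?d (snd p))"
        using nn unfolding fibre_norm_def by blast
      then show ?thesis by simp
    qed
    ultimately show "\<nu> (fst (vb_add (whitney_sum ?E ?E) (graded_double ?E (H s) p) (vb_scale (whitney_sum ?E ?E) (- 1) (graded_double ?E (H t) p)))) +
        \<nu> (snd (vb_add (whitney_sum ?E ?E) (graded_double ?E (H s) p) (vb_scale (whitney_sum ?E ?E) (- 1) (graded_double ?E (H t) p))))
        \<le> \<epsilon> * (\<nu> (fst p) + \<nu> (snd p))"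
      using est[of "fst p"] est[of "snd p"] p by (simp add: graded_double_def algebra_simps)
  qed (simp_all add: graded_double_def)
qed

text \<open>A grading anticommutes with both new generators. The two signs cancel in their product
  \<open>J\<close>, so \<open>double_half\<close> applies to every \<open>H t\<close>, and the
  homotopy restricts to the first summand together with the norm.\<close>

lemma ksys_null_double_reflect:
  assumes X: "is_ksys GG Y Y' N X" and null: "ksys_null GG Y Y' (Suc (Suc N)) (ksys_double N X)"
  shows "ksys_null GG Y Y' N X"
proof -
  interpret X: ksystem GG Y Y' N X using X by unfold_locales
  interpret D: ksystem GG Y Y' "Suc (Suc N)" "ksys_double N X" using is_ksys_double[OF X] by unfold_locales
  let ?E = "ks_bundle X" and ?W = "whitney_sum (ks_bundle X) (ks_bundle X)"
  let ?z = "\<lambda>x. (x, vb_scale (ks_bundle X) 0 x)"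
  obtain H \<nu> where n: "ksys_null_via GG Y Y' (Suc (Suc N)) (ksys_double N X) H \<nu>" using null unfolding ksys_null_def by blast
  have nn: "fibre_norm ?W \<nu>" using n by (simp add: ksys_null_via_def)
  have zm: "g_bundle_map GG Y ?E ?W ?z"
    by (rule g_bundle_map_pair[OF g_bundle_map_id g_bundle_map_scale[OF X.g_vector_bundle X.g_vector_bundle g_bundle_map_id] X.g_vector_bundle])
  have zp: "?z x \<in> topspace (vb_total ?W)" if "x \<in> X.tot" for x using that by simp
  have Hz: "H t (?z x) = ?z (fst (H t (?z x)))"
    if t: "sys_grading GG Y (ks_bundle (ksys_double N X)) (Suc (Suc N)) (ks_gen (ksys_double N X)) (H t)" and x: "x \<in> X.tot" for t x
  proof (rule double_half[OF X.g_vector_bundle X.g_vector_bundle _ _ x])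
    show "g_bundle_map GG Y ?W ?W (H t)" using t by (simp add: sys_grading_def)
    fix p assume p: "p \<in> topspace (vb_total ?W)"
    have "H t p \<in> topspace (vb_total ?W)" using D.grading(1)[OF t, of p] p by simp
    then show "H t (vb_scale ?E \<i> (fst p), vb_scale ?E (- \<i>) (snd p)) = (vb_scale ?E \<i> (fst (H t p)), vb_scale ?E (- \<i>) (snd (H t p)))"
      using D.grading(6)[OF t, of N "ks_gen (ksys_double N X) (Suc N) p"] D.grading(6)[OF t, of "Suc N" p] p
      by (auto intro!: prod_eqI X.eqI)
  qed
  have gz: "ks_gen (ksys_double N X) i (?z x) = ?z (ks_gen X i x)" if "i < N" "x \<in> X.tot" for i x
    using that unfolding graded_double_def by (intro prod_eqI X.eqI) (simp_all add: graded_double_def)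
  show ?thesis
  proof (rule ksys_null_transfer[OF n, where \<mu> = "\<lambda>x. \<nu> (?z x)" and K = "\<lambda>t x. fst (H t (?z x))"])
    show "fibre_norm ?E (\<lambda>x. \<nu> (?z x))"
    proof (rule fibre_norm_comp[OF nn g_bundle_map_cont[OF zm]])
      show "?z (vb_scale ?E c x) = vb_scale ?W c (?z x)" if "x \<in> X.tot" for c x
        by (rule X.bm_scale[OF zm that])
      show "?z (vb_add ?E x x') = vb_add ?W (?z x) (?z x') \<and> vb_proj ?W (?z x') = vb_proj ?W (?z x)"
        if "x \<in> X.tot" "x' \<in> X.tot" "vb_proj ?E x' = vb_proj ?E x" for x x'
        using X.bm_add[OF zm that] that by simp
    qed simp
    show "sys_grading GG Y ?E N (ks_gen X) (\<lambda>x. fst (H t (?z x)))"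
      if t: "sys_grading GG Y (ks_bundle (ksys_double N X)) (Suc (Suc N)) (ks_gen (ksys_double N X)) (H t)" for t
    proof (rule sys_gradingI)
      show "g_bundle_map GG Y ?E ?E (\<lambda>x. fst (H t (?z x)))"
        by (rule g_bundle_map_half[OF X.g_vector_bundle]) (use t in \<open>simp add: sys_grading_def\<close>)
      fix x assume x: "x \<in> X.tot"
      show "fst (H t (?z (fst (H t (?z x))))) = x"
        unfolding Hz[OF t x, symmetric] using D.grading(5)[OF t, of "?z x"] x by simp
      fix i assume i: "i < N"
      have "H t (?z (ks_gen X i x)) = vb_scale ?W (- 1) (ks_gen (ksys_double N X) i (H t (?z x)))"
        unfolding gz[OF i x, symmetric] using D.grading(6)[OF t, of i "?z x"] i x by simp
      then show "fst (H t (?z (ks_gen X i x))) = vb_scale ?E (- 1) (ks_gen X i (fst (H t (?z x))))"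
        using i by (simp add: graded_double_def)
    qed
    show "fst (H 0 (?z x)) = ks_eta1 X x \<and> fst (H 1 (?z x)) = ks_eta2 X x"
      if "x \<in> X.tot" "\<And>e. e \<in> topspace (vb_total (ks_bundle (ksys_double N X))) \<Longrightarrow>
        H 0 e = ks_eta1 (ksys_double N X) e \<and> H 1 e = ks_eta2 (ksys_double N X) e" for x
      using that(2)[of "?z x"] that(1) by (simp add: graded_double_def)
    show "fst (H t (?z x)) = fst (H 0 (?z x))"
      if "x \<in> X.tot" "vb_proj ?E x \<in> Y'" "\<And>e. e \<in> topspace (vb_total (ks_bundle (ksys_double N X))) \<Longrightarrow>
        vb_proj (ks_bundle (ksys_double N X)) e \<in> Y' \<Longrightarrow> H t e = H 0 e" for t x
      using that(3)[of "?z x"] that(1,2) by simp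
    fix s t x \<epsilon>
    assume s: "sys_grading GG Y (ks_bundle (ksys_double N X)) (Suc (Suc N)) (ks_gen (ksys_double N X)) (H s)"
      and t: "sys_grading GG Y (ks_bundle (ksys_double N X)) (Suc (Suc N)) (ks_gen (ksys_double N X)) (H t)"
      and x: "x \<in> X.tot"
      and est: "\<And>e. e \<in> topspace (vb_total (ks_bundle (ksys_double N X))) \<Longrightarrow>
         \<nu> (vb_add (ks_bundle (ksys_double N X)) (H s e) (vb_scale (ks_bundle (ksys_double N X)) (- 1) (H t e))) \<le> \<epsilon> * \<nu> e"
    have a: "fst (H s (?z x)) \<in> X.tot" "vb_proj ?E (fst (H s (?z x))) = vb_proj ?E x"
      "fst (H t (?z x)) \<in> X.tot" "vb_proj ?E (fst (H t (?z x))) = vb_proj ?E x"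
      using D.grading(1,2)[OF s, of "?z x"] D.grading(1,2)[OF t, of "?z x"] x by simp_all
    have "?z (vb_add ?E (fst (H s (?z x))) (vb_scale ?E (- 1) (fst (H t (?z x))))) =
        vb_add ?W (?z (fst (H s (?z x)))) (vb_scale ?W (- 1) (?z (fst (H t (?z x)))))"
      by (intro prod_eqI X.eqI) (use a in simp_all)
    also have "\<dots> = vb_add ?W (H s (?z x)) (vb_scale ?W (- 1) (H t (?z x)))"
      unfolding Hz[OF s x, symmetric] Hz[OF t x, symmetric] ..
    finally show "\<nu> (?z (vb_add ?E (fst (H s (?z x))) (vb_scale ?E (- 1) (fst (H t (?z x)))))) \<le> \<epsilon> * \<nu> (?z x)"
      using est[of "?z x"] x by simp
  qed
qed

text \<open>With \<open>a\<close>, \<open>b\<close> the last two generators, the involution \<open>- \<i> a b\<close> commutes with everything else, and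
  \<open>a\<close> exchanges its two eigenbundles.\<close>

lemma ksys_double_essentially_surjective:
  fixes M :: "('e, 'y, 'g) ksys"
  assumes M: "is_ksys GG Y Y' (Suc (Suc N)) M"
  obtains X :: "('e, 'y, 'g) ksys" where "is_ksys GG Y Y' N X" "ksys_iso GG Y (Suc (Suc N)) (ksys_double N X) M"
proof -
  interpret M: ksystem GG Y Y' "Suc (Suc N)" M using M by unfold_locales
  let ?E = "ks_bundle M"
  define a where "a = ks_gen M N"
  define b where "b = ks_gen M (Suc N)"
  \<comment> \<open>\<open>- \<i> a b\<close> squares to \<open>1\<close> because \<open>a\<close>
    and \<open>b\<close> are anticommuting involutions; \<open>P\<close> is the projection onto its
    \<open>1\<close>-eigenbundle.\<close>
  define P where "P e = vb_scale ?E (1/2) (vb_add ?E e (vb_scale ?E (- \<i>) (a (b e))))" for e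
  have ab [simp]: "b (a e) = vb_scale ?E (- 1) (a (b e))" if "e \<in> M.tot" for e
    using M.ks_anticommute[of "Suc N" N] that by (simp add: a_def b_def)
  have ag [simp]: "a (ks_gen M i e) = vb_scale ?E (- 1) (ks_gen M i (a e))"
    "b (ks_gen M i e) = vb_scale ?E (- 1) (ks_gen M i (b e))" if "i < N" "e \<in> M.tot" for i e
    using M.ks_anticommute[of N i] M.ks_anticommute[of "Suc N" i] that by (simp_all add: a_def b_def)
  have am: "g_bundle_map GG Y ?E ?E a" and bm: "g_bundle_map GG Y ?E ?E b"
    by (simp_all add: a_def b_def M.ks_gen_map)
  note [simp] = M.bm_total[OF am] M.bm_add[OF am] M.bm_scale[OF am] M.bm_total[OF bm] M.bm_add[OF bm] M.bm_scale[OF bm]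
  have aa [simp]: "a (a e) = e" "b (b e) = e" if "e \<in> M.tot" for e
    using that by (simp_all add: a_def b_def)
  have eta [simp]: "\<eta> (a e) = vb_scale ?E (- 1) (a (\<eta> e))" "\<eta> (b e) = vb_scale ?E (- 1) (b (\<eta> e))"
    if "sys_grading GG Y ?E (Suc (Suc N)) (ks_gen M) \<eta>" "e \<in> M.tot" for \<eta> e
    using M.grading(6)[OF that(1)] that(2) by (simp_all add: a_def b_def)
  have Pm: "g_bundle_map GG Y ?E ?E P"
    unfolding P_def
    by (rule g_bundle_map_scale[OF M.g_vector_bundle M.g_vector_bundle g_bundle_map_add[OF M.g_vector_bundle M.g_vector_bundle
          g_bundle_map_id g_bundle_map_scale[OF M.g_vector_bundle M.g_vector_bundle g_bundle_map_comp[OF M.g_vector_bundle bm am]]]])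
  note [simp] = M.bm_total[OF Pm]
  have PP: "P (P e) = P e" if "e \<in> M.tot" for e
    by (rule M.eqI) (use that in \<open>simp_all add: P_def algebra_simps\<close>)
  let ?S = "vb_sub P ?E"
  have S: "g_vector_bundle GG Y ?S" by (rule g_vector_bundle_vb_sub[OF M.g_vector_bundle Pm PP])
  have sub: "g_bundle_map GG Y ?S ?S h"
    if h: "g_bundle_map GG Y ?E ?E h" and hP: "\<And>e. e \<in> M.tot \<Longrightarrow> P (h e) = h (P e)" for h
    by (rule g_bundle_map_into_vb_sub[OF g_bundle_map_comp[OF S g_bundle_map_vb_sub_incl h]]) (simp add: hP)
  have gP: "P (ks_gen M i e) = ks_gen M i (P e)" if "i < N" "e \<in> M.tot" for i e
    by (rule M.eqI) (use that in \<open>simp_all add: P_def algebra_simps\<close>)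
  have etaP: "P (\<eta> e) = \<eta> (P e)" if \<eta>: "sys_grading GG Y ?E (Suc (Suc N)) (ks_gen M) \<eta>" and e: "e \<in> M.tot" for \<eta> e
    by (rule M.eqI) (use e in \<open>simp_all add: P_def M.grading[OF \<eta>] eta[OF \<eta>] algebra_simps\<close>)
  define X where "X = M\<lparr>ks_bundle := ?S\<rparr>"
  have X [simp]: "ks_bundle X = ?S" "ks_gen X = ks_gen M" "ks_eta1 X = ks_eta1 M" "ks_eta2 X = ks_eta2 M"
    by (simp_all add: X_def)
  have grS: "sys_grading GG Y ?S N (ks_gen M) \<eta>" if \<eta>: "sys_grading GG Y ?E (Suc (Suc N)) (ks_gen M) \<eta>" for \<eta>
  proof (rule sys_gradingI)
    show "g_bundle_map GG Y ?S ?S \<eta>"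
      by (rule sub) (use \<eta> etaP[OF \<eta>] in \<open>simp_all add: sys_grading_def\<close>)
  qed (simp_all add: M.grading[OF \<eta>])
  have isX: "is_ksys GG Y Y' N X"
  proof (rule is_ksysI; unfold X)
    show "anticommuting GG Y ?S N (\<lambda>_. 1) (ks_gen M)"
    proof (rule anticommutingI)
      show "g_bundle_map GG Y ?S ?S (ks_gen M i)" if "i < N" for i
        by (rule sub) (use that M.ks_gen_map[of i] gP in simp_all)
      show "ks_gen M i (ks_gen M j e) = vb_scale ?S (- 1) (ks_gen M j (ks_gen M i e))"
        if "i < N" "j < N" "i \<noteq> j" "e \<in> topspace (vb_total ?S)" for i j e
        using M.ks_anticommute[of i j e] that by simp
    qed simp
  qed (use S grS M.ks_eta1 M.ks_eta2 M.ks_eta_eq in simp_all)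
  let ?W = "whitney_sum ?S ?S"
  have W: "g_vector_bundle GG Y ?W" using S by simp
  \<comment> \<open>Since \<open>a\<close> identifies the two eigenbundles, \<open>x + a y\<close>
    is the decomposition of a vector into its eigencomponents. \<open>P m\<close> recovers
    \<open>x\<close>, and \<open>P (a m)\<close> recovers \<open>y\<close> because \<open>a\<close>
    is an involution.\<close>
  define h where "h p = vb_add ?E (fst p) (a (snd p))" for p
  define k where "k m = (P m, P (a m))" for m
  have hm: "g_bundle_map GG Y ?W ?E h"
    unfolding h_def
    by (rule g_bundle_map_add[OF W M.g_vector_bundle g_bundle_map_comp[OF W g_bundle_map_fst g_bundle_map_vb_sub_incl]
          g_bundle_map_comp[OF W g_bundle_map_comp[OF W g_bundle_map_snd g_bundle_map_vb_sub_incl] am]])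
  have km: "g_bundle_map GG Y ?E ?W k"
    unfolding k_def
    by (rule g_bundle_map_pair[OF g_bundle_map_into_vb_sub[OF Pm]
          g_bundle_map_into_vb_sub[OF g_bundle_map_comp[OF M.g_vector_bundle am Pm]] M.g_vector_bundle]) (simp_all add: PP)
  \<comment> \<open>Applying \<open>a\<close> to \<open>- \<i> a b x = x\<close> gives
    \<open>- \<i> b x = a x\<close>, that is \<open>b x = \<i> a x\<close>. By this rule
    \<open>b\<close> corresponds to the second new generator of the double.\<close>
  have bx: "b x = vb_scale ?E \<i> (a x)" if x: "x \<in> M.tot" and Px: "P x = x" for x
  proof -
    have "vb_coord (gs_total Y) ?E (P x) i = vb_coord (gs_total Y) ?E x i" for i using Px by simp
    then have "vb_coord (gs_total Y) ?E x i + \<i> * vb_coord (gs_total Y) ?E (a (b x)) i = 0" for i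
      using x by (simp add: P_def field_simps)
    then have "vb_coord (gs_total Y) ?E x i = - (\<i> * vb_coord (gs_total Y) ?E (a (b x)) i)" for i
      by (simp add: eq_neg_iff_add_eq_0)
    then have "vb_scale ?E (- \<i>) (a (b x)) = x"
      by (intro M.eqI) (use x in simp_all)
    then have "a (vb_scale ?E (- \<i>) (a (b x))) = a x" by simp
    then have eq: "vb_scale ?E (- \<i>) (b x) = a x" using x by simp
    show ?thesis unfolding eq[symmetric] by (rule M.eqI) (use x in simp_all)
  qed
  have kh: "k (h p) = p" if "p \<in> topspace (vb_total ?W)" for p
  proof -
    have p: "fst p \<in> M.tot" "snd p \<in> M.tot" "vb_proj ?E (snd p) = vb_proj ?E (fst p)" "P (fst p) = fst p" "P (snd p) = snd p"
      using that by simp_all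
    show ?thesis
      unfolding k_def h_def P_def
      by (intro prod_eqI M.eqI) (use p in \<open>simp_all add: bx field_simps\<close>)
  qed
  \<comment> \<open>This is the identity \<open>P + a P a = 1\<close>: conjugation by
    \<open>a\<close> turns \<open>P\<close> into the complementary projection.\<close>
  have hk: "h (k m) = m" if "m \<in> M.tot" for m
    unfolding k_def h_def P_def
    by (intro M.eqI) (use that in \<open>simp_all add: field_simps\<close>)
  have "ksys_iso_via GG Y (Suc (Suc N)) (ksys_double N X) M h k"
    unfolding ksys_iso_via_def homeomorphic_maps_def
  proof (intro conjI ballI allI impI)
    fix p assume "p \<in> topspace (vb_total (ks_bundle (ksys_double N X)))"
    then have p: "fst p \<in> M.tot" "snd p \<in> M.tot" "vb_proj ?E (snd p) = vb_proj ?E (fst p)" "P (fst p) = fst p" "P (snd p) = snd p"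
      by simp_all
    fix i assume "i < Suc (Suc N)"
    then consider "i < N" | "i = N" | "i = Suc N" by linarith
    then show "h (ks_gen (ksys_double N X) i p) = ks_gen M i (h p)"
    proof cases
      case 1
      then show ?thesis
        by (intro M.eqI) (use p in \<open>simp_all add: h_def graded_double_def\<close>)
    next
      case 2
      then show ?thesis
        unfolding 2 a_def[symmetric]
        by (intro M.eqI) (use p in \<open>simp_all add: h_def\<close>)
    next
      case 3
      then show ?thesis
        unfolding 3 b_def[symmetric]
        by (intro M.eqI) (use p in \<open>simp_all add: h_def bx\<close>)
    qed
  next
    fix p assume "p \<in> topspace (vb_total (ks_bundle (ksys_double N X)))"
    then have p: "fst p \<in> M.tot" "snd p \<in> M.tot" "vb_proj ?E (snd p) = vb_proj ?E (fst p)"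
      by simp_all
    show "h (ks_eta1 (ksys_double N X) p) = ks_eta1 M (h p)"
      by (intro M.eqI) (use p in \<open>simp_all add: h_def graded_double_def eta[OF M.ks_eta1]\<close>)
    show "h (ks_eta2 (ksys_double N X) p) = ks_eta2 M (h p)"
      by (intro M.eqI) (use p in \<open>simp_all add: h_def graded_double_def eta[OF M.ks_eta2]\<close>)
  qed (use hm km g_bundle_map_cont[OF hm] g_bundle_map_cont[OF km] hk kh in auto)
  then show thesis using that[OF isX] unfolding ksys_iso_def by blast
qed

section \<open>From generators and relations to natural isomorphisms of groups\<close>

section \<open>Quotients of free abelian groups\<close>

lemma free_relations_subgroup:
  assumes "Rel \<subseteq> carrier (free_Abelian_group A)"
  shows "subgroup (generate (free_Abelian_group A) Rel) (free_Abelian_group A)"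
  using group.generate_is_subgroup[OF group_free_Abelian_group assms] .

text \<open>Supplies the subgroup and coset laws in the additive notation of the free abelian group,
  where elements are congruent when their difference lies in \<open>R\<close>.\<close>

locale free_subgroup =
  fixes A :: "'a set" and R :: "('a \<Rightarrow>\<^sub>0 int) set"
  assumes subgroup: "subgroup R (free_Abelian_group A)"
begin

lemma R_keys: "r \<in> R \<Longrightarrow> Poly_Mapping.keys r \<subseteq> A"
  using subgroup.mem_carrier[OF subgroup, of r] by simp

lemma R_zero: "0 \<in> R"
  using subgroup.one_closed[OF subgroup] by simp

lemma R_add: "r \<in> R \<Longrightarrow> s \<in> R \<Longrightarrow> r + s \<in> R"
  using subgroup.m_closed[OF subgroup] by simp

lemma R_minus: "r \<in> R \<Longrightarrow> - r \<in> R"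
  using subgroup.m_inv_closed[OF subgroup, of r] R_keys by simp

lemma R_diff: "r \<in> R \<Longrightarrow> s \<in> R \<Longrightarrow> r - s \<in> R"
  using R_add[of r "- s"] R_minus by simp

abbreviation coset where "coset x \<equiv> R #>\<^bsub>free_Abelian_group A\<^esub> x"

lemma in_coset: "z \<in> coset x \<longleftrightarrow> z - x \<in> R"
  by (auto simp: r_coset_def) (metis add.commute diff_add_cancel)

lemma coset_eqI: assumes "x - y \<in> R" shows "coset x = coset y"
proof (rule Set.set_eqI)
  fix z
  have "z - y = (z - x) + (x - y)" "z - x = (z - y) - (x - y)" by simp_all
  then show "z \<in> coset x \<longleftrightarrow> z \<in> coset y" unfolding in_coset using assms R_add R_diff by metis
qed

lemma coset_self: "x \<in> coset x"
  by (simp add: in_coset R_zero)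

text \<open>The free group is built from its generators by differences, so congruence on generators
  propagates to all elements. It serves both for composites with an inverse and for naturality
  squares.\<close>

lemma agree_mod:
  assumes x: "Poly_Mapping.keys x \<subseteq> C"
    and \<phi>: "\<phi> 0 = 0" "\<And>u v. \<phi> (u - v) = \<phi> u - \<phi> v" and \<psi>: "\<psi> 0 = 0" "\<And>u v. \<psi> (u - v) = \<psi> u - \<psi> v"
    and gen: "\<And>c. c \<in> C \<Longrightarrow> \<phi> (frag_of c) - \<psi> (frag_of c) \<in> R"
  shows "\<phi> x - \<psi> x \<in> R"
  using x
proof (induction x rule: frag_induction)
  case (diff u v)
  have "\<phi> (u - v) - \<psi> (u - v) = (\<phi> u - \<psi> u) - (\<phi> v - \<psi> v)" by (simp add: \<phi> \<psi>)
  then show ?case using R_diff[OF diff] by simp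
qed (simp_all add: \<phi> \<psi> R_zero gen)

end

text \<open>Written in the shape of \<open>K_pullback\<close>, so that pullbacks and the periodicity
  maps are instances of one construction. The image of a coset is a single coset, which gives
  \<open>the_elem\<close> its meaning, as soon as relations are sent to relations.\<close>

definition induced_map :: "'b set \<Rightarrow> ('b \<Rightarrow>\<^sub>0 int) set \<Rightarrow> ('a \<Rightarrow> 'b) \<Rightarrow> ('a \<Rightarrow>\<^sub>0 int) set \<Rightarrow> ('b \<Rightarrow>\<^sub>0 int) set" where
  "induced_map A R \<sigma> X = the_elem ((\<lambda>x. R #>\<^bsub>free_Abelian_group A\<^esub> frag_extend (\<lambda>T. frag_of (\<sigma> T)) x) ` X)"

lemma frag_extend_generate:
  assumes R: "free_subgroup A' R'" and Rel: "Rel \<subseteq> carrier (free_Abelian_group A)"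
    and "\<And>r. r \<in> Rel \<Longrightarrow> frag_extend f r \<in> R'" and "x \<in> generate (free_Abelian_group A) Rel"
  shows "frag_extend f x \<in> R'"
proof -
  interpret free_subgroup A' R' by fact
  show ?thesis
    using assms(4)
  proof (induction rule: generate.induct)
    case (inv h)
    then have "h \<in> carrier (free_Abelian_group A)" using Rel by blast
    then have "Poly_Mapping.keys h \<subseteq> A" by simp
    then show ?case using inv assms(3) by (simp add: frag_extend_minus R_minus)
  qed (simp_all add: R_zero R_add assms(3) frag_extend_add)
qed

lemma induced_map_coset:
  assumes R: "free_subgroup A R" and R': "free_subgroup A' R'"
    and \<sigma>: "\<And>r. r \<in> R \<Longrightarrow> frag_extend (\<lambda>T. frag_of (\<sigma> T)) r \<in> R'"
  shows "induced_map A' R' \<sigma> (R #>\<^bsub>free_Abelian_group A\<^esub> x) =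
    R' #>\<^bsub>free_Abelian_group A'\<^esub> frag_extend (\<lambda>T. frag_of (\<sigma> T)) x"
proof -
  interpret R: free_subgroup A R by fact
  interpret R': free_subgroup A' R' by fact
  have "(\<lambda>z. R'.coset (frag_extend (\<lambda>T. frag_of (\<sigma> T)) z)) ` R.coset x = {R'.coset (frag_extend (\<lambda>T. frag_of (\<sigma> T)) x)}"
  proof -
    have "R'.coset (frag_extend (\<lambda>T. frag_of (\<sigma> T)) z) = R'.coset (frag_extend (\<lambda>T. frag_of (\<sigma> T)) x)"
      if "z \<in> R.coset x" for z
      by (rule R'.coset_eqI) (use that \<sigma>[of "z - x"] in \<open>simp add: R.in_coset frag_extend_diff\<close>)
    then show ?thesis
      using image_constant[OF R.coset_self[of x], of "R'.coset (frag_extend (\<lambda>T. frag_of (\<sigma> T)) x)"]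
      by (simp cong: image_cong_simp)
  qed
  then show ?thesis by (simp add: induced_map_def)
qed

lemma keys_frag_extend_of:
  assumes "Poly_Mapping.keys x \<subseteq> A" "\<And>T. T \<in> A \<Longrightarrow> \<sigma> T \<in> A'"
  shows "Poly_Mapping.keys (frag_extend (\<lambda>T. frag_of (\<sigma> T)) x) \<subseteq> A'"
  using keys_frag_extend[of "\<lambda>T. frag_of (\<sigma> T)" x] assms by auto

text \<open>\<open>\<sigma>\<close> and \<open>\<tau>\<close> will be choices of representatives,
  inverse to each other only up to relations; for the quotient groups this suffices.\<close>

lemma induced_map_iso:
  assumes R: "free_subgroup A R" and R': "free_subgroup A' R'"
    and \<sigma>: "\<And>T. T \<in> A \<Longrightarrow> \<sigma> T \<in> A'" "\<And>r. r \<in> R \<Longrightarrow> frag_extend (\<lambda>T. frag_of (\<sigma> T)) r \<in> R'"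
    and \<tau>: "\<And>S. S \<in> A' \<Longrightarrow> \<tau> S \<in> A" "\<And>r. r \<in> R' \<Longrightarrow> frag_extend (\<lambda>S. frag_of (\<tau> S)) r \<in> R"
    and inv: "\<And>T. T \<in> A \<Longrightarrow> frag_of (\<tau> (\<sigma> T)) - frag_of T \<in> R" "\<And>S. S \<in> A' \<Longrightarrow> frag_of (\<sigma> (\<tau> S)) - frag_of S \<in> R'"
  shows "induced_map A' R' \<sigma> \<in> iso (free_Abelian_group A Mod R) (free_Abelian_group A' Mod R')"
proof -
  interpret R: free_subgroup A R by fact
  interpret R': free_subgroup A' R' by fact
  let ?G = "free_Abelian_group A" and ?G' = "free_Abelian_group A'"
  let ?\<phi> = "frag_extend (\<lambda>T. frag_of (\<sigma> T))" and ?\<psi> = "frag_extend (\<lambda>S. frag_of (\<tau> S))"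
  have \<Phi>: "induced_map A' R' \<sigma> (R.coset x) = R'.coset (?\<phi> x)" for x
    by (rule induced_map_coset[OF R R']) (rule \<sigma>(2))
  have \<Psi>: "induced_map A R \<tau> (R'.coset x) = R.coset (?\<psi> x)" for x
    by (rule induced_map_coset[OF R' R]) (rule \<tau>(2))
  have k: "Poly_Mapping.keys (?\<phi> x) \<subseteq> A'" if "Poly_Mapping.keys x \<subseteq> A" for x
    by (rule keys_frag_extend_of[OF that \<sigma>(1)])
  have k': "Poly_Mapping.keys (?\<psi> x) \<subseteq> A" if "Poly_Mapping.keys x \<subseteq> A'" for x
    by (rule keys_frag_extend_of[OF that \<tau>(1)])
  interpret N: normal R ?G
    using R.subgroup comm_group.subgroup_imp_normal[OF abelian_free_Abelian_group] by blast
  interpret N': normal R' ?G'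
    using R'.subgroup comm_group.subgroup_imp_normal[OF abelian_free_Abelian_group] by blast
  have hom: "induced_map A' R' \<sigma> \<in> hom (?G Mod R) (?G' Mod R')"
  proof (rule homI)
    fix X assume "X \<in> carrier (?G Mod R)"
    then show "induced_map A' R' \<sigma> X \<in> carrier (?G' Mod R')"
      using k by (auto simp: carrier_FactGroup \<Phi>)
  next
    fix X Z assume "X \<in> carrier (?G Mod R)" "Z \<in> carrier (?G Mod R)"
    then obtain x z where x: "x \<in> carrier ?G" "X = R.coset x" and z: "z \<in> carrier ?G" "Z = R.coset z"
      by (auto simp: carrier_FactGroup)
    have "?\<phi> x \<in> carrier ?G'" "?\<phi> z \<in> carrier ?G'" using k x z by auto
    then show "induced_map A' R' \<sigma> (X \<otimes>\<^bsub>?G Mod R\<^esub> Z) = induced_map A' R' \<sigma> X \<otimes>\<^bsub>?G' Mod R'\<^esub> induced_map A' R' \<sigma> Z"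
      using x z by (simp only: mult_FactGroup N.rcos_sum N'.rcos_sum \<Phi> mult_free_Abelian_group frag_extend_add)
  qed
  have "bij_betw (induced_map A' R' \<sigma>) (carrier (?G Mod R)) (carrier (?G' Mod R'))"
  proof (rule bij_betw_byWitness[where f' = "induced_map A R \<tau>"])
    show "\<forall>X\<in>carrier (?G Mod R). induced_map A R \<tau> (induced_map A' R' \<sigma> X) = X"
    proof
      fix X assume "X \<in> carrier (?G Mod R)"
      then obtain x where x: "Poly_Mapping.keys x \<subseteq> A" "X = R.coset x" by (auto simp: carrier_FactGroup)
      have "?\<psi> (?\<phi> x) - x \<in> R"
        by (rule R.agree_mod[OF x(1), where \<psi> = "\<lambda>x. x"]) (simp_all add: frag_extend_diff inv)
      then show "induced_map A R \<tau> (induced_map A' R' \<sigma> X) = X"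
        unfolding x(2) \<Phi> \<Psi> by (rule R.coset_eqI)
    qed
    show "\<forall>X\<in>carrier (?G' Mod R'). induced_map A' R' \<sigma> (induced_map A R \<tau> X) = X"
    proof
      fix X assume "X \<in> carrier (?G' Mod R')"
      then obtain x where x: "Poly_Mapping.keys x \<subseteq> A'" "X = R'.coset x" by (auto simp: carrier_FactGroup)
      have "?\<phi> (?\<psi> x) - x \<in> R'"
        by (rule R'.agree_mod[OF x(1), where \<psi> = "\<lambda>x. x"]) (simp_all add: frag_extend_diff inv)
      then show "induced_map A' R' \<sigma> (induced_map A R \<tau> X) = X"
        unfolding x(2) \<Phi> \<Psi> by (rule R'.coset_eqI)
    qed
    show "induced_map A' R' \<sigma> ` carrier (?G Mod R) \<subseteq> carrier (?G' Mod R')"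
      using hom by (auto simp: hom_def)
    show "induced_map A R \<tau> ` carrier (?G' Mod R') \<subseteq> carrier (?G Mod R)"
      using k' by (auto simp: carrier_FactGroup \<Psi>)
  qed
  then show ?thesis using hom by (simp add: iso_def)
qed

section \<open>Correspondences of triples\<close>

abbreviation null_triple where
  "null_triple GG Y Y' p q T \<equiv> gradings_homotopic GG Y Y' p q (kt_bundle T) (kt_rep T) (kt_eta1 T) (kt_eta2 T)"

lemma equivariant_map_pair:
  assumes "compact_pair B GG Y Y'" and "pair_map GG Y Y' Z Z' f"
  shows "equivariant_map GG Y Z f" "f ` Y' \<subseteq> Z'"
  using assms unfolding equivariant_map_def compact_pair_def g_fibre_bundle_def pair_map_def by auto

lemma ksys_iso_cong:
  assumes "is_ksys GG Y Y' N X" "is_ksys GG Y Y' N X1" "is_ksys GG Y Y' N Z" "is_ksys GG Y Y' N Z1"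
    and "ksys_iso GG Y N X X1" and "ksys_iso GG Y N Z Z1"
  shows "ksys_iso GG Y N X Z \<longleftrightarrow> ksys_iso GG Y N X1 Z1"
  using assms ksys_iso_sym ksys_iso_trans by meson

text \<open>A system on any type is realized by a generator: it is copied into the fixed type by
  \<open>ksys_copy\<close> and then turned into a triple by \<open>triple_of\<close>.\<close>

lemma K_generator_copy:
  fixes X :: "('e, 'y, 'g) ksys"
  assumes X: "is_ksys GG Y Y' (p + q) X"
  obtains T where "T \<in> K_generators GG p q Y Y'" "ksys_iso GG Y (p + q) (sys_of p T) X"
proof -
  obtain Z :: "('y \<times> (nat \<Rightarrow> complex), 'y, 'g) ksys" where Z: "is_ksys GG Y Y' (p + q) Z" "ksys_iso GG Y (p + q) Z X"
    by (rule ksys_copy[OF X])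
  note T = is_ktriple_triple_of[OF Z(1)]
  show thesis
    by (rule that[of "triple_of p q Z"]) (use T ksys_iso_trans[OF is_ksys_sys_of[OF T(1)] T(2) Z(2)] in \<open>simp_all add: K_generators_def\<close>)
qed

lemma ktriple_iso_refl: "ktriple_iso GG Y p q T T"
  unfolding ktriple_iso_def by (rule exI[of _ "\<lambda>e. e"]) (simp add: g_bundle_map_id homeomorphic_map_id[unfolded id_def])

lemma K_relators_carrier: "K_relators GG p q Y Y' \<subseteq> carrier (free_Abelian_group (K_generators GG p q Y Y'))"
proof
  fix r assume "r \<in> K_relators GG p q Y Y'"
  then consider S T U where "r = frag_of S + frag_of T - frag_of U"
      "S \<in> K_generators GG p q Y Y'" "T \<in> K_generators GG p q Y Y'" "U \<in> K_generators GG p q Y Y'"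
    | T where "r = frag_of T" "T \<in> K_generators GG p q Y Y'"
    unfolding K_relators_def by blast
  then show "r \<in> carrier (free_Abelian_group (K_generators GG p q Y Y'))"
  proof cases
    case 1
    have "Poly_Mapping.keys r \<subseteq> Poly_Mapping.keys (frag_of S + frag_of T) \<union> Poly_Mapping.keys (frag_of U)"
      unfolding 1(1) by (rule keys_diff)
    also have "\<dots> \<subseteq> {S} \<union> {T} \<union> {U}" using keys_add[of "frag_of S" "frag_of T"] by auto
    finally show ?thesis using 1 by auto
  qed simp
qed

lemma K_relations_subgroup: "free_subgroup (K_generators GG p q Y Y') (K_relations GG p q Y Y')"
  by (rule free_subgroup.intro) (simp add: K_relations_def K_free_def free_relations_subgroup[OF K_relators_carrier])

lemma K_relators_in: "r \<in> K_relators GG p q Y Y' \<Longrightarrow> r \<in> K_relations GG p q Y Y'"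
  unfolding K_relations_def by (rule generate.incl)

text \<open>A copy of \<open>T \<oplus> T\<close> is also a copy of \<open>T \<oplus> T'\<close>; compare the two relators.\<close>

lemma K_class_eq:
  assumes T: "T \<in> K_generators GG p q Y Y'" and T': "T' \<in> K_generators GG p q Y Y'" and iso: "ktriple_iso GG Y p q T T'"
  shows "frag_of T - frag_of T' \<in> K_relations GG p q Y Y'"
proof -
  interpret free_subgroup "K_generators GG p q Y Y'" "K_relations GG p q Y Y'" by (rule K_relations_subgroup)
  have t: "is_ktriple GG Y Y' p q T" "is_ktriple GG Y Y' p q T'" using T T' by (simp_all add: K_generators_def)
  note s = is_ksys_sys_of[OF t(1)] is_ksys_sys_of[OF t(2)]
  note d = is_ktriple_sum[OF t(1) t(1)] is_ktriple_sum[OF t(1) t(2)]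
  obtain V where V: "V \<in> K_generators GG p q Y Y'" "ksys_iso GG Y (p + q) (sys_of p V) (sys_of p (ktriple_sum T T))"
    using K_generator_copy[OF is_ksys_sys_of[OF d(1)]] by blast
  have v: "is_ktriple GG Y Y' p q V" using V by (simp add: K_generators_def)
  have "ksys_iso GG Y (p + q) (sys_of p (ktriple_sum T T)) (sys_of p (ktriple_sum T T'))"
    unfolding sys_of_sum
    by (rule ksys_iso_sum[OF s(1) s(1) ksys_iso_refl]) (use iso ktriple_iso_iff[OF t] in simp)
  then have "ksys_iso GG Y (p + q) (sys_of p V) (sys_of p (ktriple_sum T T'))"
    by (rule ksys_iso_trans[OF is_ksys_sys_of[OF v] V(2)])
  then have "frag_of T + frag_of T - frag_of V \<in> K_relators GG p q Y Y'" "frag_of T + frag_of T' - frag_of V \<in> K_relators GG p q Y Y'"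
    using V T T' ktriple_iso_iff[OF v d(1)] ktriple_iso_iff[OF v d(2)] unfolding K_relators_def by blast+
  from R_diff[OF this[THEN K_relators_in]] show ?thesis by simp
qed

text \<open>Compatibility with relations is reduced to the two kinds of relators: sums have to be
  respected up to isomorphism, and null homotopies preserved. This is applied to pullbacks and to
  the maps chosen from a correspondence, in both directions.\<close>

lemma K_relations_map:
  assumes \<sigma>: "\<And>T. T \<in> K_generators GG p q Y Y' \<Longrightarrow> \<sigma> T \<in> K_generators GG p' q' Z Z'"
    and sum: "\<And>S T U. S \<in> K_generators GG p q Y Y' \<Longrightarrow> T \<in> K_generators GG p q Y Y' \<Longrightarrow> U \<in> K_generators GG p q Y Y' \<Longrightarrow>
      ktriple_iso GG Y p q U (ktriple_sum S T) \<Longrightarrow> ktriple_iso GG Z p' q' (\<sigma> U) (ktriple_sum (\<sigma> S) (\<sigma> T))"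
    and null: "\<And>T. T \<in> K_generators GG p q Y Y' \<Longrightarrow> null_triple GG Y Y' p q T \<Longrightarrow> null_triple GG Z Z' p' q' (\<sigma> T)"
    and r: "r \<in> K_relations GG p q Y Y'"
  shows "frag_extend (\<lambda>T. frag_of (\<sigma> T)) r \<in> K_relations GG p' q' Z Z'"
proof (rule frag_extend_generate[OF K_relations_subgroup K_relators_carrier])
  show "r \<in> generate (free_Abelian_group (K_generators GG p q Y Y')) (K_relators GG p q Y Y')"
    using r by (simp add: K_relations_def K_free_def)
  fix r assume "r \<in> K_relators GG p q Y Y'"
  then consider S T U where "r = frag_of S + frag_of T - frag_of U"
      "S \<in> K_generators GG p q Y Y'" "T \<in> K_generators GG p q Y Y'" "U \<in> K_generators GG p q Y Y'"
      "ktriple_iso GG Y p q U (ktriple_sum S T)"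
    | T where "r = frag_of T" "T \<in> K_generators GG p q Y Y'" "null_triple GG Y Y' p q T"
    unfolding K_relators_def by blast
  then show "frag_extend (\<lambda>T. frag_of (\<sigma> T)) r \<in> K_relations GG p' q' Z Z'"
  proof cases
    case 1
    then have "frag_of (\<sigma> S) + frag_of (\<sigma> T) - frag_of (\<sigma> U) \<in> K_relators GG p' q' Z Z'"
      unfolding K_relators_def using \<sigma> sum by blast
    then show ?thesis using K_relators_in unfolding 1(1) by (simp add: frag_extend_add frag_extend_diff)
  next
    case 2
    then have "frag_of (\<sigma> T) \<in> K_relators GG p' q' Z Z'"
      unfolding K_relators_def using \<sigma> null by blast
    then show ?thesis using K_relators_in unfolding 2(1) by simp
  qed
qed

text \<open>A copy of the pulled back triple exists in the fixed type, so the choice that defines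
  \<open>K_pullback_gen\<close> has the intended property.\<close>

lemma K_pullback_gen:
  fixes Y :: "('y, 'g, 'b) gspace" and Z :: "('z, 'g, 'b) gspace"
  assumes f: "equivariant_map GG Y Z f" "f ` Y' \<subseteq> Z'" and T: "T \<in> K_generators GG p q Z Z'"
  shows "K_pullback_gen GG p q Y Y' f T \<in> K_generators GG p q Y Y'"
    and "ksys_iso GG Y (p + q) (sys_of p (K_pullback_gen GG p q Y Y' f T)) (ksys_pullback Y f (sys_of p T))"
proof -
  have t: "is_ktriple GG Z Z' p q T" using T by (simp add: K_generators_def)
  note P = is_ktriple_pullback[OF t f]
  obtain S where S: "S \<in> K_generators GG p q Y Y'" "ksys_iso GG Y (p + q) (sys_of p S) (sys_of p (ktriple_pullback Y f T))"
    by (rule K_generator_copy[OF is_ksys_sys_of[OF P]])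
  have "ktriple_iso GG Y p q S (ktriple_pullback Y f T)"
    using S ktriple_iso_iff[OF _ P, where S = S] by (simp add: K_generators_def)
  then have "\<exists>S. S \<in> K_generators GG p q Y Y' \<and> ktriple_iso GG Y p q S (ktriple_pullback Y f T)" using S by blast
  from someI_ex[OF this]
  have *: "K_pullback_gen GG p q Y Y' f T \<in> K_generators GG p q Y Y'"
    "ktriple_iso GG Y p q (K_pullback_gen GG p q Y Y' f T) (ktriple_pullback Y f T)"
    unfolding K_pullback_gen_def by blast+
  then show "K_pullback_gen GG p q Y Y' f T \<in> K_generators GG p q Y Y'"
    "ksys_iso GG Y (p + q) (sys_of p (K_pullback_gen GG p q Y Y' f T)) (ksys_pullback Y f (sys_of p T))"
    using ktriple_iso_iff[OF _ P] by (auto simp: K_generators_def sys_of_pullback)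
qed

text \<open>A sum relation is carried along a chain of isomorphisms: from the chosen copy to the
  pullback, from there to the pullback of the sum, then to the sum of the pullbacks, and finally to
  the sum of the chosen copies.\<close>

lemma K_pullback_relations:
  fixes Y :: "('y, 'g, 'b) gspace" and Z :: "('z, 'g, 'b) gspace"
  assumes f: "equivariant_map GG Y Z f" "f ` Y' \<subseteq> Z'" and r: "r \<in> K_relations GG p q Z Z'"
  shows "frag_extend (\<lambda>T. frag_of (K_pullback_gen GG p q Y Y' f T)) r \<in> K_relations GG p q Y Y'"
proof (rule K_relations_map[OF _ _ _ r])
  note P = K_pullback_gen[OF f]
  let ?P = "K_pullback_gen GG p q Y Y' f"
  fix T assume T: "T \<in> K_generators GG p q Z Z'"
  then show "?P T \<in> K_generators GG p q Y Y'" by (rule P)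
  have t: "is_ktriple GG Z Z' p q T" "is_ktriple GG Y Y' p q (?P T)"
    using T P(1)[OF T] by (simp_all add: K_generators_def)
  { assume "null_triple GG Z Z' p q T"
    then have "ksys_null GG Z Z' (p + q) (sys_of p T)" using gradings_homotopic_iff[OF t(1)] by blast
    then have n: "ksys_null GG Y Y' (p + q) (ksys_pullback Y f (sys_of p T))"
      by (rule ksys_null_pullback[OF _ is_ksys_sys_of[OF t(1)] f])
    have pl: "is_ksys GG Y Y' (p + q) (ksys_pullback Y f (sys_of p T))"
      using is_ksys_sys_of[OF is_ktriple_pullback[OF t(1) f]] by (simp add: sys_of_pullback)
    have "ksys_null GG Y Y' (p + q) (sys_of p (?P T))"
      by (rule ksys_null_iso[OF pl is_ksys_sys_of[OF t(2)] ksys_iso_sym[OF is_ksys_sys_of[OF t(2)] pl P(2)[OF T]] n])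
    then show "null_triple GG Y Y' p q (?P T)" using gradings_homotopic_iff[OF t(2)] by blast }
  fix S U assume S: "S \<in> K_generators GG p q Z Z'" and U: "U \<in> K_generators GG p q Z Z'"
    and iso: "ktriple_iso GG Z p q U (ktriple_sum S T)"
  have s: "is_ktriple GG Z Z' p q S" "is_ktriple GG Y Y' p q (?P S)" and u: "is_ktriple GG Z Z' p q U" "is_ktriple GG Y Y' p q (?P U)"
    using S P(1)[OF S] U P(1)[OF U] by (simp_all add: K_generators_def)
  note st = is_ktriple_sum[OF s(1) t(1)] and Pst = is_ktriple_sum[OF s(2) t(2)]
  have pl: "is_ksys GG Y Y' (p + q) (ksys_pullback Y f (sys_of p T))" if "is_ktriple GG Z Z' p q T" for T :: "('z, 'g) kgen"
    using is_ksys_sys_of[OF is_ktriple_pullback[OF that f]] by (simp add: sys_of_pullback)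
  have 0: "ksys_iso GG Z (p + q) (sys_of p U) (ksys_sum (sys_of p S) (sys_of p T))"
    using iso ktriple_iso_iff[OF u(1) st] by (simp add: sys_of_sum)
  have 1: "ksys_iso GG Y (p + q) (ksys_pullback Y f (sys_of p U)) (ksys_pullback Y f (ksys_sum (sys_of p S) (sys_of p T)))"
    by (rule ksys_iso_pullback[OF is_ksys_sys_of[OF u(1)] _ 0 f(1)])
      (use is_ksys_sys_of[OF st] in \<open>simp add: sys_of_sum\<close>)
  have 2: "ksys_iso GG Y (p + q) (ksys_pullback Y f (ksys_sum (sys_of p S) (sys_of p T)))
      (ksys_sum (ksys_pullback Y f (sys_of p S)) (ksys_pullback Y f (sys_of p T)))"
    by (rule ksys_pullback_sum_iso[OF is_ksys_sys_of[OF s(1)] is_ksys_sys_of[OF t(1)] f(1)])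
  have 3: "ksys_iso GG Y (p + q) (ksys_sum (ksys_pullback Y f (sys_of p S)) (ksys_pullback Y f (sys_of p T)))
      (ksys_sum (sys_of p (?P S)) (sys_of p (?P T)))"
    by (rule ksys_iso_sum[OF pl[OF s(1)] pl[OF t(1)]
          ksys_iso_sym[OF is_ksys_sys_of[OF s(2)] pl[OF s(1)] P(2)[OF S]]
          ksys_iso_sym[OF is_ksys_sys_of[OF t(2)] pl[OF t(1)] P(2)[OF T]]])
  have "ksys_iso GG Y (p + q) (sys_of p (?P U)) (sys_of p (ktriple_sum (?P S) (?P T)))"
    unfolding sys_of_sum
    by (rule ksys_iso_trans[OF is_ksys_sys_of[OF u(2)] P(2)[OF U] ksys_iso_trans[OF pl[OF u(1)] 1
          ksys_iso_trans[OF _ 2 3]]])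
      (use is_ksys_sys_of[OF is_ktriple_pullback[OF st f]] in \<open>simp add: sys_of_pullback sys_of_sum\<close>)
  then show "ktriple_iso GG Y p q (?P U) (ktriple_sum (?P S) (?P T))"
    using ktriple_iso_iff[OF u(2) Pst] by blast
qed

text \<open>A correspondence relates triples of different degrees like an equivalence of categories would,
  and is stated symmetrically, so that correspondences can be inverted and composed.\<close>

definition K_correspondence ::
  "'b topology \<Rightarrow> ('g, 'b) group_bundle \<Rightarrow> nat \<Rightarrow> nat \<Rightarrow> nat \<Rightarrow> nat \<Rightarrow>
     (('y, 'g, 'b) gspace \<Rightarrow> 'y set \<Rightarrow> ('y, 'g) kgen \<Rightarrow> ('y, 'g) kgen \<Rightarrow> bool) \<Rightarrow> bool" where
  "K_correspondence B GG p q p' q' C \<longleftrightarrow>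
     (\<forall>Y Y'. compact_pair B GG Y Y' \<longrightarrow>
        (\<forall>T S. C Y Y' T S \<longrightarrow> T \<in> K_generators GG p q Y Y' \<and> S \<in> K_generators GG p' q' Y Y' \<and>
           (null_triple GG Y Y' p q T \<longleftrightarrow> null_triple GG Y Y' p' q' S)) \<and>
        (\<forall>T\<in>K_generators GG p q Y Y'. \<exists>S. C Y Y' T S) \<and>
        (\<forall>S\<in>K_generators GG p' q' Y Y'. \<exists>T. C Y Y' T S) \<and>
        (\<forall>T S T1 S1. C Y Y' T S \<longrightarrow> C Y Y' T1 S1 \<longrightarrow> (ktriple_iso GG Y p q T T1 \<longleftrightarrow> ktriple_iso GG Y p' q' S S1)) \<and>
        (\<forall>T S T1 S1 T2 S2. C Y Y' T S \<longrightarrow> C Y Y' T1 S1 \<longrightarrow> C Y Y' T2 S2 \<longrightarrow>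
           (ktriple_iso GG Y p q T (ktriple_sum T1 T2) \<longleftrightarrow> ktriple_iso GG Y p' q' S (ktriple_sum S1 S2)))) \<and>
     (\<forall>Y Y' Z Z' f. compact_pair B GG Y Y' \<longrightarrow> compact_pair B GG Z Z' \<longrightarrow> pair_map GG Y Y' Z Z' f \<longrightarrow>
        (\<forall>T S T1 S1. C Y Y' T S \<longrightarrow> C Z Z' T1 S1 \<longrightarrow>
           (ktriple_iso GG Y p q T (ktriple_pullback Y f T1) \<longleftrightarrow> ktriple_iso GG Y p' q' S (ktriple_pullback Y f S1))))"

lemma K_correspondenceD:
  assumes C: "K_correspondence B GG p q p' q' C" and Y: "compact_pair B GG Y Y'"
  shows "C Y Y' T S \<Longrightarrow> T \<in> K_generators GG p q Y Y'"
    and "C Y Y' T S \<Longrightarrow> S \<in> K_generators GG p' q' Y Y'"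
    and "C Y Y' T S \<Longrightarrow> null_triple GG Y Y' p q T \<longleftrightarrow> null_triple GG Y Y' p' q' S"
    and "T \<in> K_generators GG p q Y Y' \<Longrightarrow> \<exists>S. C Y Y' T S"
    and "S \<in> K_generators GG p' q' Y Y' \<Longrightarrow> \<exists>T. C Y Y' T S"
    and "C Y Y' T S \<Longrightarrow> C Y Y' T1 S1 \<Longrightarrow> ktriple_iso GG Y p q T T1 \<longleftrightarrow> ktriple_iso GG Y p' q' S S1"
    and "C Y Y' T S \<Longrightarrow> C Y Y' T1 S1 \<Longrightarrow> C Y Y' T2 S2 \<Longrightarrow>
      ktriple_iso GG Y p q T (ktriple_sum T1 T2) \<longleftrightarrow> ktriple_iso GG Y p' q' S (ktriple_sum S1 S2)"
    and "compact_pair B GG Z Z' \<Longrightarrow> pair_map GG Y Y' Z Z' f \<Longrightarrow> C Y Y' T S \<Longrightarrow> C Z Z' T1 S1 \<Longrightarrow>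
      ktriple_iso GG Y p q T (ktriple_pullback Y f T1) \<longleftrightarrow> ktriple_iso GG Y p' q' S (ktriple_pullback Y f S1)"
proof -
  note c = conjunct1[OF C[unfolded K_correspondence_def], rule_format, OF Y]
  show "C Y Y' T S \<Longrightarrow> T \<in> K_generators GG p q Y Y'" "C Y Y' T S \<Longrightarrow> S \<in> K_generators GG p' q' Y Y'"
    "C Y Y' T S \<Longrightarrow> null_triple GG Y Y' p q T \<longleftrightarrow> null_triple GG Y Y' p' q' S"
    using conjunct1[OF c] by blast+
  show "T \<in> K_generators GG p q Y Y' \<Longrightarrow> \<exists>S. C Y Y' T S"
    using conjunct1[OF conjunct2[OF c]] by blast
  show "S \<in> K_generators GG p' q' Y Y' \<Longrightarrow> \<exists>T. C Y Y' T S"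
    using conjunct1[OF conjunct2[OF conjunct2[OF c]]] by blast
  show "C Y Y' T S \<Longrightarrow> C Y Y' T1 S1 \<Longrightarrow> ktriple_iso GG Y p q T T1 \<longleftrightarrow> ktriple_iso GG Y p' q' S S1"
    using conjunct1[OF conjunct2[OF conjunct2[OF conjunct2[OF c]]]] by blast
  show "C Y Y' T S \<Longrightarrow> C Y Y' T1 S1 \<Longrightarrow> C Y Y' T2 S2 \<Longrightarrow>
      ktriple_iso GG Y p q T (ktriple_sum T1 T2) \<longleftrightarrow> ktriple_iso GG Y p' q' S (ktriple_sum S1 S2)"
    using conjunct2[OF conjunct2[OF conjunct2[OF conjunct2[OF c]]]] by blast
  show "compact_pair B GG Z Z' \<Longrightarrow> pair_map GG Y Y' Z Z' f \<Longrightarrow> C Y Y' T S \<Longrightarrow> C Z Z' T1 S1 \<Longrightarrow>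
      ktriple_iso GG Y p q T (ktriple_pullback Y f T1) \<longleftrightarrow> ktriple_iso GG Y p' q' S (ktriple_pullback Y f S1)"
    using conjunct2[OF C[unfolded K_correspondence_def], rule_format, OF Y] by blast
qed

lemma K_correspondenceI:
  assumes "\<And>Y Y' T S. compact_pair B GG Y Y' \<Longrightarrow> C Y Y' T S \<Longrightarrow> T \<in> K_generators GG p q Y Y'"
    and "\<And>Y Y' T S. compact_pair B GG Y Y' \<Longrightarrow> C Y Y' T S \<Longrightarrow> S \<in> K_generators GG p' q' Y Y'"
    and "\<And>Y Y' T S. compact_pair B GG Y Y' \<Longrightarrow> C Y Y' T S \<Longrightarrow>
      null_triple GG Y Y' p q T \<longleftrightarrow> null_triple GG Y Y' p' q' S"
    and "\<And>Y Y' T. compact_pair B GG Y Y' \<Longrightarrow> T \<in> K_generators GG p q Y Y' \<Longrightarrow> \<exists>S. C Y Y' T S"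
    and "\<And>Y Y' S. compact_pair B GG Y Y' \<Longrightarrow> S \<in> K_generators GG p' q' Y Y' \<Longrightarrow> \<exists>T. C Y Y' T S"
    and "\<And>Y Y' T S T1 S1. compact_pair B GG Y Y' \<Longrightarrow> C Y Y' T S \<Longrightarrow> C Y Y' T1 S1 \<Longrightarrow>
      ktriple_iso GG Y p q T T1 \<longleftrightarrow> ktriple_iso GG Y p' q' S S1"
    and "\<And>Y Y' T S T1 S1 T2 S2. compact_pair B GG Y Y' \<Longrightarrow> C Y Y' T S \<Longrightarrow> C Y Y' T1 S1 \<Longrightarrow> C Y Y' T2 S2 \<Longrightarrow>
      ktriple_iso GG Y p q T (ktriple_sum T1 T2) \<longleftrightarrow> ktriple_iso GG Y p' q' S (ktriple_sum S1 S2)"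
    and "\<And>Y Y' Z Z' f T S T1 S1. compact_pair B GG Y Y' \<Longrightarrow> compact_pair B GG Z Z' \<Longrightarrow> pair_map GG Y Y' Z Z' f \<Longrightarrow>
      C Y Y' T S \<Longrightarrow> C Z Z' T1 S1 \<Longrightarrow>
      ktriple_iso GG Y p q T (ktriple_pullback Y f T1) \<longleftrightarrow> ktriple_iso GG Y p' q' S (ktriple_pullback Y f S1)"
  shows "K_correspondence B GG p q p' q' C"
  unfolding K_correspondence_def
proof (intro conjI allI impI ballI)
qed (rule assms; assumption)+

lemma K_correspondence_converse:
  assumes C: "K_correspondence B GG p q p' q' C"
  shows "K_correspondence B GG p' q' p q (\<lambda>Y Y' S T. C Y Y' T S)"
  by (rule K_correspondenceI;
      (rule K_correspondenceD(2)[OF C] K_correspondenceD(1)[OF C] K_correspondenceD(3)[OF C, symmetric]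
         K_correspondenceD(4)[OF C] K_correspondenceD(5)[OF C] K_correspondenceD(6)[OF C, symmetric]
         K_correspondenceD(7)[OF C, symmetric] K_correspondenceD(8)[OF C, symmetric]; assumption))

lemma K_correspondence_comp:
  fixes C D :: "('y, 'g, 'b) gspace \<Rightarrow> 'y set \<Rightarrow> ('y, 'g) kgen \<Rightarrow> ('y, 'g) kgen \<Rightarrow> bool"
  assumes C: "K_correspondence B GG p q p' q' C" and D: "K_correspondence B GG p' q' p'' q'' D"
  shows "K_correspondence B GG p q p'' q'' (\<lambda>Y Y' T U. \<exists>S. C Y Y' T S \<and> D Y Y' S U)"
proof (rule K_correspondenceI)
  fix Y :: "('y, 'g, 'b) gspace" and Y' assume Y: "compact_pair B GG Y Y'"
  note c = K_correspondenceD[OF C Y] and d = K_correspondenceD[OF D Y]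
  show "T \<in> K_generators GG p q Y Y' \<Longrightarrow> \<exists>U S. C Y Y' T S \<and> D Y Y' S U" for T
    using c(2,4) d(4) by blast
  show "U \<in> K_generators GG p'' q'' Y Y' \<Longrightarrow> \<exists>T S. C Y Y' T S \<and> D Y Y' S U" for U
    using d(1,5) c(5) by blast
  fix T U assume TU: "\<exists>S. C Y Y' T S \<and> D Y Y' S U"
  then obtain S where S: "C Y Y' T S" "D Y Y' S U" by blast
  show "T \<in> K_generators GG p q Y Y'" "U \<in> K_generators GG p'' q'' Y Y'"
    using c(1)[OF S(1)] d(2)[OF S(2)] .
  show "null_triple GG Y Y' p q T \<longleftrightarrow> null_triple GG Y Y' p'' q'' U"
    using c(3)[OF S(1)] d(3)[OF S(2)] by simp
  fix T1 U1
  { assume "\<exists>S. C Y Y' T1 S \<and> D Y Y' S U1"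
    then obtain S1 where S1: "C Y Y' T1 S1" "D Y Y' S1 U1" by blast
    show "ktriple_iso GG Y p q T T1 \<longleftrightarrow> ktriple_iso GG Y p'' q'' U U1"
      using c(6)[OF S(1) S1(1)] d(6)[OF S(2) S1(2)] by simp
    fix T2 U2 assume "\<exists>S. C Y Y' T2 S \<and> D Y Y' S U2"
    then obtain S2 where S2: "C Y Y' T2 S2" "D Y Y' S2 U2" by blast
    show "ktriple_iso GG Y p q T (ktriple_sum T1 T2) \<longleftrightarrow> ktriple_iso GG Y p'' q'' U (ktriple_sum U1 U2)"
      using c(7)[OF S(1) S1(1) S2(1)] d(7)[OF S(2) S1(2) S2(2)] by simp }
  fix Z :: "('y, 'g, 'b) gspace" and Z' f assume Z: "compact_pair B GG Z Z'" "pair_map GG Y Y' Z Z' f"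
    and "\<exists>S. C Z Z' T1 S \<and> D Z Z' S U1"
  then obtain S1 where S1: "C Z Z' T1 S1" "D Z Z' S1 U1" by blast
  show "ktriple_iso GG Y p q T (ktriple_pullback Y f T1) \<longleftrightarrow> ktriple_iso GG Y p'' q'' U (ktriple_pullback Y f U1)"
    using c(8)[OF Z S(1) S1(1)] d(8)[OF Z S(2) S1(2)] by simp
qed

text \<open>\<open>S\<close> corresponds to \<open>T\<close> if it is a copy of the double of
  \<open>T\<close>. The equivalences hold because doubling both preserves and reflects isomorphisms
  and null homotopies; that every \<open>S\<close> is reached is
  \<open>ksys_double_essentially_surjective\<close>.\<close>

lemma K_correspondence_double:
  fixes GG :: "('g, 'b) group_bundle"
  assumes N: "p' + q' = Suc (Suc (p + q))"
  shows "K_correspondence B GG p q p' q' (\<lambda>(Y :: ('y, 'g, 'b) gspace) Y' T S.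
     T \<in> K_generators GG p q Y Y' \<and> S \<in> K_generators GG p' q' Y Y' \<and>
     ksys_iso GG Y (Suc (Suc (p + q))) (sys_of p' S) (ksys_double (p + q) (sys_of p T)))"
    (is "K_correspondence B GG p q p' q' ?C")
proof (rule K_correspondenceI)
  let ?M = "Suc (Suc (p + q))" and ?D = "ksys_double (p + q)"
  have T: "is_ktriple GG Y Y' p q T" if "T \<in> K_generators GG p q Y Y'" for Y :: "('y, 'g, 'b) gspace" and Y' T
    using that by (simp add: K_generators_def)
  have S: "is_ktriple GG Y Y' p' q' S" if "S \<in> K_generators GG p' q' Y Y'" for Y :: "('y, 'g, 'b) gspace" and Y' S
    using that by (simp add: K_generators_def)
  have t: "is_ksys GG Y Y' (p + q) (sys_of p T)" if "is_ktriple GG Y Y' p q T"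
    for Y :: "('y, 'g, 'b) gspace" and Y' and T :: "('e, 'y, 'g) ktriple"
    using is_ksys_sys_of that by blast
  have s: "is_ksys GG Y Y' ?M (sys_of p' S)" if "is_ktriple GG Y Y' p' q' S"
    for Y :: "('y, 'g, 'b) gspace" and Y' and S :: "('e, 'y, 'g) ktriple"
    using is_ksys_sys_of[OF that] N by simp
  note isoT = ktriple_iso_iff[where p = p and q = q] and isoS = ktriple_iso_iff[where p = p' and q = q', unfolded N]
  fix Y :: "('y, 'g, 'b) gspace" and Y' assume Y: "compact_pair B GG Y Y'"
  note tY = t[OF T, of _ Y Y'] and sY = s[OF S, of _ Y Y'] and dY = is_ksys_double[OF t[OF T, of _ Y Y']]
  { fix T assume "T \<in> K_generators GG p q Y Y'"
    then show "\<exists>S. ?C Y Y' T S"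
      using K_generator_copy[of GG Y Y' p' q' "?D (sys_of p T)"] dY[of T] unfolding N by blast }
  { fix S assume S': "S \<in> K_generators GG p' q' Y Y'"
    obtain X :: "('y \<times> (nat \<Rightarrow> complex), 'y, 'g) ksys"
      where X: "is_ksys GG Y Y' (p + q) X" "ksys_iso GG Y ?M (?D X) (sys_of p' S)"
      by (rule ksys_double_essentially_surjective[OF sY[OF S']])
    note r = is_ktriple_triple_of[OF X(1)]
    have "ksys_iso GG Y ?M (?D (sys_of p (triple_of p q X))) (sys_of p' S)"
      by (rule ksys_iso_trans[OF is_ksys_double[OF t[OF r(1)]] ksys_iso_double[OF t[OF r(1)] X(1) r(2)] X(2)])
    then have "?C Y Y' (triple_of p q X) S"
      using r(1) S' ksys_iso_sym[OF is_ksys_double[OF t[OF r(1)]] sY[OF S']] by (simp add: K_generators_def)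
    then show "\<exists>T. ?C Y Y' T S" by blast }
  fix T S assume TS: "?C Y Y' T S"
  then have T0: "T \<in> K_generators GG p q Y Y'" and S0: "S \<in> K_generators GG p' q' Y Y'"
    and c0: "ksys_iso GG Y ?M (sys_of p' S) (?D (sys_of p T))" by blast+
  show "T \<in> K_generators GG p q Y Y'" "S \<in> K_generators GG p' q' Y Y'" by (rule T0 S0)+
  have "ksys_null GG Y Y' (p + q) (sys_of p T) \<longleftrightarrow> ksys_null GG Y Y' ?M (?D (sys_of p T))"
    using ksys_null_double[OF tY[OF T0]] ksys_null_double_reflect[OF tY[OF T0]] by blast
  also have "\<dots> \<longleftrightarrow> ksys_null GG Y Y' ?M (sys_of p' S)"
    using ksys_null_iso[OF sY[OF S0] dY[OF T0] c0] ksys_null_iso[OF dY[OF T0] sY[OF S0] ksys_iso_sym[OF sY[OF S0] dY[OF T0] c0]] by blast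
  finally show "null_triple GG Y Y' p q T \<longleftrightarrow> null_triple GG Y Y' p' q' S"
    using gradings_homotopic_iff[OF T[OF T0]] gradings_homotopic_iff[OF S[OF S0]] unfolding N by simp
  \<comment> \<open>The three isomorphism clauses are instances of this statement: \<open>X\<close>
    is the system of a triple, a sum or a pullback, and \<open>Z\<close> is the same construction on
    the other side, shown each time to be isomorphic to the double of \<open>X\<close>.\<close>
  have key: "ksys_iso GG Y (p + q) (sys_of p T) X \<longleftrightarrow> ksys_iso GG Y ?M (sys_of p' S) Z"
    if X: "is_ksys GG Y Y' (p + q) X" and Z: "is_ksys GG Y Y' ?M Z" and ZX: "ksys_iso GG Y ?M Z (?D X)"
    for X :: "('e, 'y, 'g) ksys" and Z :: "('f, 'y, 'g) ksys"
  proof -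
    have "ksys_iso GG Y (p + q) (sys_of p T) X \<longleftrightarrow> ksys_iso GG Y ?M (?D (sys_of p T)) (?D X)"
      using ksys_iso_double[OF tY[OF T0] X] ksys_iso_double_reflect[OF tY[OF T0] X] by blast
    also have "\<dots> \<longleftrightarrow> ksys_iso GG Y ?M (sys_of p' S) Z"
      by (rule ksys_iso_cong[OF dY[OF T0] sY[OF S0] is_ksys_double[OF X] Z
            ksys_iso_sym[OF sY[OF S0] dY[OF T0] c0] ksys_iso_sym[OF Z is_ksys_double[OF X] ZX]])
    finally show ?thesis .
  qed
  fix T1 S1
  { assume "?C Y Y' T1 S1"
    then have T1: "T1 \<in> K_generators GG p q Y Y'" and S1: "S1 \<in> K_generators GG p' q' Y Y'"
      and c1: "ksys_iso GG Y ?M (sys_of p' S1) (?D (sys_of p T1))" by blast+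
    show "ktriple_iso GG Y p q T T1 \<longleftrightarrow> ktriple_iso GG Y p' q' S S1"
      unfolding isoT[OF T[OF T0] T[OF T1]] isoS[OF S[OF S0] S[OF S1]]
      by (rule key[OF tY[OF T1] sY[OF S1] c1])
    fix T2 S2 assume "?C Y Y' T2 S2"
    then have T2: "T2 \<in> K_generators GG p q Y Y'" and S2: "S2 \<in> K_generators GG p' q' Y Y'"
      and c2: "ksys_iso GG Y ?M (sys_of p' S2) (?D (sys_of p T2))" by blast+
    note T12 = is_ktriple_sum[OF T[OF T1] T[OF T2]] and S12 = is_ktriple_sum[OF S[OF S1] S[OF S2]]
    have X: "is_ksys GG Y Y' (p + q) (ksys_sum (sys_of p T1) (sys_of p T2))"
      using t[OF T12] by (simp add: sys_of_sum)
    have Z: "is_ksys GG Y Y' ?M (ksys_sum (sys_of p' S1) (sys_of p' S2))"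
      using s[OF S12] by (simp add: sys_of_sum)
    have "ksys_iso GG Y ?M (ksys_sum (sys_of p' S1) (sys_of p' S2)) (ksys_sum (?D (sys_of p T1)) (?D (sys_of p T2)))"
      by (rule ksys_iso_sum[OF sY[OF S1] sY[OF S2] c1 c2])
    moreover have "ksys_iso GG Y ?M (?D (ksys_sum (sys_of p T1) (sys_of p T2))) (ksys_sum (?D (sys_of p T1)) (?D (sys_of p T2)))"
      by (rule ksys_double_sum_iso[OF tY[OF T1] tY[OF T2]])
    moreover have "is_ksys GG Y Y' ?M (ksys_sum (?D (sys_of p T1)) (?D (sys_of p T2)))"
      by (rule is_ksys_sum[OF dY[OF T1] dY[OF T2]])
    ultimately have ZX: "ksys_iso GG Y ?M (ksys_sum (sys_of p' S1) (sys_of p' S2)) (?D (ksys_sum (sys_of p T1) (sys_of p T2)))"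
      using ksys_iso_trans[OF Z] ksys_iso_sym[OF is_ksys_double[OF X]] by blast
    show "ktriple_iso GG Y p q T (ktriple_sum T1 T2) \<longleftrightarrow> ktriple_iso GG Y p' q' S (ktriple_sum S1 S2)"
      unfolding isoT[OF T[OF T0] T12] isoS[OF S[OF S0] S12] sys_of_sum
      by (rule key[OF X Z ZX]) }
  fix Z :: "('y, 'g, 'b) gspace" and Z' f
  assume ZZ: "compact_pair B GG Z Z'" and f: "pair_map GG Y Y' Z Z' f" and "?C Z Z' T1 S1"
  then have T1: "T1 \<in> K_generators GG p q Z Z'" and S1: "S1 \<in> K_generators GG p' q' Z Z'"
    and c1: "ksys_iso GG Z ?M (sys_of p' S1) (?D (sys_of p T1))" by blast+
  note e = equivariant_map_pair[OF Y f]
  note T1f = is_ktriple_pullback[OF T[OF T1] e] and S1f = is_ktriple_pullback[OF S[OF S1] e]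
  have PT: "is_ksys GG Y Y' (p + q) (ksys_pullback Y f (sys_of p T1))"
    using t[OF T1f] by (simp add: sys_of_pullback)
  have PS: "is_ksys GG Y Y' ?M (ksys_pullback Y f (sys_of p' S1))"
    using s[OF S1f] by (simp add: sys_of_pullback)
  have "ksys_iso GG Y ?M (ksys_pullback Y f (sys_of p' S1)) (ksys_pullback Y f (?D (sys_of p T1)))"
    by (rule ksys_iso_pullback[OF s[OF S[OF S1]] is_ksys_double[OF t[OF T[OF T1]]] c1 e(1)])
  from ksys_iso_trans[OF PS this ksys_pullback_double_iso[OF t[OF T[OF T1]] e(1)]]
  have ZX: "ksys_iso GG Y ?M (ksys_pullback Y f (sys_of p' S1)) (?D (ksys_pullback Y f (sys_of p T1)))" .
  show "ktriple_iso GG Y p q T (ktriple_pullback Y f T1) \<longleftrightarrow> ktriple_iso GG Y p' q' S (ktriple_pullback Y f S1)"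
    unfolding isoT[OF T[OF T0] T1f] isoS[OF S[OF S0] S1f] sys_of_pullback
    by (rule key[OF PT PS ZX])
qed

lemma K_correspondence_exists:
  fixes GG :: "('g, 'b) group_bundle"
  assumes "p' + q' = p + q + 2 * k"
  shows "\<exists>C :: ('y, 'g, 'b) gspace \<Rightarrow> _. K_correspondence B GG p q p' q' C"
  using assms
proof (induction k arbitrary: p q)
  case 0
  \<comment> \<open>Equal sums do not force equal pairs. Both \<open>(p, q)\<close> and
    \<open>(p', q')\<close> are one doubling away from \<open>(p, q + 2)\<close>, so one goes up and
    comes down again.\<close>
  have "p + (q + 2) = Suc (Suc (p + q))" "p + (q + 2) = Suc (Suc (p' + q'))" using 0 by simp_all
  from K_correspondence_comp[OF K_correspondence_double[OF this(1)] K_correspondence_converse[OF K_correspondence_double[OF this(2)]]]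
  show ?case by blast
next
  case (Suc k)
  have "p + (q + 2) = Suc (Suc (p + q))" by simp
  note step = K_correspondence_double[OF this]
  obtain C :: "('y, 'g, 'b) gspace \<Rightarrow> 'y set \<Rightarrow> ('y, 'g) kgen \<Rightarrow> ('y, 'g) kgen \<Rightarrow> bool"
    where "K_correspondence B GG p (q + 2) p' q' C" using Suc.IH[of p "q + 2"] Suc.prems by auto
  from K_correspondence_comp[OF step this] show ?case by blast
qed

lemma K_pullback_eq_induced:
  "K_pullback GG p q Y Y' f = induced_map (K_generators GG p q Y Y') (K_relations GG p q Y Y') (K_pullback_gen GG p q Y Y' f)"
  by (simp add: K_pullback_def induced_map_def K_free_def fun_eq_iff)

text \<open>Choice turns the correspondence into functions \<open>\<sigma>\<close> and
  \<open>\<tau>\<close> on generators. They respect sums and null triples and are inverse up to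
  isomorphism, hence inverse on classes. Naturality likewise holds for triples up to isomorphism and
  becomes an equation of classes by \<open>K_class_eq\<close>.\<close>

lemma K_correspondence_isomorphism:
  fixes GG :: "('g, 'b) group_bundle" and C :: "('y, 'g, 'b) gspace \<Rightarrow> 'y set \<Rightarrow> ('y, 'g) kgen \<Rightarrow> ('y, 'g) kgen \<Rightarrow> bool"
  assumes C: "K_correspondence B GG p q p' q' C"
  defines "\<sigma> \<equiv> \<lambda>Y Y' T. SOME S. C Y Y' T S"
  defines "\<Phi> \<equiv> \<lambda>Y Y'. induced_map (K_generators GG p' q' Y Y') (K_relations GG p' q' Y Y') (\<sigma> Y Y')"
  shows "compact_pair B GG Y Y' \<Longrightarrow> \<Phi> Y Y' \<in> iso (K_group GG p q Y Y') (K_group GG p' q' Y Y')"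
    and "compact_pair B GG Y Y' \<Longrightarrow> compact_pair B GG Z Z' \<Longrightarrow> pair_map GG Y Y' Z Z' f \<Longrightarrow>
      x \<in> carrier (K_group GG p q Z Z') \<Longrightarrow>
      \<Phi> Y Y' (K_pullback GG p q Y Y' f x) = K_pullback GG p' q' Y Y' f (\<Phi> Z Z' x)"
proof -
  have C\<sigma>: "C Y Y' T (\<sigma> Y Y' T)" if "compact_pair B GG Y Y'" "T \<in> K_generators GG p q Y Y'" for Y Y' T
    unfolding \<sigma>_def by (rule someI_ex) (rule K_correspondenceD(4)[OF C that])
  have rel: "frag_extend (\<lambda>T. frag_of (\<sigma> Y Y' T)) r \<in> K_relations GG p' q' Y Y'"
    if Y: "compact_pair B GG Y Y'" and r: "r \<in> K_relations GG p q Y Y'" for Y Y' r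
  proof (rule K_relations_map[OF _ _ _ r])
    note c = K_correspondenceD[OF C Y]
    show "\<sigma> Y Y' T \<in> K_generators GG p' q' Y Y'" if "T \<in> K_generators GG p q Y Y'" for T
      by (rule c(2)[OF C\<sigma>[OF Y that]])
    show "ktriple_iso GG Y p' q' (\<sigma> Y Y' U) (ktriple_sum (\<sigma> Y Y' S) (\<sigma> Y Y' T))"
      if "S \<in> K_generators GG p q Y Y'" "T \<in> K_generators GG p q Y Y'" "U \<in> K_generators GG p q Y Y'"
        "ktriple_iso GG Y p q U (ktriple_sum S T)" for S T U
      using c(7)[OF C\<sigma>[OF Y that(3)] C\<sigma>[OF Y that(1)] C\<sigma>[OF Y that(2)]] that(4) by blast
    show "null_triple GG Y Y' p' q' (\<sigma> Y Y' T)" if "T \<in> K_generators GG p q Y Y'" "null_triple GG Y Y' p q T" for T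
      using c(3)[OF C\<sigma>[OF Y that(1)]] that(2) by blast
  qed
  define \<tau> where "\<tau> = (\<lambda>Y Y' S. SOME T. C Y Y' T S)"
  have C\<tau>: "C Y Y' (\<tau> Y Y' S) S" if "compact_pair B GG Y Y'" "S \<in> K_generators GG p' q' Y Y'" for Y Y' S
    unfolding \<tau>_def by (rule someI_ex) (rule K_correspondenceD(5)[OF C that])
  have rel': "frag_extend (\<lambda>T. frag_of (\<tau> Y Y' T)) r \<in> K_relations GG p q Y Y'"
    if Y: "compact_pair B GG Y Y'" and r: "r \<in> K_relations GG p' q' Y Y'" for Y Y' r
  proof (rule K_relations_map[OF _ _ _ r])
    note c = K_correspondenceD[OF C Y]
    show "\<tau> Y Y' T \<in> K_generators GG p q Y Y'" if "T \<in> K_generators GG p' q' Y Y'" for T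
      by (rule c(1)[OF C\<tau>[OF Y that]])
    show "ktriple_iso GG Y p q (\<tau> Y Y' U) (ktriple_sum (\<tau> Y Y' S) (\<tau> Y Y' T))"
      if "S \<in> K_generators GG p' q' Y Y'" "T \<in> K_generators GG p' q' Y Y'" "U \<in> K_generators GG p' q' Y Y'"
        "ktriple_iso GG Y p' q' U (ktriple_sum S T)" for S T U
      using c(7)[OF C\<tau>[OF Y that(3)] C\<tau>[OF Y that(1)] C\<tau>[OF Y that(2)]] that(4) by blast
    show "null_triple GG Y Y' p q (\<tau> Y Y' T)" if "T \<in> K_generators GG p' q' Y Y'" "null_triple GG Y Y' p' q' T" for T
      using c(3)[OF C\<tau>[OF Y that(1)]] that(2) by blast
  qed
  { assume Y: "compact_pair B GG Y Y'"
    note c = K_correspondenceD[OF C Y]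
    show "\<Phi> Y Y' \<in> iso (K_group GG p q Y Y') (K_group GG p' q' Y Y')"
      unfolding \<Phi>_def K_group_def K_free_def
    proof (rule induced_map_iso[OF K_relations_subgroup K_relations_subgroup, where \<tau> = "\<tau> Y Y'"])
      fix T assume T: "T \<in> K_generators GG p q Y Y'"
      show s: "\<sigma> Y Y' T \<in> K_generators GG p' q' Y Y'" by (rule c(2)[OF C\<sigma>[OF Y T]])
      have t: "C Y Y' (\<tau> Y Y' (\<sigma> Y Y' T)) (\<sigma> Y Y' T)" by (rule C\<tau>[OF Y s])
      show "frag_of (\<tau> Y Y' (\<sigma> Y Y' T)) - frag_of T \<in> K_relations GG p q Y Y'"
        by (rule K_class_eq[OF c(1)[OF t] T]) (use c(6)[OF t C\<sigma>[OF Y T]] ktriple_iso_refl in blast)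
    next
      fix S assume S: "S \<in> K_generators GG p' q' Y Y'"
      show t: "\<tau> Y Y' S \<in> K_generators GG p q Y Y'" by (rule c(1)[OF C\<tau>[OF Y S]])
      have s: "C Y Y' (\<tau> Y Y' S) (\<sigma> Y Y' (\<tau> Y Y' S))" by (rule C\<sigma>[OF Y t])
      show "frag_of (\<sigma> Y Y' (\<tau> Y Y' S)) - frag_of S \<in> K_relations GG p' q' Y Y'"
        by (rule K_class_eq[OF c(2)[OF s] S]) (use c(6)[OF s C\<tau>[OF Y S]] ktriple_iso_refl in blast)
    qed (rule rel[OF Y] rel'[OF Y]; assumption)+ }
  assume Y: "compact_pair B GG Y Y'" and Z: "compact_pair B GG Z Z'" and f: "pair_map GG Y Y' Z Z' f"
    and "x \<in> carrier (K_group GG p q Z Z')"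
  then obtain u where u: "Poly_Mapping.keys u \<subseteq> K_generators GG p q Z Z'"
    and x: "x = K_relations GG p q Z Z' #>\<^bsub>free_Abelian_group (K_generators GG p q Z Z')\<^esub> u"
    by (auto simp: K_group_def K_free_def carrier_FactGroup)
  note c = K_correspondenceD[OF C Y] and d = K_correspondenceD[OF C Z]
  note e = equivariant_map_pair[OF Y f]
  let ?P = "K_pullback_gen GG p q Y Y' f" and ?P' = "K_pullback_gen GG p' q' Y Y' f"
  let ?s = "\<lambda>Y Y'. frag_extend (\<lambda>T. frag_of (\<sigma> Y Y' T))"
  let ?p = "frag_extend (\<lambda>T. frag_of (?P T))" and ?p' = "frag_extend (\<lambda>T. frag_of (?P' T))"
  interpret R: free_subgroup "K_generators GG p' q' Y Y'" "K_relations GG p' q' Y Y'"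
    by (rule K_relations_subgroup)
  have coset: "induced_map (K_generators GG b c W W') (K_relations GG b c W W') \<rho>
        (K_relations GG b' c' V V' #>\<^bsub>free_Abelian_group (K_generators GG b' c' V V')\<^esub> z) =
      K_relations GG b c W W' #>\<^bsub>free_Abelian_group (K_generators GG b c W W')\<^esub> frag_extend (\<lambda>T. frag_of (\<rho> T)) z"
    if "\<And>r. r \<in> K_relations GG b' c' V V' \<Longrightarrow> frag_extend (\<lambda>T. frag_of (\<rho> T)) r \<in> K_relations GG b c W W'"
    for b c b' c' W' V' \<rho> z and W V :: "('y, 'g, 'b) gspace"
    by (rule induced_map_coset[OF K_relations_subgroup K_relations_subgroup that])
  \<comment> \<open>It is enough to compare both ways round on one triple \<open>T\<close>: the
    image of its pullback and the chosen pullback of its image are both isomorphic to the pullback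
    of \<open>\<sigma> Z Z' T\<close>.\<close>
  have "?s Y Y' (?p u) - ?p' (?s Z Z' u) \<in> K_relations GG p' q' Y Y'"
  proof (rule R.agree_mod[OF u])
    fix T assume T: "T \<in> K_generators GG p q Z Z'"
    have S: "\<sigma> Z Z' T \<in> K_generators GG p' q' Z Z'" by (rule d(2)[OF C\<sigma>[OF Z T]])
    note PT = K_pullback_gen[OF e T] and PS = K_pullback_gen[OF e S]
    have tT: "is_ktriple GG Z Z' p q T" "is_ktriple GG Y Y' p q (?P T)"
      using T PT by (simp_all add: K_generators_def)
    have tS: "is_ktriple GG Z Z' p' q' (\<sigma> Z Z' T)" "is_ktriple GG Y Y' p' q' (?P' (\<sigma> Z Z' T))"
      using S PS by (simp_all add: K_generators_def)
    have \<sigma>P: "\<sigma> Y Y' (?P T) \<in> K_generators GG p' q' Y Y'" by (rule c(2)[OF C\<sigma>[OF Y PT(1)]])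
    then have t\<sigma>P: "is_ktriple GG Y Y' p' q' (\<sigma> Y Y' (?P T))" by (simp add: K_generators_def)
    note pS = is_ktriple_pullback[OF tS(1) e]
    have "ktriple_iso GG Y p q (?P T) (ktriple_pullback Y f T)"
      using ktriple_iso_iff[OF tT(2) is_ktriple_pullback[OF tT(1) e]] PT(2) by (simp add: sys_of_pullback)
    then have "ktriple_iso GG Y p' q' (\<sigma> Y Y' (?P T)) (ktriple_pullback Y f (\<sigma> Z Z' T))"
      using c(8)[OF Z f C\<sigma>[OF Y PT(1)] C\<sigma>[OF Z T]] by blast
    then have 1: "ksys_iso GG Y (p' + q') (sys_of p' (\<sigma> Y Y' (?P T))) (sys_of p' (ktriple_pullback Y f (\<sigma> Z Z' T)))"
      using ktriple_iso_iff[OF t\<sigma>P pS] by blast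
    have 2: "ksys_iso GG Y (p' + q') (sys_of p' (ktriple_pullback Y f (\<sigma> Z Z' T))) (sys_of p' (?P' (\<sigma> Z Z' T)))"
      by (rule ksys_iso_sym[OF is_ksys_sys_of[OF tS(2)] is_ksys_sys_of[OF pS]]) (use PS(2) in \<open>simp add: sys_of_pullback\<close>)
    have "ktriple_iso GG Y p' q' (\<sigma> Y Y' (?P T)) (?P' (\<sigma> Z Z' T))"
      using ktriple_iso_iff[OF t\<sigma>P tS(2)] ksys_iso_trans[OF is_ksys_sys_of[OF t\<sigma>P] 1 2] by blast
    from K_class_eq[OF \<sigma>P PS(1) this]
    show "?s Y Y' (?p (frag_of T)) - ?p' (?s Z Z' (frag_of T)) \<in> K_relations GG p' q' Y Y'" by simp
  qed (simp_all add: frag_extend_diff)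
  then show "\<Phi> Y Y' (K_pullback GG p q Y Y' f x) = K_pullback GG p' q' Y Y' f (\<Phi> Z Z' x)"
    unfolding \<Phi>_def K_pullback_eq_induced x
    by (simp add: coset rel[OF Y] rel[OF Z] K_pullback_relations[OF e] R.coset_eqI)
qed

theorem theorem3p17:
  fixes B :: "'b topology" and GG :: "('g, 'b) group_bundle" and n :: int and p q p' q' :: nat
  assumes "compact_space B" and "Hausdorff_space B" and "lie_group_bundle B GG"
    and "n = int p - int q" and "n - 2 = int p' - int q'"
  shows "\<exists>\<Phi> :: ('y, 'g, 'b) gspace \<Rightarrow> 'y set \<Rightarrow>
               (('y, 'g) kgen \<Rightarrow>\<^sub>0 int) set \<Rightarrow> (('y, 'g) kgen \<Rightarrow>\<^sub>0 int) set.
     (\<forall>Y Y'. compact_pair B GG Y Y' \<longrightarrow>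
        \<Phi> Y Y' \<in> iso (K_group GG p q Y Y') (K_group GG p' q' Y Y')) \<and>
     (\<forall>Y Y' Z Z' f. compact_pair B GG Y Y' \<longrightarrow> compact_pair B GG Z Z' \<longrightarrow> pair_map GG Y Y' Z Z' f \<longrightarrow>
        (\<forall>x\<in>carrier (K_group GG p q Z Z').
           \<Phi> Y Y' (K_pullback GG p q Y Y' f x) = K_pullback GG p' q' Y Y' f (\<Phi> Z Z' x)))"
proof -
  have "\<exists>C :: ('y, 'g, 'b) gspace \<Rightarrow> _. K_correspondence B GG p q p' q' C"
  \<comment> \<open>Doubling only increases the number of generators, so the correspondence is built
    from the smaller sum to the larger one and inverted if necessary.\<close>
  proof (cases "p + q \<le> p' + q'")
    case True
    \<comment> \<open>As integers, the difference is \<open>2 * (q' - q - 1)\<close>.\<close>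
    have "even (int (p' + q') - int (p + q))" using assms(4,5) by presburger
    then have "even (p' + q' - (p + q))" using True by (metis even_of_nat of_nat_diff)
    then obtain k where "p' + q' = p + q + 2 * k" using True by (metis evenE le_add_diff_inverse)
    then show ?thesis by (rule K_correspondence_exists)
  next
    case False
    have "even (int (p + q) - int (p' + q'))" using assms(4,5) by presburger
    then have "even (p + q - (p' + q'))" using False by (metis even_of_nat of_nat_diff nat_le_linear)
    then obtain k where "p + q = p' + q' + 2 * k" using False by (metis evenE le_add_diff_inverse nat_le_linear)
    then obtain C :: "('y, 'g, 'b) gspace \<Rightarrow> 'y set \<Rightarrow> ('y, 'g) kgen \<Rightarrow> ('y, 'g) kgen \<Rightarrow> bool"
      where "K_correspondence B GG p' q' p q C" using K_correspondence_exists by blast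
    from K_correspondence_converse[OF this] show ?thesis by blast
  qed
  then obtain C :: "('y, 'g, 'b) gspace \<Rightarrow> 'y set \<Rightarrow> ('y, 'g) kgen \<Rightarrow> ('y, 'g) kgen \<Rightarrow> bool"
    where C: "K_correspondence B GG p q p' q' C" by blast
  show ?thesis
    by (rule exI, intro conjI allI impI ballI)
      (rule K_correspondence_isomorphism[OF C]; assumption)+
qed

end
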